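(* Let $(M^{m+d},H,g_H)$ be a compact connected sub-Riemannian manifold with $g_H=g|_H$ for a Riemannian metric $g$ on $M$, let $(N^n,h)$ be a Riemannian manifold, and let $f:M\to N$ be an exponentially subelliptic harmonic map. Let $\{f_t\}_{|t|<\epsilon}$ be a one-parameter family of maps $M\to N$ such that $(x,t)\mapsto f_t(x)$ belongs to $C^\infty(M\times(-\epsilon,\epsilon),N)$, $f_0=f$, and the variation vector field $V=\frac{\partial f_t}{\partial t}\big|_{t=0}\in\Gamma(f^{-1}TN)$ has compact support. Then $$\frac{d^2}{dt^2}E(f_t)\Big|_{t=0}=\int_M e^{\frac{|df_H|^2}{2}}\Big[\Big(\sum_{i=1}^m\langle\tilde\nabla_{e_i}V,df(e_i)\rangle\Big)^2+\sum_{i=1}^m\langle\tilde\nabla_{e_i}V,\tilde\nabla_{e_i}V\rangle-\sum_{i=1}^m\langle\tilde R(df(e_i),V)V,df(e_i)\rangle\Big]dv_g,$$ where $\tilde R$ is the curvature tensor of $N$.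
   Context: Manifolds are without boundary. Let $(M^{m+d},g)$ be a compact connected Riemannian manifold of dimension $m+d$, $H\subset TM$ a smooth subbundle of rank $m$, and $g_H=g|_H$; the triple $(M,H,g_H)$ is called a sub-Riemannian manifold (no further condition on $H$ is imposed). $TM=H\oplus H^\perp$ is the $g$-orthogonal decomposition, $\pi_H:TM\to H$ is the orthogonal projection, and $\{e_1,\dots,e_m\}$ is a local $g$-orthonormal frame of $H$. $dv_g$ is the Riemannian volume element. For a smooth map $f:M\to N$ into a Riemannian manifold $(N,h)$, $\langle\cdot,\cdot\rangle$ on $f^{-1}TN$ is induced by $h$, $\tilde\nabla$ (acting on sections of $f^{-1}TN$) is the pull-back of the Levi-Civita connection of $(N,h)$, $df_H=df\circ\pi_H$, and $|df_H|^2=\sum_{i=1}^m\langle df(e_i),df(e_i)\rangle$. The curvature convention is $\tilde R(X,Y)Z=\tilde\nabla_X\tilde\nabla_YZ-\tilde\nabla_Y\tilde\nabla_XZ-\tilde\nabla_{[X,Y]}Z$, so that $\langle\tilde R(X,Y)Y,X\rangle$ is the sectional curvature of the plane spanned by orthonormal $X,Y$. The horizontal exponential energy is $E(f)=\int_M e^{\frac{|df_H|^2}{2}}\,dv_g$. A smooth map $f$ is called exponentially subelliptic harmonic if it is a critical point of $E$, i.e. $\frac{d}{dt}E(f_t)|_{t=0}=0$ for every smooth one-parameter family $f_t$ with $f_0=f$ whose variation vector field has compact support. *)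

theory Defs
  imports "HOL-Analysis.Analysis"
begin

section \<open>Smooth functions on open subsets of Euclidean spaces\<close>

text \<open>Only meant for open \<open>S\<close>: all partial derivatives up to order \<open>k\<close> exist and are continuous.\<close>

primrec Ck_on :: "nat \<Rightarrow> 'e::euclidean_space set \<Rightarrow> ('e \<Rightarrow> 'v::real_normed_vector) \<Rightarrow> bool" where
  "Ck_on 0 S f \<longleftrightarrow> continuous_on S f"
| "Ck_on (Suc k) S f \<longleftrightarrow>
     (\<forall>x\<in>S. f differentiable (at x)) \<and>
     (\<forall>b\<in>Basis. Ck_on k S (\<lambda>x. frechet_derivative f (at x) b))"

definition smooth_on :: "'e::euclidean_space set \<Rightarrow> ('e \<Rightarrow> 'v::real_normed_vector) \<Rightarrow> bool" where
  "smooth_on S f \<longleftrightarrow> (\<forall>k. Ck_on k S f)"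


section \<open>Smooth manifolds\<close>

text \<open>A chart is its domain together with its coordinate map. The atlas need not be maximal.\<close>

type_synonym ('a, 'e) chart = "'a set \<times> ('a \<Rightarrow> 'e)"

definition chart_inv :: "('a, 'e) chart \<Rightarrow> 'e \<Rightarrow> 'a" where
  "chart_inv c = inv_into (fst c) (snd c)"

definition is_chart :: "('a::topological_space, 'e::euclidean_space) chart \<Rightarrow> bool" where
  "is_chart c \<longleftrightarrow> open (fst c) \<and> open (snd c ` fst c) \<and>
     homeomorphism (fst c) (snd c ` fst c) (snd c) (chart_inv c)"

definition atlas_carrier :: "('a, 'e) chart set \<Rightarrow> 'a set" where
  "atlas_carrier A = (\<Union>c\<in>A. fst c)"

definition smooth_atlas :: "('a::topological_space, 'e::euclidean_space) chart set \<Rightarrow> bool" where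
  "smooth_atlas A \<longleftrightarrow> (\<forall>c\<in>A. is_chart c) \<and>
     (\<forall>c\<in>A. \<forall>c'\<in>A. smooth_on (snd c ` (fst c \<inter> fst c')) (snd c' \<circ> chart_inv c))"

text \<open>The underlying space of a manifold is a whole (Hausdorff, second countable) type.\<close>

definition smooth_manifold ::
  "('a::{t2_space,second_countable_topology}, 'e::euclidean_space) chart set \<Rightarrow> bool" where
  "smooth_manifold A \<longleftrightarrow> smooth_atlas A \<and> atlas_carrier A = UNIV"

definition smooth_map :: "('a::topological_space, 'e::euclidean_space) chart set \<Rightarrow>
    ('b::topological_space, 'e2::euclidean_space) chart set \<Rightarrow> ('a \<Rightarrow> 'b) \<Rightarrow> bool" where
  "smooth_map A B f \<longleftrightarrow>
     continuous_on (atlas_carrier A) f \<and> f ` atlas_carrier A \<subseteq> atlas_carrier B \<and>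
     (\<forall>c\<in>A. \<forall>c'\<in>B. smooth_on (snd c ` (fst c \<inter> f -` fst c')) (snd c' \<circ> f \<circ> chart_inv c))"

definition smooth_fun :: "('a::topological_space, 'e::euclidean_space) chart set \<Rightarrow>
    ('a \<Rightarrow> real) \<Rightarrow> bool" where
  "smooth_fun A \<phi> \<longleftrightarrow> (\<forall>c\<in>A. smooth_on (snd c ` fst c) (\<phi> \<circ> chart_inv c))"

text \<open>The product of a manifold with an open set \<open>I\<close> of real parameters.\<close>

definition product_atlas ::
  "('a, 'e) chart set \<Rightarrow> real set \<Rightarrow> ('a \<times> real, 'e \<times> real) chart set" where
  "product_atlas A I = (\<lambda>c. (fst c \<times> I, \<lambda>(p, t). (snd c p, t))) ` A"


section \<open>Tangent vectors, vector fields and vector bundles\<close>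

text \<open>
  A tangent vector at \<open>p\<close> is represented by its coordinate vector in the preferred chart
  \<open>chart_at A p\<close>, so every tangent space is a copy of the model space. The preferred chart may jump
  from point to point; smoothness is therefore always expressed after passing to the components
  \<open>components A c p v\<close> with respect to a fixed chart \<open>c\<close>.
\<close>

definition chart_at :: "('a, 'e) chart set \<Rightarrow> 'a \<Rightarrow> ('a, 'e) chart" where
  "chart_at A p = (SOME c. c \<in> A \<and> p \<in> fst c)"

definition coord_change ::
  "('a, 'e::euclidean_space) chart \<Rightarrow> ('a, 'e) chart \<Rightarrow> 'a \<Rightarrow> 'e \<Rightarrow> 'e" where
  "coord_change c c' p = frechet_derivative (snd c' \<circ> chart_inv c) (at (snd c p))"

definition components ::
  "('a, 'e::euclidean_space) chart set \<Rightarrow> ('a, 'e) chart \<Rightarrow> 'a \<Rightarrow> 'e \<Rightarrow> 'e" where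
  "components A c p v = coord_change (chart_at A p) c p v"

text \<open>The tangent vector at \<open>p\<close> whose components with respect to \<open>c\<close> are \<open>u\<close>.\<close>

definition from_components ::
  "('a, 'e::euclidean_space) chart set \<Rightarrow> ('a, 'e) chart \<Rightarrow> 'a \<Rightarrow> 'e \<Rightarrow> 'e" where
  "from_components A c p u = coord_change c (chart_at A p) p u"

text \<open>The differential \<open>df\<^sub>p(v)\<close> of a map between manifolds, and of a real function.\<close>

definition differential ::
  "('a, 'e::euclidean_space) chart set \<Rightarrow> ('b, 'e2::euclidean_space) chart set \<Rightarrow>
    ('a \<Rightarrow> 'b) \<Rightarrow> 'a \<Rightarrow> 'e \<Rightarrow> 'e2" where
  "differential A B f p v =
     frechet_derivative (snd (chart_at B (f p)) \<circ> f \<circ> chart_inv (chart_at A p))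
       (at (snd (chart_at A p) p)) v"

definition dir_deriv ::
  "('a, 'e::euclidean_space) chart set \<Rightarrow> ('a \<Rightarrow> real) \<Rightarrow> 'a \<Rightarrow> 'e \<Rightarrow> real" where
  "dir_deriv A \<phi> p v =
     frechet_derivative (\<phi> \<circ> chart_inv (chart_at A p)) (at (snd (chart_at A p) p)) v"

text \<open>Smooth sections over \<open>U\<close> of the pull-back bundle \<open>f\<^sup>-\<^sup>1TN\<close>; for \<open>f = id\<close>, vector fields.\<close>

definition smooth_along ::
  "('a::topological_space, 'e::euclidean_space) chart set \<Rightarrow>
    ('b::topological_space, 'e2::euclidean_space) chart set \<Rightarrow>
    'a set \<Rightarrow> ('a \<Rightarrow> 'b) \<Rightarrow> ('a \<Rightarrow> 'e2) \<Rightarrow> bool" where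
  "smooth_along A B U f V \<longleftrightarrow>
     (\<forall>c\<in>A. \<forall>c'\<in>B. smooth_on (snd c ` (U \<inter> fst c \<inter> f -` fst c'))
        (\<lambda>x. components B c' (f (chart_inv c x)) (V (chart_inv c x))))"

definition sections ::
  "('a::topological_space, 'e::euclidean_space) chart set \<Rightarrow>
    ('b::topological_space, 'e2::euclidean_space) chart set \<Rightarrow> ('a \<Rightarrow> 'b) \<Rightarrow> ('a \<Rightarrow> 'e2) set" where
  "sections A B f = {V. smooth_along A B UNIV f V}"

definition vector_fields ::
  "('a::topological_space, 'e::euclidean_space) chart set \<Rightarrow> ('a \<Rightarrow> 'e) set" where
  "vector_fields A = sections A A id"

text \<open>\<open>[X, Y]\<^sup>k = X\<^sup>i \<partial>\<^sub>i Y\<^sup>k - Y\<^sup>i \<partial>\<^sub>i X\<^sup>k\<close>, evaluated at \<open>p\<close> in the chart \<open>chart_at A p\<close>.\<close>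

definition lie_bracket ::
  "('a, 'e::euclidean_space) chart set \<Rightarrow> ('a \<Rightarrow> 'e) \<Rightarrow> ('a \<Rightarrow> 'e) \<Rightarrow> 'a \<Rightarrow> 'e" where
  "lie_bracket A X Y p =
     (let c = chart_at A p;
          rep = (\<lambda>Z x. components A c (chart_inv c x) (Z (chart_inv c x)))
      in frechet_derivative (rep Y) (at (snd c p)) (X p)
         - frechet_derivative (rep X) (at (snd c p)) (Y p))"

definition smooth_subbundle ::
  "('a::topological_space, 'e::euclidean_space) chart set \<Rightarrow> ('a \<Rightarrow> 'e set) \<Rightarrow> nat \<Rightarrow> bool" where
  "smooth_subbundle A H m \<longleftrightarrow>
     (\<forall>p. subspace (H p) \<and> dim (H p) = m) \<and>
     (\<forall>p. \<exists>U X. open U \<and> p \<in> U \<and>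
        (\<forall>i<m. smooth_along A A U id (X i)) \<and>
        (\<forall>q\<in>U. H q = span ((\<lambda>i. X i q) ` {..<m})))"


section \<open>Riemannian geometry\<close>

definition riemannian_metric ::
  "('a::topological_space, 'e::euclidean_space) chart set \<Rightarrow> ('a \<Rightarrow> 'e \<Rightarrow> 'e \<Rightarrow> real) \<Rightarrow> bool" where
  "riemannian_metric A g \<longleftrightarrow>
     (\<forall>p. bilinear (g p) \<and> (\<forall>u v. g p u v = g p v u) \<and> (\<forall>v. v \<noteq> 0 \<longrightarrow> g p v v > 0)) \<and>
     (\<forall>c\<in>A. \<forall>u v. smooth_on (snd c ` fst c)
        (\<lambda>x. g (chart_inv c x) (from_components A c (chart_inv c x) u)
                               (from_components A c (chart_inv c x) v)))"

definition riemannian_manifold ::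
  "('a::{t2_space,second_countable_topology}, 'e::euclidean_space) chart set \<Rightarrow>
    ('a \<Rightarrow> 'e \<Rightarrow> 'e \<Rightarrow> real) \<Rightarrow> bool" where
  "riemannian_manifold A g \<longleftrightarrow> smooth_manifold A \<and> riemannian_metric A g"

definition gram_matrix ::
  "('a, real^'k) chart set \<Rightarrow> ('a \<Rightarrow> real^'k \<Rightarrow> real^'k \<Rightarrow> real) \<Rightarrow>
    ('a, real^'k) chart \<Rightarrow> 'a \<Rightarrow> real^'k^'k" where
  "gram_matrix A g c p =
     (\<chi> i j. g p (from_components A c p (axis i 1)) (from_components A c p (axis j 1)))"

text \<open>
  The Riemannian volume measure is the unique Borel measure given in every chart by the density
  \<open>sqrt (det (g\<^sub>i\<^sub>j))\<close> with respect to Lebesgue measure.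
\<close>

definition riemannian_volume ::
  "('a::topological_space, real^'k) chart set \<Rightarrow> ('a \<Rightarrow> real^'k \<Rightarrow> real^'k \<Rightarrow> real) \<Rightarrow>
    'a measure \<Rightarrow> bool" where
  "riemannian_volume A g \<mu> \<longleftrightarrow> sets \<mu> = sets borel \<and>
     (\<forall>c\<in>A. \<forall>S\<in>sets borel. S \<subseteq> fst c \<longrightarrow>
        emeasure \<mu> S = (\<integral>\<^sup>+ x \<in> snd c ` S. ennreal (sqrt (det (gram_matrix A g c (chart_inv c x)))) \<partial>lborel))"

text \<open>\<open>nabla X Y\<close> is \<open>\<nabla>\<^sub>X Y\<close>; its values matter only for smooth vector fields \<open>X\<close>, \<open>Y\<close>.\<close>

definition affine_connection ::
  "('b::topological_space, 'e::euclidean_space) chart set \<Rightarrow>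
    (('b \<Rightarrow> 'e) \<Rightarrow> ('b \<Rightarrow> 'e) \<Rightarrow> 'b \<Rightarrow> 'e) \<Rightarrow> bool" where
  "affine_connection B nabla \<longleftrightarrow>
     (\<forall>X\<in>vector_fields B. \<forall>Y\<in>vector_fields B. nabla X Y \<in> vector_fields B) \<and>
     (\<forall>X\<in>vector_fields B. \<forall>X'\<in>vector_fields B. \<forall>Y\<in>vector_fields B.
        nabla (\<lambda>q. X q + X' q) Y = (\<lambda>q. nabla X Y q + nabla X' Y q)) \<and>
     (\<forall>\<phi>. smooth_fun B \<phi> \<longrightarrow> (\<forall>X\<in>vector_fields B. \<forall>Y\<in>vector_fields B.
        nabla (\<lambda>q. \<phi> q *\<^sub>R X q) Y = (\<lambda>q. \<phi> q *\<^sub>R nabla X Y q))) \<and>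
     (\<forall>X\<in>vector_fields B. \<forall>Y\<in>vector_fields B. \<forall>Y'\<in>vector_fields B.
        nabla X (\<lambda>q. Y q + Y' q) = (\<lambda>q. nabla X Y q + nabla X Y' q)) \<and>
     (\<forall>\<phi>. smooth_fun B \<phi> \<longrightarrow> (\<forall>X\<in>vector_fields B. \<forall>Y\<in>vector_fields B.
        nabla X (\<lambda>q. \<phi> q *\<^sub>R Y q) = (\<lambda>q. dir_deriv B \<phi> q (X q) *\<^sub>R Y q + \<phi> q *\<^sub>R nabla X Y q)))"

definition levi_civita_connection ::
  "('b::topological_space, 'e::euclidean_space) chart set \<Rightarrow> ('b \<Rightarrow> 'e \<Rightarrow> 'e \<Rightarrow> real) \<Rightarrow>
    (('b \<Rightarrow> 'e) \<Rightarrow> ('b \<Rightarrow> 'e) \<Rightarrow> 'b \<Rightarrow> 'e) \<Rightarrow> bool" where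
  "levi_civita_connection B h nabla \<longleftrightarrow>
     affine_connection B nabla \<and>
     (\<forall>X\<in>vector_fields B. \<forall>Y\<in>vector_fields B. \<forall>q.
        nabla X Y q - nabla Y X q = lie_bracket B X Y q) \<and>
     (\<forall>X\<in>vector_fields B. \<forall>Y\<in>vector_fields B. \<forall>Z\<in>vector_fields B. \<forall>q.
        dir_deriv B (\<lambda>r. h r (Y r) (Z r)) q (X q) = h q (nabla X Y q) (Z q) + h q (Y q) (nabla X Z q))"

definition curvature ::
  "('b::topological_space, 'e::euclidean_space) chart set \<Rightarrow>
    (('b \<Rightarrow> 'e) \<Rightarrow> ('b \<Rightarrow> 'e) \<Rightarrow> 'b \<Rightarrow> 'e) \<Rightarrow>
    ('b \<Rightarrow> 'e) \<Rightarrow> ('b \<Rightarrow> 'e) \<Rightarrow> ('b \<Rightarrow> 'e) \<Rightarrow> 'b \<Rightarrow> 'e" where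
  "curvature B nabla X Y Z q =
     nabla X (nabla Y Z) q - nabla Y (nabla X Z) q - nabla (lie_bracket B X Y) Z q"

text \<open>
  \<open>R(x, y)z\<close> for tangent vectors at \<open>q\<close>: the common value of \<open>(R(X, Y)Z)(q)\<close> over all smooth vector
  fields \<open>X\<close>, \<open>Y\<close>, \<open>Z\<close> extending \<open>x\<close>, \<open>y\<close>, \<open>z\<close>.
\<close>

definition curvature_tensor ::
  "('b::topological_space, 'e::euclidean_space) chart set \<Rightarrow>
    (('b \<Rightarrow> 'e) \<Rightarrow> ('b \<Rightarrow> 'e) \<Rightarrow> 'b \<Rightarrow> 'e) \<Rightarrow> 'b \<Rightarrow> 'e \<Rightarrow> 'e \<Rightarrow> 'e \<Rightarrow> 'e" where
  "curvature_tensor B nabla q x y z =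
     (THE w. \<forall>X\<in>vector_fields B. \<forall>Y\<in>vector_fields B. \<forall>Z\<in>vector_fields B.
        X q = x \<and> Y q = y \<and> Z q = z \<longrightarrow> curvature B nabla X Y Z q = w)"

text \<open>
  \<open>D p v V\<close> is the derivative at \<open>p\<close> of the section \<open>V\<close> of \<open>f\<^sup>-\<^sup>1TN\<close> in the direction \<open>v\<close>. The
  last clause, \<open>D\<^sub>v (Y \<circ> f) = \<nabla>\<^bsub>df(v)\<^esub> Y\<close>, characterizes the pull-back connection among the
  connections on \<open>f\<^sup>-\<^sup>1TN\<close>.
\<close>

definition pullback_connection ::
  "('a::topological_space, 'e::euclidean_space) chart set \<Rightarrow>
    ('b::topological_space, 'e2::euclidean_space) chart set \<Rightarrow> ('a \<Rightarrow> 'b) \<Rightarrow>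
    (('b \<Rightarrow> 'e2) \<Rightarrow> ('b \<Rightarrow> 'e2) \<Rightarrow> 'b \<Rightarrow> 'e2) \<Rightarrow>
    ('a \<Rightarrow> 'e \<Rightarrow> ('a \<Rightarrow> 'e2) \<Rightarrow> 'e2) \<Rightarrow> bool" where
  "pullback_connection A B f nabla D \<longleftrightarrow>
     (\<forall>X\<in>vector_fields A. \<forall>V\<in>sections A B f. (\<lambda>p. D p (X p) V) \<in> sections A B f) \<and>
     (\<forall>p. \<forall>V\<in>sections A B f. linear (\<lambda>v. D p v V)) \<and>
     (\<forall>p v. \<forall>V\<in>sections A B f. \<forall>W\<in>sections A B f.
        D p v (\<lambda>q. V q + W q) = D p v V + D p v W) \<and>
     (\<forall>p v \<phi>. smooth_fun A \<phi> \<longrightarrow> (\<forall>V\<in>sections A B f.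
        D p v (\<lambda>q. \<phi> q *\<^sub>R V q) = dir_deriv A \<phi> p v *\<^sub>R V p + \<phi> p *\<^sub>R D p v V)) \<and>
     (\<forall>p v. \<forall>X\<in>vector_fields B. \<forall>Y\<in>vector_fields B.
        X (f p) = differential A B f p v \<longrightarrow> D p v (Y \<circ> f) = nabla X Y (f p))"


section \<open>The horizontal exponential energy\<close>

definition orthonormal_frame_at ::
  "('a \<Rightarrow> 'e \<Rightarrow> 'e \<Rightarrow> real) \<Rightarrow> ('a \<Rightarrow> 'e set) \<Rightarrow> nat \<Rightarrow> 'a \<Rightarrow> (nat \<Rightarrow> 'e) \<Rightarrow> bool" where
  "orthonormal_frame_at g H m p e \<longleftrightarrow>
     (\<forall>i<m. e i \<in> H p) \<and> (\<forall>i<m. \<forall>j<m. g p (e i) (e j) = (if i = j then 1 else 0))"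

text \<open>\<open>|df\<^sub>H|\<^sup>2\<close> at \<open>p\<close>; the sum does not depend on the orthonormal basis of \<open>H p\<close> that is chosen.\<close>

definition hor_norm_sq ::
  "('a, 'e::euclidean_space) chart set \<Rightarrow> ('a \<Rightarrow> 'e \<Rightarrow> 'e \<Rightarrow> real) \<Rightarrow> ('a \<Rightarrow> 'e set) \<Rightarrow> nat \<Rightarrow>
    ('b, 'e2::euclidean_space) chart set \<Rightarrow> ('b \<Rightarrow> 'e2 \<Rightarrow> 'e2 \<Rightarrow> real) \<Rightarrow> ('a \<Rightarrow> 'b) \<Rightarrow> 'a \<Rightarrow> real" where
  "hor_norm_sq A g H m B h f p =
     (let e = (SOME e. orthonormal_frame_at g H m p e)
      in \<Sum>i<m. h (f p) (differential A B f p (e i)) (differential A B f p (e i)))"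

definition exp_energy ::
  "('a, 'e::euclidean_space) chart set \<Rightarrow> ('a \<Rightarrow> 'e \<Rightarrow> 'e \<Rightarrow> real) \<Rightarrow> ('a \<Rightarrow> 'e set) \<Rightarrow> nat \<Rightarrow>
    'a measure \<Rightarrow> ('b, 'e2::euclidean_space) chart set \<Rightarrow> ('b \<Rightarrow> 'e2 \<Rightarrow> 'e2 \<Rightarrow> real) \<Rightarrow>
    ('a \<Rightarrow> 'b) \<Rightarrow> real" where
  "exp_energy A g H m dv B h f = (LINT p|dv. exp (hor_norm_sq A g H m B h f p / 2))"

definition smooth_family ::
  "('a::topological_space, 'e::euclidean_space) chart set \<Rightarrow>
    ('b::topological_space, 'e2::euclidean_space) chart set \<Rightarrow>
    real \<Rightarrow> (real \<Rightarrow> 'a \<Rightarrow> 'b) \<Rightarrow> bool" where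
  "smooth_family A B \<epsilon> F \<longleftrightarrow>
     smooth_map (product_atlas A {-\<epsilon><..<\<epsilon>}) B (\<lambda>(p, t). F t p)"

definition variation_field ::
  "('b, 'e::euclidean_space) chart set \<Rightarrow> (real \<Rightarrow> 'a \<Rightarrow> 'b) \<Rightarrow> 'a \<Rightarrow> 'e" where
  "variation_field B F p = vector_derivative (\<lambda>t. snd (chart_at B (F 0 p)) (F t p)) (at 0)"

definition compactly_supported :: "('a::topological_space \<Rightarrow> 'v::zero) \<Rightarrow> bool" where
  "compactly_supported V \<longleftrightarrow> compact (closure {p. V p \<noteq> 0})"

definition exp_subelliptic_harmonic ::
  "('a::topological_space, 'e::euclidean_space) chart set \<Rightarrow> ('a \<Rightarrow> 'e \<Rightarrow> 'e \<Rightarrow> real) \<Rightarrow>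
    ('a \<Rightarrow> 'e set) \<Rightarrow> nat \<Rightarrow> 'a measure \<Rightarrow>
    ('b::topological_space, 'e2::euclidean_space) chart set \<Rightarrow> ('b \<Rightarrow> 'e2 \<Rightarrow> 'e2 \<Rightarrow> real) \<Rightarrow>
    ('a \<Rightarrow> 'b) \<Rightarrow> bool" where
  "exp_subelliptic_harmonic A g H m dv B h f \<longleftrightarrow>
     smooth_map A B f \<and>
     (\<forall>\<epsilon>>0. \<forall>F. smooth_family A B \<epsilon> F \<and> F 0 = f \<and> compactly_supported (variation_field B F) \<longrightarrow>
        ((\<lambda>t. exp_energy A g H m dv B h (F t)) has_real_derivative 0) (at 0))"

end

theory Submission
  imports Defs "HOL-Computational_Algebra.Polynomial"
begin

text \<open>
  Write \<open>u t p = |d(F t)\<^sub>H|\<^sup>2\<close>. Differentiating twice under the integral, the integrand of the second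
  derivative at \<open>t = 0\<close> is \<open>exp (u/2) * ((u'/2)\<^sup>2 + u''/2)\<close>. In coordinates, symmetry and metric
  compatibility of the Christoffel symbols give \<open>u'/2 = \<Sum>\<langle>\<nabla>\<^sub>e V, df e\<rangle>\<close>, and commuting covariant derivatives
  gives \<open>u''/2 = \<Sum>\<langle>\<nabla>\<^sub>e a, df e\<rangle> + \<Sum>|\<nabla>\<^sub>e V|\<^sup>2 - \<Sum>\<langle>R(df e, V)V, df e\<rangle>\<close>, where \<open>a\<close> is the covariant
  acceleration of the family at time \<open>0\<close>. The term with \<open>a\<close> integrates to zero because it is the
  first variation in the direction of the section \<open>a\<close>. To see this without the exponential map of the
  target, split \<open>a\<close> by bump functions on the target into finitely many sections supported over single
  charts; each of these is the variation field of a family that is affine in that chart.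
\<close>

section \<open>Calculus of smooth functions\<close>

text \<open>The Levi-Civita and pull-back connections are given only through axioms about global
  sections, so their locality has to be derived. An additive operator with a Leibniz rule is
  evaluated by cutting a section off near a point (\<open>local_operator\<close>); this yields the
  Christoffel symbols and the chart formulas of both connections. Commuting time and space
  derivatives then becomes a calculation with functions on open subsets of Euclidean space. A
  tangent vector is stored in a preferred chart that may jump from point to point. Objects are
  therefore rewritten in a fixed chart before being differentiated, and read back in the preferred
  chart, where components are the vector itself. The given orthonormal frame is chosen separately at
  every point, so no regularity of it can be used. The energy density is a trace, independent of the
  frame, and a locally continuous frame suffices for its regularity, since only time derivatives are
  taken. Compactness of the source supplies finite volume, domination, and a uniform time interval
  for the auxiliary families.\<close>

abbreviation fd :: "('a::real_normed_vector \<Rightarrow> 'b::real_normed_vector) \<Rightarrow> 'a \<Rightarrow> 'a \<Rightarrow> 'b" where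
  "fd f x \<equiv> frechet_derivative f (at x)"

lemma fd_eq: "(f has_derivative f') (at x) \<Longrightarrow> fd f x = f'"
  by (rule frechet_derivative_at [symmetric])

lemma fd_works: "f differentiable (at x) \<Longrightarrow> (f has_derivative fd f x) (at x)"
  by (simp add: frechet_derivative_works)

lemma fd_cong:
  assumes "open S" "x \<in> S" "\<And>y. y \<in> S \<Longrightarrow> f y = g y"
  shows "fd f x = fd g x"
proof -
  have "(f has_derivative f') (at x) \<longleftrightarrow> (g has_derivative f') (at x)" for f'
    using has_derivative_transform_within_open[of f f' x UNIV S g]
      has_derivative_transform_within_open[of g f' x UNIV S f] assms by auto
  then show ?thesis
    by (simp add: frechet_derivative_def)
qed

lemma differentiable_cong_open:
  assumes "open S" "x \<in> S" "\<And>y. y \<in> S \<Longrightarrow> f y = g y" "f differentiable (at x)"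
  shows "g differentiable (at x)"
  using has_derivative_transform_within_open[of f _ x UNIV S g] assms
  unfolding differentiable_def by auto

lemma linear_basis_sum:
  fixes f :: "'a::euclidean_space \<Rightarrow> 'b::real_vector"
  assumes "linear f"
  shows "f v = (\<Sum>b\<in>Basis. (v \<bullet> b) *\<^sub>R f b)"
proof -
  have "f v = f (\<Sum>b\<in>Basis. (v \<bullet> b) *\<^sub>R b)"
    by (simp add: euclidean_representation)
  then show ?thesis
    by (simp add: linear_sum[OF assms] linear_cmul[OF assms])
qed

lemma fd_compose:
  assumes "g differentiable (at x)" "f differentiable (at (g x))"
  shows "fd (\<lambda>x. f (g x)) x v = fd f (g x) (fd g x v)"
  using has_derivative_compose[OF fd_works[OF assms(1)] fd_works[OF assms(2)]]
  by (simp add: fd_eq)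

section \<open>Closure properties of \<open>Ck_on\<close> and \<open>smooth_on\<close>\<close>

lemma Ck_on_continuous: "Ck_on k S f \<Longrightarrow> continuous_on S f"
  by (cases k) (auto intro!: continuous_at_imp_continuous_on differentiable_imp_continuous_within)

lemma Ck_on_Suc_imp: "Ck_on (Suc k) S f \<Longrightarrow> Ck_on k S f"
proof (induction k arbitrary: f)
  case 0
  then show ?case
    using Ck_on_continuous by fastforce
next
  case (Suc k)
  then show ?case
    by (metis Ck_on.simps(2))
qed

lemma Ck_on_subset: "Ck_on k S f \<Longrightarrow> T \<subseteq> S \<Longrightarrow> Ck_on k T f"
  by (induction k arbitrary: f) (auto intro: continuous_on_subset)

lemma Ck_on_cong:
  assumes "open S" "\<And>x. x \<in> S \<Longrightarrow> f x = g x" "Ck_on k S f"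
  shows "Ck_on k S g"
  using assms(2,3)
proof (induction k arbitrary: f g)
  case 0
  then show ?case
    by (simp cong: continuous_on_cong)
next
  case (Suc k)
  have "g differentiable (at x)" if "x \<in> S" for x
    using differentiable_cong_open[OF assms(1) that, of f g] Suc.prems that by auto
  moreover have "Ck_on k S (\<lambda>x. fd g x b)" if "b \<in> Basis" for b
  proof (rule Suc.IH)
    show "Ck_on k S (\<lambda>x. fd f x b)"
      using Suc.prems that by simp
  next
    fix x assume "x \<in> S"
    then show "fd f x b = fd g x b"
      using fd_cong[OF assms(1), of x f g] Suc.prems(1) by simp
  qed
  ultimately show ?case
    by simp
qed

text \<open>Derivatives are taken at full neighbourhoods of each point, so regularity on a small
  open set around the point already decides everything there.\<close>

lemma Ck_on_local:
  assumes "\<And>x. x \<in> S \<Longrightarrow> \<exists>T. open T \<and> x \<in> T \<and> Ck_on k T f"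
  shows "Ck_on k S f"
  using assms
proof (induction k arbitrary: f)
  case 0
  have "isCont f x" if "x \<in> S" for x
    using 0[OF that] by (auto simp: continuous_on_eq_continuous_at)
  then show ?case
    by (auto intro: continuous_at_imp_continuous_on)
next
  case (Suc k)
  have "Ck_on k S (\<lambda>x. fd f x b)" if "b \<in> Basis" for b
  proof (rule Suc.IH)
    fix x assume "x \<in> S"
    then obtain T where "open T" "x \<in> T" "Ck_on (Suc k) T f"
      using Suc.prems by blast
    then show "\<exists>T. open T \<and> x \<in> T \<and> Ck_on k T (\<lambda>x. fd f x b)"
      using that by auto
  qed
  moreover have "f differentiable (at x)" if x: "x \<in> S" for x
  proof -
    obtain T where "x \<in> T" "Ck_on (Suc k) T f"
      using Suc.prems[OF x] by blast
    then show ?thesis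
      by simp
  qed
  ultimately show ?case
    by simp
qed

lemma Ck_on_const: "Ck_on k S (\<lambda>x. c)"
  by (induction k arbitrary: c) auto

lemma Ck_on_bounded_linear:
  assumes "bounded_linear L"
  shows "Ck_on k S L"
proof (cases k)
  case 0
  then show ?thesis
    by (simp add: linear_continuous_on assms)
next
  case (Suc j)
  have "(L has_derivative L) (at x)" for x
    by (rule bounded_linear_imp_has_derivative[OF assms])
  then show ?thesis
    using Suc by (auto simp: fd_eq[of L L] Ck_on_const differentiable_def)
qed

lemma Ck_on_add:
  assumes "open S" "Ck_on k S f" "Ck_on k S g"
  shows "Ck_on k S (\<lambda>x. f x + g x)"
  using assms(2,3)
proof (induction k arbitrary: f g)
  case 0
  then show ?case
    by (simp add: continuous_on_add)
next
  case (Suc k)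
  have "Ck_on k S (\<lambda>x. fd (\<lambda>x. f x + g x) x b)" if "b \<in> Basis" for b
  proof (rule Ck_on_cong[OF assms(1)])
    show "Ck_on k S (\<lambda>x. fd f x b + fd g x b)"
      using Suc that by simp
    show "fd f x b + fd g x b = fd (\<lambda>x. f x + g x) x b" if "x \<in> S" for x
      using fd_eq[OF has_derivative_add[OF fd_works fd_works, of f x g]] Suc.prems that by simp
  qed
  then show ?case
    using Suc.prems by simp
qed

lemma Ck_on_sum:
  assumes "open S" "\<And>i. i \<in> I \<Longrightarrow> Ck_on k S (f i)"
  shows "Ck_on k S (\<lambda>x. \<Sum>i\<in>I. f i x)"
  using assms(2)
  by (induction I rule: infinite_finite_induct) (auto intro!: Ck_on_add Ck_on_const assms(1))

text \<open>Induction along the product rule: the derivative is again a sum of bilinear terms, each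
  pairing a factor with a derivative of the other. Scalar multiples, products and inner products are
  all instances.\<close>

lemma Ck_on_bilinear:
  assumes "bounded_bilinear p" "open S" "Ck_on k S f" "Ck_on k S g"
  shows "Ck_on k S (\<lambda>x. p (f x) (g x))"
  using assms(3,4)
proof (induction k arbitrary: f g)
  case 0
  then show ?case
    by (simp add: bounded_bilinear.continuous_on[OF assms(1)])
next
  case (Suc k)
  have D: "((\<lambda>x. p (f x) (g x)) has_derivative (\<lambda>h. p (f x) (fd g x h) + p (fd f x h) (g x))) (at x)"
    if "x \<in> S" for x
    using bounded_bilinear.FDERIV[OF assms(1) fd_works fd_works, of f x g] Suc.prems that by simp
  have "Ck_on k S (\<lambda>x. fd (\<lambda>x. p (f x) (g x)) x b)" if b: "b \<in> Basis" for b
  proof (rule Ck_on_cong[OF assms(2)])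
    show "Ck_on k S (\<lambda>x. p (f x) (fd g x b) + p (fd f x b) (g x))"
      using Suc.prems b by (intro Ck_on_add assms(2) Suc.IH)
          (auto dest: Ck_on_Suc_imp simp del: Ck_on.simps, auto)
  qed (simp add: fd_eq[OF D])
  then show ?case
    using D by (auto simp: differentiable_def)
qed

text \<open>\<open>Ck_on\<close> controls derivatives of \<open>f\<close> only in fixed directions,
  while the chain rule produces the moving direction \<open>fd g x b\<close>. Expanding that
  direction in the basis leaves products of functions covered by the induction hypothesis.\<close>

lemma Ck_on_compose:
  fixes g :: "'e::euclidean_space \<Rightarrow> 'f::euclidean_space"
  assumes "open S" "open T" "g ` S \<subseteq> T" "Ck_on k S g" "Ck_on k T f"
  shows "Ck_on k S (\<lambda>x. f (g x))"
  using assms(4,5)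
proof (induction k arbitrary: f)
  case 0
  then show ?case
    using assms(3) by (auto intro: continuous_on_compose2)
next
  case (Suc k)
  have dg: "g differentiable (at x)" and df: "f differentiable (at (g x))" if "x \<in> S" for x
    using Suc.prems assms(3) that by auto
  have "Ck_on k S (\<lambda>x. fd (\<lambda>x. f (g x)) x b)" if b: "b \<in> Basis" for b
  proof (rule Ck_on_cong[OF assms(1)])
    show "Ck_on k S (\<lambda>x. \<Sum>i\<in>Basis. (fd g x b \<bullet> i) *\<^sub>R fd f (g x) i)"
    proof (intro Ck_on_sum Ck_on_bilinear[OF bounded_bilinear_scaleR] assms(1))
      fix i :: 'f assume i: "i \<in> Basis"
      show "Ck_on k S (\<lambda>x. fd g x b \<bullet> i)"
        using Suc.prems b
        by (intro Ck_on_bilinear[OF bounded_bilinear_inner] Ck_on_const assms(1)) auto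
      show "Ck_on k S (\<lambda>x. fd f (g x) i)"
        using Suc.IH[of "\<lambda>y. fd f y i"] Suc.prems i Ck_on_Suc_imp by auto
    qed
    show "(\<Sum>i\<in>Basis. (fd g x b \<bullet> i) *\<^sub>R fd f (g x) i) = fd (\<lambda>x. f (g x)) x b" if "x \<in> S" for x
      unfolding fd_compose[OF dg[OF that] df[OF that]]
      by (rule linear_basis_sum[symmetric]) (rule linear_frechet_derivative[OF df[OF that]])
  qed
  moreover have "(\<lambda>x. f (g x)) differentiable (at x)" if "x \<in> S" for x
    using differentiable_chain_at[OF dg[OF that] df[OF that]] by (simp add: o_def)
  ultimately show ?case
    by simp
qed

lemma smooth_on_subset: "smooth_on S f \<Longrightarrow> T \<subseteq> S \<Longrightarrow> smooth_on T f"
  by (auto simp: smooth_on_def intro: Ck_on_subset)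

lemma smooth_on_cong:
  "open S \<Longrightarrow> (\<And>x. x \<in> S \<Longrightarrow> f x = g x) \<Longrightarrow> smooth_on S f \<Longrightarrow> smooth_on S g"
  by (auto simp: smooth_on_def intro: Ck_on_cong)

lemma smooth_on_local:
  assumes "\<And>x. x \<in> S \<Longrightarrow> \<exists>T. open T \<and> x \<in> T \<and> smooth_on T f"
  shows "smooth_on S f"
  unfolding smooth_on_def
proof
  fix k show "Ck_on k S f"
    using assms by (intro Ck_on_local) (auto simp: smooth_on_def)
qed

lemma smooth_on_continuous: "smooth_on S f \<Longrightarrow> continuous_on S f"
  using Ck_on_continuous by (auto simp: smooth_on_def)

lemma smooth_on_differentiable: "smooth_on S f \<Longrightarrow> x \<in> S \<Longrightarrow> f differentiable (at x)"
  by (metis smooth_on_def Ck_on.simps(2))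

lemma smooth_on_const: "smooth_on S (\<lambda>x. c)"
  by (simp add: smooth_on_def Ck_on_const)

lemma smooth_on_bounded_linear: "bounded_linear L \<Longrightarrow> smooth_on S L"
  by (simp add: smooth_on_def Ck_on_bounded_linear)

lemma smooth_on_id: "smooth_on S (\<lambda>x. x)"
  by (rule smooth_on_bounded_linear) (rule bounded_linear_ident)

lemma smooth_on_add:
  "open S \<Longrightarrow> smooth_on S f \<Longrightarrow> smooth_on S g \<Longrightarrow> smooth_on S (\<lambda>x. f x + g x)"
  by (simp add: smooth_on_def Ck_on_add)

lemma smooth_on_sum:
  "open S \<Longrightarrow> (\<And>i. i \<in> I \<Longrightarrow> smooth_on S (f i)) \<Longrightarrow> smooth_on S (\<lambda>x. \<Sum>i\<in>I. f i x)"
  by (simp add: smooth_on_def Ck_on_sum)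

lemma smooth_on_bilinear:
  "bounded_bilinear p \<Longrightarrow> open S \<Longrightarrow> smooth_on S f \<Longrightarrow> smooth_on S g \<Longrightarrow>
    smooth_on S (\<lambda>x. p (f x) (g x))"
  by (simp add: smooth_on_def Ck_on_bilinear)

lemmas smooth_on_scaleR = smooth_on_bilinear[OF bounded_bilinear_scaleR]
lemmas smooth_on_mult = smooth_on_bilinear[OF bounded_bilinear_mult]
lemmas smooth_on_inner = smooth_on_bilinear[OF bounded_bilinear_inner]

lemma smooth_on_compose:
  fixes g :: "'e::euclidean_space \<Rightarrow> 'f::euclidean_space"
  shows "open S \<Longrightarrow> open T \<Longrightarrow> g ` S \<subseteq> T \<Longrightarrow> smooth_on S g \<Longrightarrow> smooth_on T f \<Longrightarrow>
    smooth_on S (\<lambda>x. f (g x))"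
  by (auto simp: smooth_on_def intro: Ck_on_compose)

lemma smooth_on_linear_compose:
  fixes f :: "'e::euclidean_space \<Rightarrow> 'f::euclidean_space"
  shows "bounded_linear L \<Longrightarrow> open S \<Longrightarrow> smooth_on S f \<Longrightarrow> smooth_on S (\<lambda>x. L (f x))"
  by (rule smooth_on_compose[of S UNIV]) (auto intro: smooth_on_bounded_linear)

lemma smooth_on_minus:
  fixes f :: "'e::euclidean_space \<Rightarrow> 'f::euclidean_space"
  shows "open S \<Longrightarrow> smooth_on S f \<Longrightarrow> smooth_on S (\<lambda>x. - f x)"
  by (rule smooth_on_linear_compose[OF bounded_linear_minus[OF bounded_linear_ident]])

lemma smooth_on_diff:
  fixes f :: "'e::euclidean_space \<Rightarrow> 'f::euclidean_space"
  assumes "open S" "smooth_on S f" "smooth_on S g"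
  shows "smooth_on S (\<lambda>x. f x - g x)"
  using smooth_on_add[OF assms(1,2) smooth_on_minus[OF assms(1,3)]] by simp

lemma smooth_on_Pair:
  fixes f :: "'e::euclidean_space \<Rightarrow> 'f::euclidean_space" and g :: "'e \<Rightarrow> 'g::euclidean_space"
  assumes "open S" "smooth_on S f" "smooth_on S g"
  shows "smooth_on S (\<lambda>x. (f x, g x))"
proof -
  have "bounded_linear (\<lambda>y::'f. (y, 0::'g))" "bounded_linear (\<lambda>y::'g. (0::'f, y))"
    by (intro bounded_linear_Pair bounded_linear_ident bounded_linear_zero)+
  then have "smooth_on S (\<lambda>x. (f x, 0) + (0, g x))"
    by (intro smooth_on_add assms(1) smooth_on_linear_compose[of "\<lambda>y. (y, 0)"]
        smooth_on_linear_compose[of "\<lambda>y. (0, y)"] assms)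
  then show ?thesis
    by simp
qed

lemma smooth_on_fd:
  assumes "open S" "smooth_on S f"
  shows "smooth_on S (\<lambda>x. fd f x v)"
proof (rule smooth_on_cong[OF assms(1)])
  have "smooth_on S (\<lambda>x. fd f x b)" if "b \<in> Basis" for b
    unfolding smooth_on_def
  proof
    fix k
    have "Ck_on (Suc k) S f"
      using assms(2) by (simp only: smooth_on_def)
    then show "Ck_on k S (\<lambda>x. fd f x b)"
      using that by simp
  qed
  then show "smooth_on S (\<lambda>x. \<Sum>b\<in>Basis. (v \<bullet> b) *\<^sub>R fd f x b)"
    by (intro smooth_on_sum smooth_on_scaleR smooth_on_const assms(1))
  show "(\<Sum>b\<in>Basis. (v \<bullet> b) *\<^sub>R fd f x b) = fd f x v" if "x \<in> S" for x
    by (rule linear_basis_sum[symmetric])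
      (rule linear_frechet_derivative[OF smooth_on_differentiable[OF assms(2) that]])
qed

lemma fd_linear_in:
  assumes "smooth_on S f" "x \<in> S"
  shows "linear (fd f x)"
  by (rule linear_frechet_derivative[OF smooth_on_differentiable[OF assms]])

text \<open>Both mixed derivatives are limits of the same second difference quotient.\<close>

lemma second_difference_mean_value:
  fixes f :: "'e::euclidean_space \<Rightarrow> real"
  assumes S: "open S" "smooth_on S f" and t: "t > 0"
    and box: "\<And>a b. a \<in> {0..t} \<Longrightarrow> b \<in> {0..t} \<Longrightarrow> x + a *\<^sub>R v + b *\<^sub>R w \<in> S"
  shows "\<exists>a\<in>{0..t}. \<exists>b\<in>{0..t}. f (x + t *\<^sub>R v + t *\<^sub>R w) - f (x + t *\<^sub>R v) - f (x + t *\<^sub>R w) + f x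
    = t * t * fd (\<lambda>y. fd f y v) (x + a *\<^sub>R v + b *\<^sub>R w) w"
proof -
  have f: "(f has_derivative fd f y) (at y)" if "y \<in> S" for y
    using smooth_on_differentiable[OF S(2) that] by (rule fd_works)
  have g: "((\<lambda>y. fd f y v) has_derivative fd (\<lambda>y. fd f y v) y) (at y)" if "y \<in> S" for y
    using smooth_on_differentiable[OF smooth_on_fd[OF S] that] by (rule fd_works)
  have lin: "linear (fd f y)" "linear (fd (\<lambda>y. fd f y v) y)" if "y \<in> S" for y
    using fd_linear_in that S smooth_on_fd by blast+
  have d1: "((\<lambda>a. f (x + a *\<^sub>R v + b *\<^sub>R w)) has_real_derivative fd f (x + a *\<^sub>R v + b *\<^sub>R w) v) (at a)"
    if "a \<in> {0..t}" "b \<in> {0..t}" for a b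
  proof -
    have "((\<lambda>a. f (x + a *\<^sub>R v + b *\<^sub>R w)) has_derivative (\<lambda>h. fd f (x + a *\<^sub>R v + b *\<^sub>R w) (h *\<^sub>R v))) (at a)"
      using f[OF box[OF that]]
      by (intro has_derivative_compose[where f = "\<lambda>a. x + a *\<^sub>R v + b *\<^sub>R w" and g = f])
        (auto intro!: derivative_eq_intros)
    then show ?thesis
      by (simp add: has_field_derivative_def linear_cmul[OF lin(1)[OF box[OF that]]] mult_commute_abs)
  qed
  have d2: "((\<lambda>b. fd f (x + a *\<^sub>R v + b *\<^sub>R w) v) has_real_derivative
      fd (\<lambda>y. fd f y v) (x + a *\<^sub>R v + b *\<^sub>R w) w) (at b)"
    if "a \<in> {0..t}" "b \<in> {0..t}" for a b
  proof -
    have "((\<lambda>b. fd f (x + a *\<^sub>R v + b *\<^sub>R w) v) has_derivative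
        (\<lambda>h. fd (\<lambda>y. fd f y v) (x + a *\<^sub>R v + b *\<^sub>R w) (h *\<^sub>R w))) (at b)"
      using g[OF box[OF that]]
      by (intro has_derivative_compose[where f = "\<lambda>b. x + a *\<^sub>R v + b *\<^sub>R w" and g = "\<lambda>y. fd f y v"])
        (auto intro!: derivative_eq_intros)
    then show ?thesis
      by (simp add: has_field_derivative_def linear_cmul[OF lin(2)[OF box[OF that]]] mult_commute_abs)
  qed
  \<comment> \<open>The second difference is \<open>\<phi> t - \<phi> 0\<close>. The mean value
    theorem is applied first along \<open>v\<close> and then, to the resulting derivative, along
    \<open>w\<close>; writing \<open>0 *\<^sub>R w\<close> keeps the shape required by
    \<open>d1\<close>.\<close>
  define \<phi> where "\<phi> a = f (x + a *\<^sub>R v + t *\<^sub>R w) - f (x + a *\<^sub>R v + 0 *\<^sub>R w)" for a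
  have "(\<phi> has_real_derivative fd f (x + a *\<^sub>R v + t *\<^sub>R w) v - fd f (x + a *\<^sub>R v + 0 *\<^sub>R w) v) (at a)"
    if "0 \<le> a" "a \<le> t" for a
    unfolding \<phi>_def using that t by (intro DERIV_diff d1) auto
  from MVT2[of 0 t \<phi>, OF t this]
  obtain a where a: "0 < a" "a < t"
    "\<phi> t - \<phi> 0 = t * (fd f (x + a *\<^sub>R v + t *\<^sub>R w) v - fd f (x + a *\<^sub>R v + 0 *\<^sub>R w) v)"
    by auto
  from MVT2[of 0 t "\<lambda>b. fd f (x + a *\<^sub>R v + b *\<^sub>R w) v", OF t d2] a
  obtain b where b: "0 < b" "b < t"
    "fd f (x + a *\<^sub>R v + t *\<^sub>R w) v - fd f (x + a *\<^sub>R v + 0 *\<^sub>R w) v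
      = t * fd (\<lambda>y. fd f y v) (x + a *\<^sub>R v + b *\<^sub>R w) w"
    by auto
  show ?thesis
    using a b by (intro bexI[of _ a] bexI[of _ b]) (auto simp: \<phi>_def)
qed

lemma fd_fd_commute_real:
  fixes f :: "'e::euclidean_space \<Rightarrow> real"
  assumes S: "open S" "smooth_on S f" "x \<in> S"
  shows "fd (\<lambda>y. fd f y v) x w = fd (\<lambda>y. fd f y w) x v"
proof (rule ccontr)
  assume ne: "fd (\<lambda>y. fd f y v) x w \<noteq> fd (\<lambda>y. fd f y w) x v"
  define P where "P y = fd (\<lambda>y. fd f y v) y w" for y
  define Q where "Q y = fd (\<lambda>y. fd f y w) y v" for y
  \<comment> \<open>Half the gap: values within \<open>\<delta>\<close> of \<open>P x\<close> and of
    \<open>Q x\<close> cannot coincide, although the mean value theorem produces a common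
    one.\<close>
  define \<delta> where "\<delta> = \<bar>P x - Q x\<bar> / 2"
  have \<delta>: "\<delta> > 0"
    using ne by (simp add: \<delta>_def P_def Q_def)
  have "isCont P x" "isCont Q x"
    using smooth_on_continuous[OF smooth_on_fd[OF S(1) smooth_on_fd[OF S(1,2)]]] S(1,3)
    unfolding P_def[abs_def] Q_def[abs_def] by (simp_all add: continuous_on_eq_continuous_at)
  then obtain d1 d2 where d: "d1 > 0" "d2 > 0"
    "\<And>y. dist y x < d1 \<Longrightarrow> \<bar>P y - P x\<bar> < \<delta>" "\<And>y. dist y x < d2 \<Longrightarrow> \<bar>Q y - Q x\<bar> < \<delta>"
    using \<delta> unfolding continuous_at_eps_delta dist_real_def by metis
  obtain d3 where d3: "d3 > 0" "ball x d3 \<subseteq> S"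
    using S open_contains_ball by blast
  define r where "r = min d1 (min d2 d3)"
  \<comment> \<open>Small enough that the whole parallelogram with sides
    \<open>t *\<^sub>R v\<close> and \<open>t *\<^sub>R w\<close> lies within distance
    \<open>r\<close> of \<open>x\<close>; the summand 1 avoids a zero denominator for
    \<open>v = w = 0\<close>.\<close>
  define t where "t = r / (2 * (norm v + norm w + 1))"
  have r: "r > 0"
    using d d3 by (simp add: r_def)
  have nn: "norm v + norm w + 1 > 0"
    by (simp add: add_nonneg_pos)
  then have t: "t > 0"
    using r by (simp add: t_def)
  have near: "dist (x + a *\<^sub>R v + b *\<^sub>R w) x < r" if "a \<in> {0..t}" "b \<in> {0..t}" for a b
  proof -
    have "dist (x + a *\<^sub>R v + b *\<^sub>R w) x \<le> norm (a *\<^sub>R v) + norm (b *\<^sub>R w)"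
      using norm_triangle_ineq[of "a *\<^sub>R v" "b *\<^sub>R w"] by (simp add: dist_norm algebra_simps)
    also have "\<dots> \<le> t * norm v + t * norm w"
      using that by (auto intro!: add_mono mult_right_mono)
    also have "\<dots> < t * (2 * (norm v + norm w + 1))"
      using t by (simp add: algebra_simps add_nonneg_pos)
    also have "\<dots> = r"
      using nn by (simp add: t_def)
    finally show ?thesis .
  qed
  have box: "x + a *\<^sub>R v + b *\<^sub>R w \<in> S" if "a \<in> {0..t}" "b \<in> {0..t}" for a b
    using near[OF that] d3 by (auto simp: r_def dist_commute)
  have box': "x + a *\<^sub>R w + b *\<^sub>R v \<in> S" if "a \<in> {0..t}" "b \<in> {0..t}" for a b
    using box[OF that(2,1)] by (simp add: algebra_simps)
  obtain a b where ab: "a \<in> {0..t}" "b \<in> {0..t}"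
    "f (x + t *\<^sub>R v + t *\<^sub>R w) - f (x + t *\<^sub>R v) - f (x + t *\<^sub>R w) + f x
      = t * t * P (x + a *\<^sub>R v + b *\<^sub>R w)"
    using second_difference_mean_value[OF S(1,2) t box] unfolding P_def by blast
  obtain a' b' where ab': "a' \<in> {0..t}" "b' \<in> {0..t}"
    "f (x + t *\<^sub>R w + t *\<^sub>R v) - f (x + t *\<^sub>R w) - f (x + t *\<^sub>R v) + f x
      = t * t * Q (x + a' *\<^sub>R w + b' *\<^sub>R v)"
    using second_difference_mean_value[OF S(1,2) t box'] unfolding Q_def by blast
  have "t * t * P (x + a *\<^sub>R v + b *\<^sub>R w) = t * t * Q (x + b' *\<^sub>R v + a' *\<^sub>R w)"
    using ab(3) ab'(3) by (simp add: algebra_simps)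
  then have "P (x + a *\<^sub>R v + b *\<^sub>R w) = Q (x + b' *\<^sub>R v + a' *\<^sub>R w)"
    using t by simp
  moreover have "\<bar>P (x + a *\<^sub>R v + b *\<^sub>R w) - P x\<bar> < \<delta>"
    using d(3) near[OF ab(1,2)] by (simp add: r_def)
  moreover have "\<bar>Q (x + b' *\<^sub>R v + a' *\<^sub>R w) - Q x\<bar> < \<delta>"
    using d(4) near[OF ab'(2,1)] by (simp add: r_def)
  moreover have "2 * \<delta> = \<bar>P x - Q x\<bar>"
    by (simp add: \<delta>_def)
  ultimately show False
    by (smt (verit))
qed

lemma fd_inner:
  assumes "f differentiable (at x)"
  shows "fd (\<lambda>y. f y \<bullet> i) x v = fd f x v \<bullet> i"
  using fd_eq[OF has_derivative_inner_left[OF fd_works[OF assms], of i]] by simp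

text \<open>The mean value argument is available for real values only, hence the reduction to
  components.\<close>

lemma fd_fd_commute:
  fixes f :: "'e::euclidean_space \<Rightarrow> 'f::euclidean_space"
  assumes S: "open S" "smooth_on S f" "x \<in> S"
  shows "fd (\<lambda>y. fd f y v) x w = fd (\<lambda>y. fd f y w) x v"
proof (rule euclidean_eqI)
  fix i :: 'f assume "i \<in> Basis"
  have sm: "smooth_on S (\<lambda>y. f y \<bullet> i)"
    by (intro smooth_on_inner smooth_on_const S)
  have *: "fd (\<lambda>y. fd f y v) x w \<bullet> i = fd (\<lambda>y. fd (\<lambda>y. f y \<bullet> i) y v) x w" for v w
  proof -
    have "fd (\<lambda>y. fd f y v) x w \<bullet> i = fd (\<lambda>y. fd f y v \<bullet> i) x w"
      using smooth_on_differentiable[OF smooth_on_fd[OF S(1,2)] S(3)] by (simp add: fd_inner)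
    also have "\<dots> = fd (\<lambda>y. fd (\<lambda>y. f y \<bullet> i) y v) x w"
      using fd_cong[OF S(1,3), of "\<lambda>y. fd f y v \<bullet> i" "\<lambda>y. fd (\<lambda>y. f y \<bullet> i) y v"]
        smooth_on_differentiable[OF S(2)] by (simp add: fd_inner)
    finally show ?thesis .
  qed
  show "fd (\<lambda>y. fd f y v) x w \<bullet> i = fd (\<lambda>y. fd f y w) x v \<bullet> i"
    unfolding * by (rule fd_fd_commute_real[OF S(1) sm S(3)])
qed

text \<open>One notion for the metric and for the Christoffel symbols in a chart. Smoothness is
  required for fixed arguments only; in finite dimension this gives smoothness also when the
  arguments vary, as \<open>smooth_on_bil\<close> shows.\<close>

definition smooth_bil :: "'e::euclidean_space set \<Rightarrow>
    ('e \<Rightarrow> 'f::euclidean_space \<Rightarrow> 'g::euclidean_space \<Rightarrow> 'v::euclidean_space) \<Rightarrow> bool" where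
  "smooth_bil S B \<longleftrightarrow> (\<forall>x\<in>S. bilinear (B x)) \<and> (\<forall>u w. smooth_on S (\<lambda>x. B x u w))"

lemma bilinear_basis_sum:
  fixes B :: "'f::euclidean_space \<Rightarrow> 'g::euclidean_space \<Rightarrow> 'v::real_vector"
  assumes "bilinear B"
  shows "B u w = (\<Sum>i\<in>Basis. \<Sum>j\<in>Basis. ((u \<bullet> i) * (w \<bullet> j)) *\<^sub>R B i j)"
proof -
  have 1: "linear (\<lambda>u. B u w)" and 2: "\<And>i. linear (B i)"
    using assms by (auto simp: bilinear_def)
  have "B u w = (\<Sum>i\<in>Basis. (u \<bullet> i) *\<^sub>R B i w)"
    by (rule linear_basis_sum[OF 1])
  also have "\<dots> = (\<Sum>i\<in>Basis. (u \<bullet> i) *\<^sub>R (\<Sum>j\<in>Basis. (w \<bullet> j) *\<^sub>R B i j))"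
    using linear_basis_sum[OF 2] by (metis (no_types, lifting))
  finally show ?thesis
    by (simp add: scaleR_sum_right)
qed

lemma smooth_bil_subset: "smooth_bil S B \<Longrightarrow> T \<subseteq> S \<Longrightarrow> smooth_bil T B"
  unfolding smooth_bil_def using smooth_on_subset by blast

lemma smooth_on_bil:
  assumes "open S" "open T" "smooth_bil S B" "y ` T \<subseteq> S"
    "smooth_on T y" "smooth_on T u" "smooth_on T w"
  shows "smooth_on T (\<lambda>z. B (y z) (u z) (w z))"
proof (rule smooth_on_cong[OF assms(2)])
  show "smooth_on T (\<lambda>z. \<Sum>i\<in>Basis. \<Sum>j\<in>Basis. ((u z \<bullet> i) * (w z \<bullet> j)) *\<^sub>R B (y z) i j)"
  proof (intro smooth_on_sum smooth_on_scaleR smooth_on_mult assms(2))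
    fix i j
    show "smooth_on T (\<lambda>z. u z \<bullet> i)" "smooth_on T (\<lambda>z. w z \<bullet> j)"
      by (rule smooth_on_inner[OF assms(2) _ smooth_on_const], fact)+
    show "smooth_on T (\<lambda>z. B (y z) i j)"
      by (rule smooth_on_compose[OF assms(2,1,4,5)]) (use assms(3) in \<open>simp add: smooth_bil_def\<close>)
  qed
  show "(\<Sum>i\<in>Basis. \<Sum>j\<in>Basis. ((u z \<bullet> i) * (w z \<bullet> j)) *\<^sub>R B (y z) i j) = B (y z) (u z) (w z)"
    if "z \<in> T" for z
    using bilinear_basis_sum[of "B (y z)" "u z" "w z"] assms(3,4) that by (auto simp: smooth_bil_def)
qed

lemma continuous_on_bil:
  assumes "smooth_bil S B" "y ` T \<subseteq> S"
    "continuous_on T y" "continuous_on T u" "continuous_on T w"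
  shows "continuous_on T (\<lambda>z. B (y z) (u z) (w z))"
proof -
  have "continuous_on T (\<lambda>z. \<Sum>i\<in>Basis. \<Sum>j\<in>Basis. ((u z \<bullet> i) * (w z \<bullet> j)) *\<^sub>R B (y z) i j)"
  proof (intro continuous_intros assms)
    fix i j
    have "continuous_on S (\<lambda>x. B x i j)"
      using assms(1) by (intro smooth_on_continuous) (simp add: smooth_bil_def)
    then show "continuous_on T (\<lambda>z. B (y z) i j)"
      by (rule continuous_on_compose2) (use assms in auto)
  qed
  then show ?thesis
    by (rule continuous_on_eq) (use bilinear_basis_sum[of "B (y _)"] assms(1,2) in \<open>force simp: smooth_bil_def\<close>)
qed

text \<open>Product rule with three contributions: the moving base point and the two arguments.
  Expanding in bases reduces it to products of differentiable coefficients.\<close>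

lemma has_derivative_bil:
  assumes S: "open S" "smooth_bil S B" and y0: "y t \<in> S"
    and y: "(y has_derivative y') (at t)" and u: "(u has_derivative u') (at t)"
    and w: "(w has_derivative w') (at t)"
  shows "((\<lambda>s. B (y s) (u s) (w s)) has_derivative
    (\<lambda>h. fd (\<lambda>x. B x (u t) (w t)) (y t) (y' h) + B (y t) (u' h) (w t) + B (y t) (u t) (w' h))) (at t)"
proof -
  have bil: "bilinear (B x)" if "x \<in> S" for x
    using S that by (auto simp: smooth_bil_def)
  have dB: "((\<lambda>x. B x i j) has_derivative fd (\<lambda>x. B x i j) (y t)) (at (y t))" for i j
    using S(2) y0 by (intro fd_works smooth_on_differentiable[of S]) (auto simp: smooth_bil_def)
  have dBy: "((\<lambda>s. B (y s) i j) has_derivative (\<lambda>h. fd (\<lambda>x. B x i j) (y t) (y' h))) (at t)" for i j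
    by (rule has_derivative_compose[OF y dB])
  define E where "E u w h = (\<Sum>i\<in>Basis. \<Sum>j\<in>Basis. ((u \<bullet> i) * (w \<bullet> j)) *\<^sub>R fd (\<lambda>x. B x i j) (y t) h)"
    for u w h
  have fdB: "fd (\<lambda>x. B x u w) (y t) = E u w" for u w
  proof -
    have "((\<lambda>x. \<Sum>i\<in>Basis. \<Sum>j\<in>Basis. ((u \<bullet> i) * (w \<bullet> j)) *\<^sub>R B x i j) has_derivative E u w) (at (y t))"
      unfolding E_def by (intro has_derivative_sum has_derivative_scaleR_right dB)
    then have "((\<lambda>x. B x u w) has_derivative E u w) (at (y t))"
      by (rule has_derivative_transform_within_open[OF _ S(1) y0])
        (rule bilinear_basis_sum[OF bil, symmetric])
    then show ?thesis
      by (rule fd_eq)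
  qed
  have bil': "bilinear (\<lambda>u w. B (y t) u w)"
    by (rule bil[OF y0])
  let ?D = "\<lambda>h. \<Sum>i\<in>Basis. \<Sum>j\<in>Basis.
      ((u t \<bullet> i) * (w t \<bullet> j)) *\<^sub>R fd (\<lambda>x. B x i j) (y t) (y' h) +
      ((u t \<bullet> i) * (w' h \<bullet> j) + (u' h \<bullet> i) * (w t \<bullet> j)) *\<^sub>R B (y t) i j"
  have "((\<lambda>s. \<Sum>i\<in>Basis. \<Sum>j\<in>Basis. ((u s \<bullet> i) * (w s \<bullet> j)) *\<^sub>R B (y s) i j) has_derivative ?D) (at t)"
    by (intro has_derivative_sum has_derivative_scaleR has_derivative_mult has_derivative_inner_left u w dBy)
  moreover have "?D h = fd (\<lambda>x. B x (u t) (w t)) (y t) (y' h) + B (y t) (u' h) (w t) + B (y t) (u t) (w' h)"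
      for h
  proof -
    have "?D h = E (u t) (w t) (y' h) + (\<Sum>i\<in>Basis. \<Sum>j\<in>Basis. ((u' h \<bullet> i) * (w t \<bullet> j)) *\<^sub>R B (y t) i j)
      + (\<Sum>i\<in>Basis. \<Sum>j\<in>Basis. ((u t \<bullet> i) * (w' h \<bullet> j)) *\<^sub>R B (y t) i j)"
      by (simp only: E_def sum.distrib scaleR_add_left add_ac)
    then show ?thesis
      by (simp only: fdB bilinear_basis_sum[OF bil', symmetric])
  qed
  ultimately have *: "((\<lambda>s. \<Sum>i\<in>Basis. \<Sum>j\<in>Basis. ((u s \<bullet> i) * (w s \<bullet> j)) *\<^sub>R B (y s) i j) has_derivative
     (\<lambda>h. fd (\<lambda>x. B x (u t) (w t)) (y t) (y' h) + B (y t) (u' h) (w t) + B (y t) (u t) (w' h))) (at t)"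
    by simp
  have "\<forall>\<^sub>F s in at t. y s \<in> S"
    using y has_derivative_continuous[OF y] S(1) y0
    by (metis continuous_at isCont_def topological_tendstoD)
  then have "\<forall>\<^sub>F s in at t. (\<Sum>i\<in>Basis. \<Sum>j\<in>Basis. ((u s \<bullet> i) * (w s \<bullet> j)) *\<^sub>R B (y s) i j) = B (y s) (u s) (w s)"
    by eventually_elim (rule bilinear_basis_sum[OF bil, symmetric])
  \<comment> \<open>The basis expansion equals \<open>B (y s) (u s) (w s)\<close> only while
    \<open>y s\<close> lies in \<open>S\<close>, which holds near \<open>t\<close> by continuity; so
    the derivative is transferred through an eventual equality.\<close>
  then show ?thesis
    by (rule has_derivative_transform_eventually[OF *])
      (use bilinear_basis_sum[OF bil', symmetric] in auto)
qed

text \<open>Needed to differentiate expressions such as a transition derivative applied to a moving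
  vector; it reduces to the bilinear product rule.\<close>

lemma has_derivative_fd_apply:
  fixes H :: "'e::euclidean_space \<Rightarrow> 'f::euclidean_space"
  assumes H: "open S" "smooth_on S H" and y0: "y t \<in> S"
    and y: "(y has_derivative y') (at t)" and u: "(u has_derivative u') (at t)"
  shows "((\<lambda>s. fd H (y s) (u s)) has_derivative
    (\<lambda>h. fd (\<lambda>x. fd H x (u t)) (y t) (y' h) + fd H (y t) (u' h))) (at t)"
proof -
  \<comment> \<open>The real argument is a dummy that turns the linear map \<open>fd H x\<close>
    into a bilinear one; it is held at 1 below.\<close>
  let ?D = "\<lambda>x (w::'e) (s::real). s *\<^sub>R fd H x w"
  have D: "smooth_bil S ?D"
    unfolding smooth_bil_def
  proof (intro conjI ballI allI)
    fix x assume "x \<in> S"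
    then show "bilinear (?D x)"
      using fd_linear_in[OF H(2)] by (auto simp: bilinear_def linear_iff algebra_simps)
  qed (intro smooth_on_scaleR smooth_on_const smooth_on_fd H)
  show ?thesis
    using has_derivative_bil[OF H(1) D y0 y u has_derivative_const[of 1]] by simp
qed

section \<open>Charts\<close>

lemma chart_chart_inv: "x \<in> snd c ` fst c \<Longrightarrow> snd c (chart_inv c x) = x"
  and chart_inv_in: "x \<in> snd c ` fst c \<Longrightarrow> chart_inv c x \<in> fst c"
  by (simp_all add: chart_inv_def f_inv_into_f inv_into_into)

lemma coord_change_eq: "coord_change c c' p = fd (\<lambda>x. snd c' (chart_inv c x)) (snd c p)"
  by (simp add: coord_change_def o_def)

context
  fixes A :: "('a::{t2_space,second_countable_topology}, 'e::euclidean_space) chart set"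
  assumes A: "smooth_manifold A"
begin

lemma chart_open [intro]: "c \<in> A \<Longrightarrow> open (fst c)"
  and chart_image_open [intro]: "c \<in> A \<Longrightarrow> open (snd c ` fst c)"
  and chart_continuous: "c \<in> A \<Longrightarrow> continuous_on (fst c) (snd c)"
  and chart_inv_continuous: "c \<in> A \<Longrightarrow> continuous_on (snd c ` fst c) (chart_inv c)"
  and chart_inv_chart: "c \<in> A \<Longrightarrow> p \<in> fst c \<Longrightarrow> chart_inv c (snd c p) = p"
  using A unfolding smooth_manifold_def smooth_atlas_def is_chart_def homeomorphism_def by auto

lemma chart_image_eq:
  assumes "c \<in> A" "U \<subseteq> fst c"
  shows "snd c ` U = snd c ` fst c \<inter> chart_inv c -` U"
  using assms chart_inv_chart[OF assms(1)] chart_chart_inv[of _ c] by force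

lemma open_chart_image: "c \<in> A \<Longrightarrow> open U \<Longrightarrow> U \<subseteq> fst c \<Longrightarrow> open (snd c ` U)"
  using chart_image_eq continuous_open_preimage[OF chart_inv_continuous chart_image_open] by metis

lemma open_chart_preimage: "c \<in> A \<Longrightarrow> open S \<Longrightarrow> open (fst c \<inter> snd c -` S)"
  using continuous_open_preimage[OF chart_continuous chart_open] by blast

lemma transition_smooth:
  "c \<in> A \<Longrightarrow> c' \<in> A \<Longrightarrow> smooth_on (snd c ` (fst c \<inter> fst c')) (\<lambda>x. snd c' (chart_inv c x))"
  using A unfolding smooth_manifold_def smooth_atlas_def o_def by blast

lemma chart_at_in: "chart_at A p \<in> A" and chart_at_mem: "p \<in> fst (chart_at A p)"
proof -
  have "\<exists>c. c \<in> A \<and> p \<in> fst c"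
    using A unfolding smooth_manifold_def atlas_carrier_def by blast
  from someI_ex[OF this] show "chart_at A p \<in> A" "p \<in> fst (chart_at A p)"
    unfolding chart_at_def by blast+
qed

lemma transition_differentiable:
  assumes "c \<in> A" "c' \<in> A" "p \<in> fst c" "p \<in> fst c'"
  shows "(\<lambda>x. snd c' (chart_inv c x)) differentiable (at (snd c p))"
  using assms by (intro smooth_on_differentiable[OF transition_smooth]) auto

lemma coord_change_linear:
  assumes "c \<in> A" "c' \<in> A" "p \<in> fst c" "p \<in> fst c'"
  shows "linear (coord_change c c' p)"
  unfolding coord_change_eq by (rule linear_frechet_derivative[OF transition_differentiable[OF assms]])

text \<open>Chain rule. The composed transition maps agree with the direct one only on the triple
  overlap, but this is open and contains the point, which is enough for derivatives.\<close>

lemma coord_change_comp: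
  assumes "c \<in> A" "c' \<in> A" "c'' \<in> A" "p \<in> fst c" "p \<in> fst c'" "p \<in> fst c''"
  shows "coord_change c' c'' p (coord_change c c' p v) = coord_change c c'' p v"
proof -
  let ?S = "snd c ` (fst c \<inter> fst c' \<inter> fst c'')"
  have S: "open ?S" "snd c p \<in> ?S"
    using assms by (auto intro!: open_chart_image)
  have "coord_change c' c'' p (coord_change c c' p v)
    = fd (\<lambda>x. snd c'' (chart_inv c' x)) (snd c' (chart_inv c (snd c p)))
      (fd (\<lambda>x. snd c' (chart_inv c x)) (snd c p) v)"
    using assms by (simp add: coord_change_eq chart_inv_chart)
  also have "\<dots> = fd (\<lambda>x. snd c'' (chart_inv c' (snd c' (chart_inv c x)))) (snd c p) v"
    using fd_compose[of "\<lambda>x. snd c' (chart_inv c x)" "snd c p" "\<lambda>x. snd c'' (chart_inv c' x)" v] assms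
    by (simp add: transition_differentiable chart_inv_chart)
  also have "\<dots> = fd (\<lambda>x. snd c'' (chart_inv c x)) (snd c p) v"
    by (rule arg_cong[where f = "\<lambda>f. f v"], rule fd_cong[OF S])
      (use assms in \<open>auto simp: chart_inv_chart\<close>)
  finally show ?thesis
    by (simp add: coord_change_eq)
qed

lemma coord_change_self:
  assumes "c \<in> A" "p \<in> fst c"
  shows "coord_change c c p v = v"
proof -
  have "fd (\<lambda>x. snd c (chart_inv c x)) (snd c p) = fd (\<lambda>x. x) (snd c p)"
    by (rule fd_cong[of "snd c ` fst c"]) (use assms in \<open>auto simp: chart_chart_inv\<close>)
  then show ?thesis
    by (simp add: coord_change_eq)
qed

lemma components_linear: "c \<in> A \<Longrightarrow> p \<in> fst c \<Longrightarrow> linear (components A c p)"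
  and from_components_linear: "c \<in> A \<Longrightarrow> p \<in> fst c \<Longrightarrow> linear (from_components A c p)"
  unfolding components_def[abs_def] from_components_def[abs_def]
  using coord_change_linear chart_at_in chart_at_mem by auto

lemma components_from_components:
  "c \<in> A \<Longrightarrow> p \<in> fst c \<Longrightarrow> components A c p (from_components A c p u) = u"
  and from_components_components:
  "c \<in> A \<Longrightarrow> p \<in> fst c \<Longrightarrow> from_components A c p (components A c p v) = v"
  unfolding components_def from_components_def
  by (simp_all add: coord_change_comp coord_change_self chart_at_in chart_at_mem)

lemma components_change:
  "c \<in> A \<Longrightarrow> c' \<in> A \<Longrightarrow> p \<in> fst c \<Longrightarrow> p \<in> fst c' \<Longrightarrow>
    coord_change c c' p (components A c p v) = components A c' p v"
  unfolding components_def by (simp add: coord_change_comp chart_at_in chart_at_mem)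

lemma components_chart_at: "components A (chart_at A p) p v = v"
  unfolding components_def by (simp add: coord_change_self chart_at_in chart_at_mem)

lemma components_inj:
  "c \<in> A \<Longrightarrow> p \<in> fst c \<Longrightarrow> components A c p v = components A c p w \<Longrightarrow> v = w"
  by (metis from_components_components)

text \<open>Transition maps carry smoothness from one suitable chart near each point to all charts.
  This is the tool for functions extended by zero off a chart.\<close>

lemma smooth_fun_local:
  assumes "\<And>p. \<exists>U c. open U \<and> p \<in> U \<and> c \<in> A \<and> U \<subseteq> fst c \<and> smooth_on (snd c ` U) (\<lambda>x. \<phi> (chart_inv c x))"
  shows "smooth_fun A \<phi>"
  unfolding smooth_fun_def o_def
proof (intro ballI smooth_on_local)
  fix d x assume d: "d \<in> A" and x: "x \<in> snd d ` fst d"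
  obtain U c where U: "open U" "chart_inv d x \<in> U" "c \<in> A" "U \<subseteq> fst c"
    "smooth_on (snd c ` U) (\<lambda>x. \<phi> (chart_inv c x))"
    using assms by blast
  define T where "T = snd d ` (U \<inter> fst d)"
  have T: "open T"
    unfolding T_def using U d by (intro open_chart_image) auto
  have "smooth_on T (\<lambda>x. \<phi> (chart_inv c (snd c (chart_inv d x))))"
  proof (rule smooth_on_compose[OF T, of "snd c ` U" "\<lambda>x. snd c (chart_inv d x)"])
    show "open (snd c ` U)"
      using U by (intro open_chart_image) auto
    show "smooth_on T (\<lambda>x. snd c (chart_inv d x))"
      by (rule smooth_on_subset[OF transition_smooth]) (use U d in \<open>auto simp: T_def\<close>)
  qed (use U d in \<open>auto simp: T_def chart_inv_chart\<close>)
  then have "smooth_on T (\<lambda>x. \<phi> (chart_inv d x))"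
    by (rule smooth_on_cong[OF T, rotated]) (use U d in \<open>auto simp: T_def chart_inv_chart\<close>)
  moreover have "x \<in> T"
    using x U d by (force simp: T_def chart_inv_chart)
  ultimately show "\<exists>T. open T \<and> x \<in> T \<and> smooth_on T (\<lambda>x. \<phi> (chart_inv d x))"
    using T by blast
qed

lemma smooth_fun_continuous:
  assumes "smooth_fun A \<phi>"
  shows "continuous_on UNIV \<phi>"
proof -
  have "isCont \<phi> p" for p
  proof -
    let ?c = "chart_at A p"
    have "smooth_on (snd ?c ` fst ?c) (\<phi> \<circ> chart_inv ?c)"
      using assms chart_at_in by (simp add: smooth_fun_def)
    then have "continuous_on (fst ?c) (\<lambda>q. (\<phi> \<circ> chart_inv ?c) (snd ?c q))"
      by (rule continuous_on_compose2[OF smooth_on_continuous chart_continuous[OF chart_at_in]]) simp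
    then have "continuous_on (fst ?c) \<phi>"
      by (rule continuous_on_eq) (simp add: chart_inv_chart chart_at_in)
    then show ?thesis
      using chart_open[OF chart_at_in] chart_at_mem by (simp add: continuous_on_eq_continuous_at)
  qed
  then show ?thesis
    by (simp add: continuous_at_imp_continuous_on)
qed

lemma dir_deriv_components:
  assumes "smooth_fun A \<phi>" "c \<in> A" "p \<in> fst c"
  shows "dir_deriv A \<phi> p v = fd (\<lambda>x. \<phi> (chart_inv c x)) (snd c p) (components A c p v)"
proof -
  let ?d = "chart_at A p"
  have d: "?d \<in> A" "p \<in> fst ?d"
    by (rule chart_at_in chart_at_mem)+
  let ?S = "snd ?d ` (fst ?d \<inter> fst c)"
  have S: "open ?S" "snd ?d p \<in> ?S"
    using assms d by (auto intro!: open_chart_image)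
  have "dir_deriv A \<phi> p v = fd (\<lambda>x. \<phi> (chart_inv ?d x)) (snd ?d p) v"
    by (simp add: dir_deriv_def o_def)
  also have "\<dots> = fd (\<lambda>x. \<phi> (chart_inv c (snd c (chart_inv ?d x)))) (snd ?d p) v"
    by (rule arg_cong[where f = "\<lambda>f. f v"], rule fd_cong[OF S])
      (use assms d in \<open>auto simp: chart_inv_chart\<close>)
  also have "\<dots> = fd (\<lambda>x. \<phi> (chart_inv c x)) (snd c (chart_inv ?d (snd ?d p)))
      (fd (\<lambda>x. snd c (chart_inv ?d x)) (snd ?d p) v)"
    using assms d
    by (intro fd_compose transition_differentiable smooth_on_differentiable[of "snd c ` fst c"])
      (auto simp: chart_inv_chart smooth_fun_def o_def)
  finally show ?thesis
    using d by (simp add: chart_inv_chart components_def coord_change_eq)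
qed

end

lemma local_domain_open:
  assumes "smooth_manifold A" "c \<in> A" "continuous_on UNIV f" "open T"
  shows "open (snd c ` (fst c \<inter> f -` T))"
  using assms open_vimage[of T f] by (intro open_chart_image[OF assms(1)]) auto

section \<open>Smooth maps, and sections along them\<close>

context
  fixes A :: "('a::{t2_space,second_countable_topology}, 'e::euclidean_space) chart set"
    and B :: "('b::{t2_space,second_countable_topology}, 'g::euclidean_space) chart set"
  assumes A: "smooth_manifold A" and B: "smooth_manifold B"
begin

lemma smooth_map_continuous: "smooth_map A B f \<Longrightarrow> continuous_on UNIV f"
  using A by (simp add: smooth_map_def smooth_manifold_def)

lemma smooth_map_local_smooth:
  "smooth_map A B f \<Longrightarrow> c \<in> A \<Longrightarrow> c' \<in> B \<Longrightarrow>
    smooth_on (snd c ` (fst c \<inter> f -` fst c')) (\<lambda>x. snd c' (f (chart_inv c x)))"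
  by (simp add: smooth_map_def o_def)

lemma smooth_map_differentiable:
  "smooth_map A B f \<Longrightarrow> c \<in> A \<Longrightarrow> c' \<in> B \<Longrightarrow> p \<in> fst c \<Longrightarrow> f p \<in> fst c' \<Longrightarrow>
    (\<lambda>x. snd c' (f (chart_inv c x))) differentiable (at (snd c p))"
  by (rule smooth_on_differentiable[OF smooth_map_local_smooth]) auto

text \<open>The definition uses preferred charts, which vary with the point. In fixed charts the
  differential becomes an ordinary derivative, which can be differentiated further.\<close>

lemma components_differential:
  assumes f: "smooth_map A B f" and c: "c \<in> A" "c' \<in> B" "p \<in> fst c" "f p \<in> fst c'"
  shows "components B c' (f p) (differential A B f p v)
    = fd (\<lambda>x. snd c' (f (chart_inv c x))) (snd c p) (components A c p v)"
proof -
  let ?d = "chart_at A p" and ?d' = "chart_at B (f p)"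
  have d: "?d \<in> A" "?d' \<in> B" "p \<in> fst ?d" "f p \<in> fst ?d'"
    using chart_at_in chart_at_mem A B by blast+
  let ?S = "snd ?d ` (fst ?d \<inter> (fst c \<inter> f -` (fst c' \<inter> fst ?d')))"
  have "open (f -` (fst c' \<inter> fst ?d'))"
    using smooth_map_continuous[OF f] chart_open[OF B c(2)] chart_open[OF B d(2)]
    by (intro open_vimage) auto
  then have S: "open ?S" "snd ?d p \<in> ?S"
    using c d chart_open[OF A c(1)] chart_open[OF A d(1)] by (auto intro!: open_chart_image[OF A])
  have "components B c' (f p) (differential A B f p v) =
    fd (\<lambda>y. snd c' (chart_inv ?d' y)) (snd ?d' (f (chart_inv ?d (snd ?d p))))
      (fd (\<lambda>x. snd ?d' (f (chart_inv ?d x))) (snd ?d p) v)"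
    using d by (simp add: components_def coord_change_eq differential_def o_def chart_inv_chart[OF A])
  also have "\<dots> = fd (\<lambda>x. snd c' (chart_inv ?d' (snd ?d' (f (chart_inv ?d x))))) (snd ?d p) v"
    using c d
    by (intro fd_compose[symmetric] smooth_map_differentiable f)
      (auto simp: chart_inv_chart[OF A] intro!: transition_differentiable[OF B])
  also have "\<dots> = fd (\<lambda>x. snd c' (f (chart_inv c (snd c (chart_inv ?d x))))) (snd ?d p) v"
    by (rule arg_cong[where f = "\<lambda>f. f v"], rule fd_cong[OF S])
      (use c d in \<open>auto simp: chart_inv_chart[OF A] chart_inv_chart[OF B]\<close>)
  also have "\<dots> = fd (\<lambda>x. snd c' (f (chart_inv c x))) (snd c (chart_inv ?d (snd ?d p)))
      (fd (\<lambda>x. snd c (chart_inv ?d x)) (snd ?d p) v)"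
    using c d f
    by (intro fd_compose[where f = "\<lambda>x. snd c' (f (chart_inv c x))"] transition_differentiable[OF A])
      (auto simp: chart_inv_chart[OF A] intro!: smooth_map_differentiable)
  finally show ?thesis
    using d by (simp add: chart_inv_chart[OF A] components_def coord_change_eq)
qed

lemma differential_linear:
  assumes f: "smooth_map A B f"
  shows "linear (differential A B f p)"
  unfolding differential_def[abs_def] o_def
  using assms by (intro linear_frechet_derivative smooth_map_differentiable chart_at_in chart_at_mem A B)

lemma sections_rep_smooth:
  "W \<in> sections A B f \<Longrightarrow> c \<in> A \<Longrightarrow> c' \<in> B \<Longrightarrow>
    smooth_on (snd c ` (fst c \<inter> f -` fst c'))
      (\<lambda>x. components B c' (f (chart_inv c x)) (W (chart_inv c x)))"
  by (simp add: sections_def smooth_along_def)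

lemma sections_local:
  assumes f: "smooth_map A B f"
    and W: "\<And>p. \<exists>U c c'. open U \<and> p \<in> U \<and> c \<in> A \<and> c' \<in> B \<and> U \<subseteq> fst c \<and> f ` U \<subseteq> fst c' \<and>
      smooth_on (snd c ` U) (\<lambda>x. components B c' (f (chart_inv c x)) (W (chart_inv c x)))"
  shows "W \<in> sections A B f"
  unfolding sections_def smooth_along_def
proof (intro CollectI ballI smooth_on_local)
  fix d d' x assume d: "d \<in> A" "d' \<in> B" and "x \<in> snd d ` (UNIV \<inter> fst d \<inter> f -` fst d')"
  then have x: "x \<in> snd d ` fst d" "f (chart_inv d x) \<in> fst d'"
    by (auto simp: chart_inv_chart[OF A])
  obtain U c c' where U: "open U" "chart_inv d x \<in> U" "c \<in> A" "c' \<in> B" "U \<subseteq> fst c" "f ` U \<subseteq> fst c'"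
    "smooth_on (snd c ` U) (\<lambda>x. components B c' (f (chart_inv c x)) (W (chart_inv c x)))"
    using W[of "chart_inv d x"] by (elim exE conjE) (rule that)
  have fo: "open (f -` fst d')"
    using smooth_map_continuous[OF f] chart_open[OF B d(2)] by (simp add: open_vimage)
  define T where "T = snd d ` (U \<inter> fst d \<inter> f -` fst d')"
  have T: "open T"
    unfolding T_def using U d fo chart_open[OF A d(1)] by (intro open_chart_image[OF A]) auto
  let ?y = "\<lambda>x. snd c' (f (chart_inv d x))"
  let ?w = "\<lambda>x. components B c' (f (chart_inv d x)) (W (chart_inv d x))"
  have y: "smooth_on T ?y"
    by (rule smooth_on_subset[OF smooth_map_local_smooth[OF f d(1) U(4)]]) (use U in \<open>auto simp: T_def\<close>)
  have "smooth_on T (\<lambda>x. (\<lambda>x. components B c' (f (chart_inv c x)) (W (chart_inv c x))) (snd c (chart_inv d x)))"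
  proof (rule smooth_on_compose[OF T _ _ _ U(7)])
    show "open (snd c ` U)"
      using U by (intro open_chart_image[OF A]) auto
    show "smooth_on T (\<lambda>x. snd c (chart_inv d x))"
      by (rule smooth_on_subset[OF transition_smooth[OF A]]) (use U d in \<open>auto simp: T_def\<close>)
  qed (use U d in \<open>auto simp: T_def chart_inv_chart[OF A]\<close>)
  then have w: "smooth_on T ?w"
    by (rule smooth_on_cong[OF T, rotated]) (use U d in \<open>auto simp: T_def chart_inv_chart[OF A] subset_iff\<close>)
  \<comment> \<open>Components in \<open>d'\<close> arise from those in \<open>c'\<close> by
    applying the derivative of the transition map at a moving point; expanding in the basis
    separates two smooth factors.\<close>
  have "smooth_on T (\<lambda>x. \<Sum>b\<in>Basis. (?w x \<bullet> b) *\<^sub>R fd (\<lambda>y. snd d' (chart_inv c' y)) (?y x) b)"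
  proof (intro smooth_on_sum smooth_on_scaleR T)
    fix b :: 'g
    show "smooth_on T (\<lambda>x. ?w x \<bullet> b)"
      by (rule smooth_on_inner[OF T w smooth_on_const])
    have o: "open (snd c' ` (fst c' \<inter> fst d'))"
      using U d chart_open[OF B U(4)] chart_open[OF B d(2)] by (intro open_chart_image[OF B]) auto
    show "smooth_on T (\<lambda>x. fd (\<lambda>y. snd d' (chart_inv c' y)) (?y x) b)"
      by (rule smooth_on_compose[OF T o _ y smooth_on_fd[OF o transition_smooth[OF B U(4) d(2)]]])
        (use U d in \<open>auto simp: T_def chart_inv_chart[OF A] subset_iff\<close>)
  qed
  then have "smooth_on T (\<lambda>x. components B d' (f (chart_inv d x)) (W (chart_inv d x)))"
  proof (rule smooth_on_cong[OF T, rotated])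
    fix x assume x: "x \<in> T"
    then have m: "f (chart_inv d x) \<in> fst c'" "f (chart_inv d x) \<in> fst d'"
      using U d by (auto simp: T_def chart_inv_chart[OF A])
    show "(\<Sum>b\<in>Basis. (?w x \<bullet> b) *\<^sub>R fd (\<lambda>y. snd d' (chart_inv c' y)) (?y x) b)
      = components B d' (f (chart_inv d x)) (W (chart_inv d x))"
      using linear_basis_sum[OF coord_change_linear[OF B U(4) d(2) m], of "?w x"]
        components_change[OF B U(4) d(2) m] by (simp add: coord_change_eq)
  qed
  moreover have "x \<in> T"
    using x U d by (force simp: T_def chart_inv_chart[OF A])
  ultimately show "\<exists>T. open T \<and> x \<in> T \<and>
      smooth_on T (\<lambda>x. components B d' (f (chart_inv d x)) (W (chart_inv d x)))"
    using T by blast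
qed

lemma sections_add:
  assumes f: "smooth_map A B f" and "V \<in> sections A B f" "W \<in> sections A B f"
  shows "(\<lambda>p. V p + W p) \<in> sections A B f"
  unfolding sections_def smooth_along_def
proof (intro CollectI ballI)
  fix c c' assume c: "c \<in> A" "c' \<in> B"
  have o: "open (snd c ` (fst c \<inter> f -` fst c'))"
    using local_domain_open[OF A c(1) smooth_map_continuous[OF f] chart_open[OF B c(2)]] .
  have "smooth_on (snd c ` (fst c \<inter> f -` fst c'))
     (\<lambda>x. components B c' (f (chart_inv c x)) (V (chart_inv c x))
         + components B c' (f (chart_inv c x)) (W (chart_inv c x)))"
    using assms c by (intro smooth_on_add o sections_rep_smooth)
  then have "smooth_on (snd c ` (fst c \<inter> f -` fst c'))
     (\<lambda>x. components B c' (f (chart_inv c x)) (V (chart_inv c x) + W (chart_inv c x)))"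
    by (rule smooth_on_cong[OF o, rotated])
      (use c linear_add[OF components_linear[OF B c(2)]] in \<open>auto simp: chart_inv_chart[OF A]\<close>)
  then show "smooth_on (snd c ` (UNIV \<inter> fst c \<inter> f -` fst c'))
     (\<lambda>x. components B c' (f (chart_inv c x)) (V (chart_inv c x) + W (chart_inv c x)))"
    by simp
qed

lemma sections_scale:
  assumes f: "smooth_map A B f" and "smooth_fun A \<phi>" "W \<in> sections A B f"
  shows "(\<lambda>p. \<phi> p *\<^sub>R W p) \<in> sections A B f"
  unfolding sections_def smooth_along_def
proof (intro CollectI ballI)
  fix c c' assume c: "c \<in> A" "c' \<in> B"
  have o: "open (snd c ` (fst c \<inter> f -` fst c'))"
    using local_domain_open[OF A c(1) smooth_map_continuous[OF f] chart_open[OF B c(2)]] .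
  have "smooth_on (snd c ` (fst c \<inter> f -` fst c')) (\<lambda>x. \<phi> (chart_inv c x))"
    by (rule smooth_on_subset[of "snd c ` fst c"]) (use assms c in \<open>auto simp: smooth_fun_def o_def\<close>)
  then have "smooth_on (snd c ` (fst c \<inter> f -` fst c'))
     (\<lambda>x. \<phi> (chart_inv c x) *\<^sub>R components B c' (f (chart_inv c x)) (W (chart_inv c x)))"
    using assms c by (intro smooth_on_scaleR o sections_rep_smooth)
  then have "smooth_on (snd c ` (fst c \<inter> f -` fst c'))
     (\<lambda>x. components B c' (f (chart_inv c x)) (\<phi> (chart_inv c x) *\<^sub>R W (chart_inv c x)))"
    by (rule smooth_on_cong[OF o, rotated])
      (use c linear_cmul[OF components_linear[OF B c(2)]] in \<open>auto simp: chart_inv_chart[OF A]\<close>)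
  then show "smooth_on (snd c ` (UNIV \<inter> fst c \<inter> f -` fst c'))
     (\<lambda>x. components B c' (f (chart_inv c x)) (\<phi> (chart_inv c x) *\<^sub>R W (chart_inv c x)))"
    by simp
qed

lemma sections_zero:
  assumes f: "smooth_map A B f"
  shows "(\<lambda>p. 0) \<in> sections A B f"
  unfolding sections_def smooth_along_def
proof (intro CollectI ballI)
  fix c c' assume c: "c \<in> A" "c' \<in> B"
  show "smooth_on (snd c ` (UNIV \<inter> fst c \<inter> f -` fst c')) (\<lambda>x. components B c' (f (chart_inv c x)) 0)"
    using local_domain_open[OF A c(1) smooth_map_continuous[OF f] chart_open[OF B c(2)]]
    by (intro smooth_on_cong[OF _ _ smooth_on_const[of _ 0]])
      (use c linear_0[OF components_linear[OF B c(2)]] in \<open>auto simp: chart_inv_chart[OF A]\<close>)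
qed

lemma sections_sum:
  assumes f: "smooth_map A B f" and "\<And>i. i \<in> I \<Longrightarrow> W i \<in> sections A B f"
  shows "(\<lambda>p. \<Sum>i\<in>I. W i p) \<in> sections A B f"
  using assms(2)
  by (induction I rule: infinite_finite_induct) (auto intro!: sections_add sections_zero f)

end

lemma smooth_map_id:
  assumes A: "smooth_manifold A"
  shows "smooth_map A A id"
proof -
  have "fst c \<inter> id -` fst c' = fst c \<inter> fst c'" for c c' :: "('a, 'b) chart"
    by auto
  then show ?thesis
    unfolding smooth_map_def o_def using transition_smooth[OF A] by auto
qed

lemma sections_compose:
  fixes A :: "('a::{t2_space,second_countable_topology}, 'e::euclidean_space) chart set"
    and B :: "('b::{t2_space,second_countable_topology}, 'g::euclidean_space) chart set"
  assumes A: "smooth_manifold A" and B: "smooth_manifold B" and f: "smooth_map A B f"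
    and X: "X \<in> vector_fields B"
  shows "X \<circ> f \<in> sections A B f"
  unfolding sections_def smooth_along_def
proof (intro CollectI ballI)
  fix c c' assume c: "c \<in> A" "c' \<in> B"
  have o: "open (snd c ` (fst c \<inter> f -` fst c'))"
    using local_domain_open[OF A c(1) smooth_map_continuous[OF A B f] chart_open[OF B c(2)]] .
  have X': "smooth_on (snd c' ` fst c') (\<lambda>x. components B c' (chart_inv c' x) (X (chart_inv c' x)))"
    using X c by (fastforce simp: vector_fields_def sections_def smooth_along_def)
  have "smooth_on (snd c ` (fst c \<inter> f -` fst c'))
    (\<lambda>x. (\<lambda>y. components B c' (chart_inv c' y) (X (chart_inv c' y))) (snd c' (f (chart_inv c x))))"
    by (rule smooth_on_compose[OF o chart_image_open[OF B c(2)] _ smooth_map_local_smooth[OF A B f c] X'])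
      (auto simp: chart_inv_chart[OF A c(1)])
  then have "smooth_on (snd c ` (fst c \<inter> f -` fst c'))
    (\<lambda>x. components B c' (f (chart_inv c x)) (X (f (chart_inv c x))))"
    by (rule smooth_on_cong[OF o, rotated]) (use c in \<open>auto simp: chart_inv_chart[OF A] chart_inv_chart[OF B]\<close>)
  then show "smooth_on (snd c ` (UNIV \<inter> fst c \<inter> f -` fst c'))
    (\<lambda>x. components B c' (f (chart_inv c x)) ((X \<circ> f) (chart_inv c x)))"
    by simp
qed

section \<open>Bump functions\<close>

text \<open>The functions P(1/x) exp(-1/x), extended by zero. Letting P range over all polynomials
  makes the family closed under differentiation, so smoothness follows by induction.\<close>

definition flat :: "real poly \<Rightarrow> real \<Rightarrow> real" where
  "flat P x = (if x > 0 then poly P (1 / x) * exp (- (1 / x)) else 0)"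

lemma poly_exp_neg_tendsto_0: "((\<lambda>y. poly P y * exp (- y)) \<longlongrightarrow> 0) at_top"
  for P :: "real poly"
proof -
  have "((\<lambda>y. \<Sum>i\<le>degree P. coeff P i * (y ^ i / exp y)) \<longlongrightarrow> (\<Sum>i\<le>degree P. coeff P i * 0)) at_top"
    by (intro tendsto_sum tendsto_mult tendsto_const tendsto_power_div_exp_0)
  then show ?thesis
    by (simp add: poly_altdef sum_distrib_right exp_minus divide_inverse mult.assoc)
qed

text \<open>For positive x, the derivative of P(1/x) exp(-1/x) is (P - P')(1/x) exp(-1/x) / x^2, and
  the factor 1/x^2 is the monomial \<open>[:0, 0, 1:]\<close> at 1/x.\<close>

lemma flat_has_derivative:
  "(flat P has_real_derivative flat ([:0, 0, 1:] * (P - pderiv P)) x) (at x)"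
proof -
  consider "x > 0" | "x < 0" | "x = 0" by linarith
  then show ?thesis
  proof cases
    case 1
    have "((\<lambda>x. poly P (1 / x) * exp (- (1 / x))) has_real_derivative
      flat ([:0, 0, 1:] * (P - pderiv P)) x) (at x)"
      using 1 by (auto intro!: derivative_eq_intros DERIV_chain2[OF poly_DERIV]
          simp: flat_def field_simps power2_eq_square)
    then show ?thesis
      by (rule has_field_derivative_transform_within_open[of _ _ _ "{0<..}"]) (use 1 in \<open>auto simp: flat_def\<close>)
  next
    case 2
    have "((\<lambda>x. 0) has_real_derivative flat ([:0, 0, 1:] * (P - pderiv P)) x) (at x)"
      using 2 by (simp add: flat_def)
    then show ?thesis
      by (rule has_field_derivative_transform_within_open[of _ _ _ "{..<0}"]) (use 2 in \<open>auto simp: flat_def\<close>)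
  next
    case 3
    \<comment> \<open>With y = 1/h the difference quotient at 0 becomes y P(y) exp(-y), a polynomial
      times a decaying exponential.\<close>
    have "((\<lambda>h. flat P h / h) \<longlongrightarrow> 0) (at_right 0)"
    proof (subst filterlim_at_right_to_top, rule Lim_transform_eventually)
      show "((\<lambda>y. poly ([:0, 1:] * P) y * exp (- y)) \<longlongrightarrow> 0) at_top"
        by (rule poly_exp_neg_tendsto_0)
      show "\<forall>\<^sub>F y in at_top. poly ([:0, 1:] * P) y * exp (- y) = flat P (inverse y) / inverse y"
        using eventually_gt_at_top[of 0] by eventually_elim (simp add: flat_def field_simps)
    qed
    moreover have "((\<lambda>h. flat P h / h) \<longlongrightarrow> 0) (at_left 0)"
    proof (rule Lim_transform_eventually[OF tendsto_const])
      show "\<forall>\<^sub>F h in at_left 0. 0 = flat P h / h"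
        by (auto simp: flat_def eventually_at_filter)
    qed
    ultimately have "((\<lambda>h. flat P h / h) \<longlongrightarrow> 0) (at 0)"
      by (simp add: filterlim_at_split)
    then show ?thesis
      using 3 by (simp add: has_field_derivative_iff flat_def)
  qed
qed

lemma flat_smooth: "smooth_on UNIV (flat P)"
  unfolding smooth_on_def
proof
  fix k show "Ck_on k UNIV (flat P)"
  proof (induction k arbitrary: P)
    case 0
    then show ?case
      using DERIV_isCont[OF flat_has_derivative] by (auto intro: continuous_at_imp_continuous_on)
  next
    case (Suc k)
    have D: "(flat P has_derivative (*) (flat ([:0, 0, 1:] * (P - pderiv P)) x)) (at x)" for x
      using flat_has_derivative by (simp add: has_field_derivative_def)
    then have "fd (flat P) x 1 = flat ([:0, 0, 1:] * (P - pderiv P)) x" for x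
      by (simp add: fd_eq[OF D])
    then show ?case
      using D Suc by (auto simp: differentiable_def simp del: mult_pCons_left)
  qed
qed

lemma flat_one_mono: "x \<le> y \<Longrightarrow> flat 1 x \<le> flat 1 y"
  by (auto simp: flat_def frac_le)

lemma euclidean_bump:
  fixes x0 :: "'e::euclidean_space"
  assumes r: "r > 0"
  shows "\<exists>b::'e \<Rightarrow> real. smooth_on UNIV b \<and> (\<forall>x\<in>ball x0 r. b x = 1) \<and> (\<forall>x. x \<notin> ball x0 (2 * r) \<longrightarrow> b x = 0)"
proof -
  \<comment> \<open>On the ball of radius \<open>r\<close> the argument of \<open>s\<close> is at
    least \<open>3 * r\<^sup>2\<close>, so \<open>s x\<close> is at least \<open>C\<close> and the
    correction in \<open>b\<close> vanishes. Outside radius \<open>2 * r\<close> one has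
    \<open>s x = 0\<close>, and the correction is exactly -1.\<close>
  define C where "C = flat 1 (3 * r\<^sup>2)"
  define s where "s x = flat 1 (4 * r\<^sup>2 - (x - x0) \<bullet> (x - x0))" for x
  define b where "b x = 1 + (- (1 / flat 1 C)) * flat 1 (C - s x)" for x
  have C: "C > 0"
    using r by (simp add: C_def flat_def)
  have sq: "(x - x0) \<bullet> (x - x0) = (dist x0 x)\<^sup>2" for x
    by (simp add: dist_norm power2_norm_eq_inner inner_diff inner_commute)
  have sub: "smooth_on UNIV (\<lambda>x. x - x0)"
    using smooth_on_add[OF open_UNIV smooth_on_id smooth_on_const[of UNIV "- x0"]] by simp
  have "smooth_on UNIV s"
    unfolding s_def[abs_def]
    by (intro smooth_on_compose[of UNIV UNIV "\<lambda>x. 4 * r\<^sup>2 - (x - x0) \<bullet> (x - x0)" "flat 1"]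
        flat_smooth smooth_on_diff smooth_on_const smooth_on_inner sub) auto
  then have "smooth_on UNIV (\<lambda>x. flat 1 (C - s x))"
    by (intro smooth_on_compose[of UNIV UNIV "\<lambda>x. C - s x" "flat 1"]
        flat_smooth smooth_on_diff smooth_on_const) auto
  then have "smooth_on UNIV b"
    unfolding b_def[abs_def] by (intro smooth_on_add smooth_on_mult smooth_on_const) auto
  moreover have "b x = 1" if "x \<in> ball x0 r" for x
  proof -
    have "(dist x0 x)\<^sup>2 \<le> r\<^sup>2"
      using that by (intro power_mono) auto
    then have "C \<le> s x"
      unfolding C_def s_def sq by (intro flat_one_mono) simp
    then show ?thesis
      by (simp add: b_def flat_def)
  qed
  moreover have "b x = 0" if "x \<notin> ball x0 (2 * r)" for x
  proof -
    have "(2 * r)\<^sup>2 \<le> (dist x0 x)\<^sup>2"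
      using that r by (intro power_mono) auto
    then have "s x = 0"
      by (simp add: s_def sq flat_def power_mult_distrib)
    moreover have "flat 1 C > 0"
      using C by (simp add: flat_def)
    ultimately show ?thesis
      by (simp add: b_def)
  qed
  ultimately show ?thesis
    by blast
qed

text \<open>\<open>U\<close> is the region where cutting off changes nothing. \<open>K\<close> is
  closed in the whole space, so that objects multiplied by \<open>\<psi>\<close> extend by zero
  across the boundary of the chart domain.\<close>

definition bump_in :: "('b::topological_space, 'e::euclidean_space) chart set \<Rightarrow> ('b, 'e) chart \<Rightarrow>
    'b set \<Rightarrow> 'b set \<Rightarrow> ('b \<Rightarrow> real) \<Rightarrow> bool" where
  "bump_in B c U K \<psi> \<longleftrightarrow> c \<in> B \<and> open U \<and> closed K \<and> U \<subseteq> fst c \<and> K \<subseteq> fst c \<and> smooth_fun B \<psi> \<and>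
     (\<forall>q\<in>U. \<psi> q = 1) \<and> (\<forall>q. q \<notin> K \<longrightarrow> \<psi> q = 0)"

lemma bump_exists:
  fixes B :: "('b::{t2_space,second_countable_topology}, 'e::euclidean_space) chart set"
  assumes B: "smooth_manifold B" and c: "c \<in> B" "q0 \<in> fst c"
  obtains r U K \<psi> where "r > 0" "cball (snd c q0) (3 * r) \<subseteq> snd c ` fst c" "q0 \<in> U"
    "snd c ` K \<subseteq> cball (snd c q0) (2 * r)" "bump_in B c U K \<psi>"
proof -
  let ?x = "snd c q0" and ?S = "snd c ` fst c"
  obtain r0 where r0: "r0 > 0" "cball ?x r0 \<subseteq> ?S"
    using c chart_image_open[OF B c(1)] open_contains_cball by blast
  \<comment> \<open>A third of the radius leaves a margin \<open>r\<close> between \<open>K\<close>,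
    contained in radius \<open>2 * r\<close>, and the boundary of the larger ball: room for the
    later displacement of points inside the chart.\<close>
  define r where "r = r0 / 3"
  have r: "r > 0" "cball ?x (3 * r) \<subseteq> ?S"
    using r0 by (simp_all add: r_def)
  have sub: "cball ?x (2 * r) \<subseteq> ?S" "ball ?x r \<subseteq> ?S"
    using r by (fastforce)+
  obtain b :: "'e \<Rightarrow> real" where b: "smooth_on UNIV b" "\<And>x. x \<in> ball ?x r \<Longrightarrow> b x = 1"
    "\<And>x. x \<notin> ball ?x (2 * r) \<Longrightarrow> b x = 0"
    using euclidean_bump[OF r(1)] by blast
  define U where "U = fst c \<inter> snd c -` ball ?x r"
  define K where "K = chart_inv c ` cball ?x (2 * r)"
  define \<psi> where "\<psi> q = (if q \<in> fst c then b (snd c q) else 0)" for q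
  \<comment> \<open>Closedness in the whole manifold, not merely in the chart domain, comes from
    compactness in a Hausdorff space.\<close>
  have "compact K"
    unfolding K_def using chart_inv_continuous[OF B c(1)] sub
    by (intro compact_continuous_image) (auto intro: continuous_on_subset)
  then have K: "closed K" "K \<subseteq> fst c" "snd c ` K \<subseteq> cball ?x (2 * r)"
    using sub(1) by (auto simp: K_def compact_imp_closed subset_iff
        intro: chart_inv_in[of _ c] simp: chart_chart_inv[of _ c])
  have U: "open U" "U \<subseteq> fst c" "q0 \<in> U"
    using r c by (auto simp: U_def open_chart_preimage[OF B])
  have zero: "\<psi> q = 0" if "q \<notin> K" for q
  proof (cases "q \<in> fst c")
    case True
    then have "snd c q \<notin> cball ?x (2 * r)"
      using that chart_inv_chart[OF B c(1)] by (force simp: K_def)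
    then show ?thesis
      using b(3) by (auto simp: \<psi>_def)
  qed (simp add: \<psi>_def)
  have "smooth_fun B \<psi>"
  proof (rule smooth_fun_local[OF B])
    fix q
    show "\<exists>U d. open U \<and> q \<in> U \<and> d \<in> B \<and> U \<subseteq> fst d \<and> smooth_on (snd d ` U) (\<lambda>x. \<psi> (chart_inv d x))"
    proof (cases "q \<in> fst c")
      case True
      have "smooth_on (snd c ` fst c) (\<lambda>x. \<psi> (chart_inv c x))"
        by (rule smooth_on_cong[OF chart_image_open[OF B c(1)] _ smooth_on_subset[OF b(1)]])
          (auto simp: \<psi>_def chart_inv_chart[OF B c(1)])
      then show ?thesis
        using True c chart_open[OF B c(1)] by blast
    next
      case False
      let ?d = "chart_at B q"
      have d: "?d \<in> B" "q \<in> fst ?d"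
        by (rule chart_at_in[OF B] chart_at_mem[OF B])+
      have o: "open (fst ?d - K)"
        using K chart_open[OF B d(1)] by auto
      have "smooth_on (snd ?d ` (fst ?d - K)) (\<lambda>x. \<psi> (chart_inv ?d x))"
        by (rule smooth_on_cong[OF open_chart_image[OF B d(1) o] _ smooth_on_const[of _ 0]])
          (auto simp: chart_inv_chart[OF B d(1)] zero)
      then show ?thesis
        using False d o K(2) by blast
    qed
  qed
  moreover have "\<forall>q\<in>U. \<psi> q = 1"
    using b(2) by (auto simp: U_def \<psi>_def)
  ultimately have "bump_in B c U K \<psi>"
    unfolding bump_in_def using c U K zero by blast
  then show ?thesis
    using that r U K by blast
qed

section \<open>Local formulas for operators on sections\<close>

lemma smooth_fun_compose:
  assumes A: "smooth_manifold A" and B: "smooth_manifold B" and f: "smooth_map A B f"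
    and \<psi>: "smooth_fun B \<psi>"
  shows "smooth_fun A (\<lambda>p. \<psi> (f p))"
proof (rule smooth_fun_local[OF A])
  fix p
  let ?c = "chart_at A p" and ?d = "chart_at B (f p)"
  have c: "?c \<in> A" "p \<in> fst ?c" and d: "?d \<in> B" "f p \<in> fst ?d"
    using chart_at_in chart_at_mem A B by blast+
  let ?U = "fst ?c \<inter> f -` fst ?d"
  have U: "open ?U"
    using chart_open[OF A c(1)] chart_open[OF B d(1)] smooth_map_continuous[OF A B f]
    by (simp add: open_Int open_vimage)
  have o: "open (snd ?c ` ?U)"
    using U c by (intro open_chart_image[OF A]) auto
  have "smooth_on (snd ?c ` ?U) (\<lambda>x. (\<psi> \<circ> chart_inv ?d) (snd ?d (f (chart_inv ?c x))))"
  proof (rule smooth_on_compose[OF o chart_image_open[OF B d(1)] _ smooth_map_local_smooth[OF A B f c(1) d(1)]])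
    show "smooth_on (snd ?d ` fst ?d) (\<psi> \<circ> chart_inv ?d)"
      using \<psi> d(1) unfolding smooth_fun_def by (rule bspec)
  qed (auto simp: chart_inv_chart[OF A c(1)])
  then have "smooth_on (snd ?c ` ?U) (\<lambda>x. \<psi> (f (chart_inv ?c x)))"
    by (rule smooth_on_cong[OF o, rotated])
      (auto simp: chart_inv_chart[OF A c(1)] chart_inv_chart[OF B d(1)])
  then show "\<exists>U c. open U \<and> p \<in> U \<and> c \<in> A \<and> U \<subseteq> fst c \<and> smooth_on (snd c ` U) (\<lambda>x. \<psi> (f (chart_inv c x)))"
    using U c d by (intro exI[of _ ?U] exI[of _ ?c]) auto
qed

lemma smooth_fun_mult:
  assumes A: "smooth_manifold A" and "smooth_fun A \<phi>" "smooth_fun A \<eta>"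
  shows "smooth_fun A (\<lambda>p. \<phi> p * \<eta> p)"
  using assms(2,3) unfolding smooth_fun_def o_def
  by (intro ballI smooth_on_mult chart_image_open[OF A]) auto

lemma smooth_fun_one_minus:
  assumes A: "smooth_manifold A" and "smooth_fun A \<phi>"
  shows "smooth_fun A (\<lambda>p. 1 - \<phi> p)"
  using assms(2) unfolding smooth_fun_def o_def
  by (intro ballI smooth_on_diff smooth_on_const chart_image_open[OF A]) auto

text \<open>A coordinate field made global by the cut-off, since the connections act on global
  fields only.\<close>

definition frame_field :: "('b::topological_space, 'e::euclidean_space) chart set \<Rightarrow> ('b, 'e) chart \<Rightarrow>
    ('b \<Rightarrow> real) \<Rightarrow> 'e \<Rightarrow> 'b \<Rightarrow> 'e" where
  "frame_field B c \<psi> u q = \<psi> q *\<^sub>R from_components B c q u"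

context
  fixes A :: "('a::{t2_space,second_countable_topology}, 'e::euclidean_space) chart set"
    and B :: "('b::{t2_space,second_countable_topology}, 'g::euclidean_space) chart set"
    and f :: "'a \<Rightarrow> 'b" and c' U K \<psi>
  assumes A: "smooth_manifold A" and B: "smooth_manifold B" and f: "smooth_map A B f"
    and bump: "bump_in B c' U K \<psi>"
begin

lemma bump_off_support:
  assumes "f p \<notin> K" "\<And>q. f q \<notin> K \<Longrightarrow> \<eta> q = 0"
  shows "\<exists>U c. open U \<and> p \<in> U \<and> c \<in> A \<and> U \<subseteq> fst c \<and> smooth_on (snd c ` U) (\<lambda>x. \<eta> (chart_inv c x))"
proof -
  let ?c = "chart_at A p"
  have c: "?c \<in> A" "p \<in> fst ?c"
    using chart_at_in chart_at_mem A by blast+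
  let ?U = "fst ?c \<inter> f -` (- K)"
  have U: "open ?U"
    using chart_open[OF A c(1)] bump smooth_map_continuous[OF A B f]
    by (simp add: bump_in_def open_Int open_vimage open_Compl)
  have o: "open (snd ?c ` ?U)"
    using U c by (intro open_chart_image[OF A]) auto
  have "smooth_on (snd ?c ` ?U) (\<lambda>x. \<eta> (chart_inv ?c x))"
    by (rule smooth_on_cong[OF o _ smooth_on_const[of _ 0]])
      (use assms in \<open>auto simp: chart_inv_chart[OF A c(1)]\<close>)
  then show ?thesis
    using U c assms by (intro exI[of _ ?U] exI[of _ ?c]) auto
qed

text \<open>Inside the chart this is a product of smooth functions; elsewhere \<open>f p\<close>
  lies off the closed set \<open>K\<close>, near which the cut-off makes the function zero.\<close>

lemma cutoff_component_smooth:
  assumes W: "W \<in> sections A B f"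
  shows "smooth_fun A (\<lambda>p. \<psi> (f p) * (components B c' (f p) (W p) \<bullet> b))"
proof (rule smooth_fun_local[OF A])
  fix p
  let ?\<eta> = "\<lambda>p. \<psi> (f p) * (components B c' (f p) (W p) \<bullet> b)"
  show "\<exists>U c. open U \<and> p \<in> U \<and> c \<in> A \<and> U \<subseteq> fst c \<and> smooth_on (snd c ` U) (\<lambda>x. ?\<eta> (chart_inv c x))"
  proof (cases "f p \<in> fst c'")
    case False
    then show ?thesis
      using bump by (intro bump_off_support) (auto simp: bump_in_def)
  next
    case True
    have c': "c' \<in> B"
      using bump by (simp add: bump_in_def)
    let ?c = "chart_at A p"
    have c: "?c \<in> A" "p \<in> fst ?c"
      using chart_at_in chart_at_mem A by blast+
    let ?U = "fst ?c \<inter> f -` fst c'"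
    have U: "open ?U"
      using chart_open[OF A c(1)] chart_open[OF B c'] smooth_map_continuous[OF A B f]
      by (simp add: open_Int open_vimage)
    have o: "open (snd ?c ` ?U)"
      using U c by (intro open_chart_image[OF A]) auto
    have "smooth_fun A (\<lambda>p. \<psi> (f p))"
      using bump by (intro smooth_fun_compose[OF A B f]) (simp add: bump_in_def)
    then have "smooth_on (snd ?c ` ?U) (\<lambda>x. \<psi> (f (chart_inv ?c x)))"
      using c by (simp add: smooth_fun_def o_def smooth_on_subset[of "snd ?c ` fst ?c"] image_mono)
    then have "smooth_on (snd ?c ` ?U) (\<lambda>x. ?\<eta> (chart_inv ?c x))"
      by (intro smooth_on_mult smooth_on_inner o smooth_on_const sections_rep_smooth[OF A B W c(1) c'])
    then show ?thesis
      using U c True by (intro exI[of _ ?U] exI[of _ ?c]) auto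
  qed
qed

lemma components_frame_field:
  assumes "q \<in> fst c'"
  shows "components B c' q (frame_field B c' \<psi> u q) = \<psi> q *\<^sub>R u"
  using bump assms unfolding frame_field_def bump_in_def
  by (simp add: linear_cmul[OF components_linear[OF B]] components_from_components[OF B])

lemma frame_field_linear:
  assumes "q \<in> fst c'"
  shows "frame_field B c' \<psi> u q = (\<Sum>b\<in>Basis. (u \<bullet> b) *\<^sub>R frame_field B c' \<psi> b q)"
  using linear_basis_sum[OF from_components_linear[OF B _ assms], of u] bump
  by (simp add: frame_field_def bump_in_def scaleR_sum_right mult.commute)

text \<open>Two cut-off factors are spent: one makes the coefficient function global, the other the
  frame field.\<close>

lemma cutoff_decomposition:
  "(\<psi> (f p) * \<psi> (f p)) *\<^sub>R w
    = (\<Sum>b\<in>Basis. (\<psi> (f p) * (components B c' (f p) w \<bullet> b)) *\<^sub>R frame_field B c' \<psi> b (f p))"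
proof (cases "f p \<in> fst c'")
  case True
  have c': "c' \<in> B"
    using bump by (simp add: bump_in_def)
  have "(\<Sum>b\<in>Basis. (\<psi> (f p) * (components B c' (f p) w \<bullet> b)) *\<^sub>R frame_field B c' \<psi> b (f p))
    = \<psi> (f p) *\<^sub>R frame_field B c' \<psi> (components B c' (f p) w) (f p)"
    by (simp add: frame_field_linear[OF True, of "components B c' (f p) w"] scaleR_sum_right)
  also have "\<dots> = (\<psi> (f p) * \<psi> (f p)) *\<^sub>R w"
    by (simp add: frame_field_def from_components_components[OF B c' True])
  finally show ?thesis
    by simp
next
  case False
  then have "\<psi> (f p) = 0"
    using bump by (auto simp: bump_in_def)
  then show ?thesis
    by simp
qed

end

context
  fixes B :: "('b::{t2_space,second_countable_topology}, 'g::euclidean_space) chart set"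
    and c U K \<psi>
  assumes B: "smooth_manifold B" and bump: "bump_in B c U K \<psi>"
begin

lemma frame_field_vector_field: "frame_field B c \<psi> u \<in> vector_fields B"
  unfolding vector_fields_def
proof (rule sections_local[OF B B smooth_map_id[OF B]])
  fix q
  have c: "c \<in> B"
    using bump by (simp add: bump_in_def)
  show "\<exists>U d d'. open U \<and> q \<in> U \<and> d \<in> B \<and> d' \<in> B \<and> U \<subseteq> fst d \<and> id ` U \<subseteq> fst d' \<and>
    smooth_on (snd d ` U) (\<lambda>x. components B d' (id (chart_inv d x)) (frame_field B c \<psi> u (chart_inv d x)))"
  proof (cases "q \<in> fst c")
    case True
    have "smooth_on (snd c ` fst c) (\<lambda>x. \<psi> (chart_inv c x) *\<^sub>R u)"
      using bump c by (intro smooth_on_scaleR smooth_on_const chart_image_open[OF B])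
        (simp_all add: bump_in_def smooth_fun_def o_def)
    then have "smooth_on (snd c ` fst c)
        (\<lambda>x. components B c (id (chart_inv c x)) (frame_field B c \<psi> u (chart_inv c x)))"
      by (rule smooth_on_cong[OF chart_image_open[OF B c], rotated])
        (auto simp: chart_inv_chart[OF B c] components_frame_field[OF B B smooth_map_id[OF B] bump])
    then show ?thesis
      using True c chart_open[OF B c] by (intro exI[of _ "fst c"] exI[of _ c]) auto
  next
    case False
    let ?d = "chart_at B q"
    have d: "?d \<in> B" "q \<in> fst ?d"
      by (rule chart_at_in[OF B] chart_at_mem[OF B])+
    have o: "open (fst ?d - K)"
      using bump chart_open[OF B d(1)] by (auto simp: bump_in_def)
    have "smooth_on (snd ?d ` (fst ?d - K))
        (\<lambda>x. components B ?d (id (chart_inv ?d x)) (frame_field B c \<psi> u (chart_inv ?d x)))"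
      by (rule smooth_on_cong[OF open_chart_image[OF B d(1) o] _ smooth_on_const[of _ 0]])
        (use bump linear_0[OF components_linear[OF B d(1)]] in
          \<open>auto simp: chart_inv_chart[OF B d(1)] frame_field_def bump_in_def\<close>)
    moreover have "q \<notin> K"
      using bump False by (auto simp: bump_in_def)
    ultimately show ?thesis
      using d o by (intro exI[of _ "fst ?d - K"] exI[of _ ?d]) auto
  qed
qed

end

text \<open>Additivity and the Leibniz rule determine the operator from its values on frame fields,
  after \<open>W\<close> is replaced by its product with the squared cut-off. It serves both
  \<open>nabla X\<close>, with \<open>f = id\<close>, and the pull-back connection.\<close>

lemma local_operator:
  fixes A :: "('a::{t2_space,second_countable_topology}, 'e::euclidean_space) chart set"
    and B :: "('b::{t2_space,second_countable_topology}, 'g::euclidean_space) chart set"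
    and \<Delta> :: "('a \<Rightarrow> 'g) \<Rightarrow> 'g"
  assumes A: "smooth_manifold A" and B: "smooth_manifold B" and f: "smooth_map A B f"
    and bump: "bump_in B c' U K \<psi>" and p: "c \<in> A" "p \<in> fst c" "f p \<in> U"
    and add: "\<And>V W. V \<in> sections A B f \<Longrightarrow> W \<in> sections A B f \<Longrightarrow> \<Delta> (\<lambda>q. V q + W q) = \<Delta> V + \<Delta> W"
    and leibniz: "\<And>\<phi> V. smooth_fun A \<phi> \<Longrightarrow> V \<in> sections A B f \<Longrightarrow>
      \<Delta> (\<lambda>q. \<phi> q *\<^sub>R V q) = dir_deriv A \<phi> p v *\<^sub>R V p + \<phi> p *\<^sub>R \<Delta> V"
    and W: "W \<in> sections A B f"
  shows "components B c' (f p) (\<Delta> W) =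
    fd (\<lambda>x. components B c' (f (chart_inv c x)) (W (chart_inv c x))) (snd c p) (components A c p v)
    + (\<Sum>b\<in>Basis. (components B c' (f p) (W p) \<bullet> b) *\<^sub>R components B c' (f p) (\<Delta> (frame_field B c' \<psi> b \<circ> f)))"
proof -
  have c': "c' \<in> B" "f p \<in> fst c'" and \<psi>: "smooth_fun B \<psi>" "\<And>q. q \<in> U \<Longrightarrow> \<psi> q = 1" "open U" "U \<subseteq> fst c'"
    using bump p by (auto simp: bump_in_def)
  note lin = components_linear[OF B c'] and W' = sections_rep_smooth[OF A B W p(1) c'(1)]
  have E: "frame_field B c' \<psi> b \<circ> f \<in> sections A B f" for b
    by (rule sections_compose[OF A B f frame_field_vector_field[OF B bump]])
  let ?w = "\<lambda>q. components B c' (f q) (W q)"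
  let ?\<phi> = "\<lambda>b q. \<psi> (f q) * (?w q \<bullet> b)"
  have \<phi>: "smooth_fun A (?\<phi> b)" for b
    by (rule cutoff_component_smooth[OF A B f bump W])
  let ?S = "snd c ` (fst c \<inter> f -` U)"
  have S: "open ?S" "snd c p \<in> ?S"
    using local_domain_open[OF A p(1) smooth_map_continuous[OF A B f] \<psi>(3)] p by auto
  have \<psi>\<psi>: "smooth_fun A (\<lambda>q. \<psi> (f q) * \<psi> (f q))"
    by (intro smooth_fun_mult[OF A] smooth_fun_compose[OF A B f] \<psi>)
  \<comment> \<open>The squared cut-off is identically 1 near \<open>p\<close>, so its derivative
    vanishes and the Leibniz rule shows that multiplying \<open>W\<close> by it does not change
    \<open>\<Delta> W\<close>.\<close>
  have "dir_deriv A (\<lambda>q. \<psi> (f q) * \<psi> (f q)) p v = fd (\<lambda>x. 1::real) (snd c p) (components A c p v)"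
    unfolding dir_deriv_components[OF A \<psi>\<psi> p(1,2)]
    by (rule arg_cong[where f = "\<lambda>f. f _"], rule fd_cong[OF S])
      (use \<psi> in \<open>auto simp: chart_inv_chart[OF A p(1)]\<close>)
  then have "\<Delta> W = \<Delta> (\<lambda>q. (\<psi> (f q) * \<psi> (f q)) *\<^sub>R W q)"
    using leibniz[OF \<psi>\<psi> W] \<psi>(2) p by simp
  also have "\<dots> = \<Delta> (\<lambda>q. \<Sum>b\<in>Basis. ?\<phi> b q *\<^sub>R (frame_field B c' \<psi> b \<circ> f) q)"
    by (simp add: cutoff_decomposition[OF A B f bump])
  also have "\<dots> = (\<Sum>b\<in>Basis. \<Delta> (\<lambda>q. ?\<phi> b q *\<^sub>R (frame_field B c' \<psi> b \<circ> f) q))"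
  proof -
    have "\<Delta> (\<lambda>q. 0) = \<Delta> (\<lambda>q. 0) + \<Delta> (\<lambda>q. 0)"
      using add[OF sections_zero[OF A B f] sections_zero[OF A B f]] by simp
    then have zero: "\<Delta> (\<lambda>q. 0) = 0"
      by simp
    have "\<Delta> (\<lambda>q. \<Sum>b\<in>I. ?\<phi> b q *\<^sub>R (frame_field B c' \<psi> b \<circ> f) q)
      = (\<Sum>b\<in>I. \<Delta> (\<lambda>q. ?\<phi> b q *\<^sub>R (frame_field B c' \<psi> b \<circ> f) q))" if "finite I" for I
      using that
    proof (induction I rule: finite_induct)
      case empty
      then show ?case
        using zero by simp
    next
      case (insert b I)
      show ?case
        unfolding sum.insert[OF insert(1,2)]
        by (subst add)
          (use insert in \<open>auto intro!: sections_sum[OF A B f] sections_scale[OF A B f] \<phi> E[unfolded o_def]\<close>)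
    qed
    then show ?thesis
      by simp
  qed
  also have "\<dots> = (\<Sum>b\<in>Basis. dir_deriv A (?\<phi> b) p v *\<^sub>R (frame_field B c' \<psi> b \<circ> f) p
      + ?\<phi> b p *\<^sub>R \<Delta> (frame_field B c' \<psi> b \<circ> f))"
    by (intro sum.cong refl leibniz \<phi> E)
  finally have *: "\<Delta> W = \<dots>" .
  have dd: "dir_deriv A (?\<phi> b) p v
    = fd (\<lambda>x. ?w (chart_inv c x)) (snd c p) (components A c p v) \<bullet> b" for b
  proof -
    have "dir_deriv A (?\<phi> b) p v = fd (\<lambda>x. ?w (chart_inv c x) \<bullet> b) (snd c p) (components A c p v)"
      unfolding dir_deriv_components[OF A \<phi> p(1,2)]
      by (rule arg_cong[where f = "\<lambda>f. f _"], rule fd_cong[OF S])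
        (use \<psi> in \<open>auto simp: chart_inv_chart[OF A p(1)]\<close>)
    also have "\<dots> = fd (\<lambda>x. ?w (chart_inv c x)) (snd c p) (components A c p v) \<bullet> b"
      by (rule fd_inner[OF smooth_on_differentiable[OF W']]) (use p c' in auto)
    finally show ?thesis .
  qed
  have fr: "components B c' (f p) (frame_field B c' \<psi> b (f p)) = b" for b
    using components_frame_field[OF A B f bump c'(2)] \<psi>(2) p by simp
  show ?thesis
    unfolding * linear_sum[OF lin] linear_add[OF lin] linear_cmul[OF lin] dd sum.distrib o_apply fr
      euclidean_representation
    using \<psi>(2) p by simp
qed

section \<open>Christoffel symbols\<close>

abbreviation (input) local_rep :: "('b, 'e::euclidean_space) chart set \<Rightarrow> ('b, 'e) chart \<Rightarrow> ('b \<Rightarrow> 'e) \<Rightarrow> 'e \<Rightarrow> 'e" where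
  "local_rep B c X x \<equiv> components B c (chart_inv c x) (X (chart_inv c x))"

text \<open>
  The connection acts on global fields only, so the symbol at a point is read off from arbitrary global
  fields with the given components there.
\<close>

definition christoffel :: "('b::topological_space, 'e::euclidean_space) chart set \<Rightarrow>
    (('b \<Rightarrow> 'e) \<Rightarrow> ('b \<Rightarrow> 'e) \<Rightarrow> 'b \<Rightarrow> 'e) \<Rightarrow> ('b, 'e) chart \<Rightarrow> 'e \<Rightarrow> 'e \<Rightarrow> 'e \<Rightarrow> 'e" where
  "christoffel B nabla c x u w = (SOME z. \<forall>X\<in>vector_fields B. \<forall>Y\<in>vector_fields B.
     local_rep B c X x = u \<and> local_rep B c Y x = w \<longrightarrow>
     local_rep B c (nabla X Y) x = fd (local_rep B c Y) x u + z)"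

definition metric_rep :: "('b, 'e::euclidean_space) chart set \<Rightarrow> ('b \<Rightarrow> 'e \<Rightarrow> 'e \<Rightarrow> real) \<Rightarrow>
    ('b, 'e) chart \<Rightarrow> 'e \<Rightarrow> 'e \<Rightarrow> 'e \<Rightarrow> real" where
  "metric_rep B h c x u w =
     h (chart_inv c x) (from_components B c (chart_inv c x) u) (from_components B c (chart_inv c x) w)"

text \<open>The classical expression of R(u, v)w in terms of Christoffel symbols \<open>G\<close>.
  There is no bracket term because \<open>u\<close> and \<open>v\<close> stand for constant
  coordinate fields.\<close>

definition curvature_rep :: "('e::euclidean_space \<Rightarrow> 'e \<Rightarrow> 'e \<Rightarrow> 'e) \<Rightarrow> 'e \<Rightarrow> 'e \<Rightarrow> 'e \<Rightarrow> 'e \<Rightarrow> 'e" where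
  "curvature_rep G x u v w = fd (\<lambda>x. G x v w) x u - fd (\<lambda>x. G x u w) x v + G x u (G x v w) - G x v (G x u w)"

context
  fixes B :: "('b::{t2_space,second_countable_topology}, 'g::euclidean_space) chart set"
  assumes B: "smooth_manifold B"
begin

lemma vector_field_rep_smooth:
  assumes "X \<in> vector_fields B" "c \<in> B"
  shows "smooth_on (snd c ` fst c) (local_rep B c X)"
  using assms by (fastforce simp: vector_fields_def sections_def smooth_along_def)

lemma vector_fields_scale:
  "smooth_fun B \<phi> \<Longrightarrow> X \<in> vector_fields B \<Longrightarrow> (\<lambda>q. \<phi> q *\<^sub>R X q) \<in> vector_fields B"
  unfolding vector_fields_def by (rule sections_scale[OF B B smooth_map_id[OF B]])

lemma vector_fields_add:
  "X \<in> vector_fields B \<Longrightarrow> Y \<in> vector_fields B \<Longrightarrow> (\<lambda>q. X q + Y q) \<in> vector_fields B"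
  unfolding vector_fields_def by (rule sections_add[OF B B smooth_map_id[OF B]])

lemma vector_fields_sum:
  "(\<And>i. i \<in> I \<Longrightarrow> X i \<in> vector_fields B) \<Longrightarrow> (\<lambda>q. \<Sum>i\<in>I. X i q) \<in> vector_fields B"
  unfolding vector_fields_def by (rule sections_sum[OF B B smooth_map_id[OF B]])

text \<open>Fields with constant components near a point have no derivative terms there, so
  identities for the connection turn into identities for its Christoffel symbols.\<close>

lemma constant_field_exists:
  assumes c: "c \<in> B" "q \<in> fst c"
  obtains X U where "X \<in> vector_fields B" "open U" "q \<in> U" "U \<subseteq> fst c"
    "\<And>r. r \<in> U \<Longrightarrow> components B c r (X r) = u"
proof -
  obtain U K \<psi> where b: "q \<in> U" "bump_in B c U K \<psi>"
    using bump_exists[OF B c] by metis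
  then have U: "open U" "U \<subseteq> fst c" "\<And>r. r \<in> U \<Longrightarrow> \<psi> r = 1"
    by (auto simp: bump_in_def)
  have "components B c r (frame_field B c \<psi> u r) = u" if "r \<in> U" for r
    using components_frame_field[OF B B smooth_map_id[OF B] b(2), of r u] U that by auto
  then show ?thesis
    using that[OF frame_field_vector_field[OF B b(2)] U(1) b(1) U(2)] by blast
qed

lemma fd_constant_rep:
  assumes c: "c \<in> B" and U: "open U" "q \<in> U" "U \<subseteq> fst c" "\<And>r. r \<in> U \<Longrightarrow> components B c r (X r) = u"
  shows "fd (local_rep B c X) (snd c q) = (\<lambda>_. 0)"
proof -
  have "fd (local_rep B c X) (snd c q) = fd (\<lambda>_. u) (snd c q)"
    by (rule fd_cong[of "snd c ` U"])
      (use U open_chart_image[OF B c] in \<open>auto simp: chart_inv_chart[OF B c] subset_iff\<close>)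
  then show ?thesis
    by simp
qed

lemma extending_field_exists:
  obtains X where "X \<in> vector_fields B" "X q = v"
proof -
  obtain X U where "X \<in> vector_fields B" "q \<in> U" "\<And>r. r \<in> U \<Longrightarrow> components B (chart_at B q) r (X r) = v"
    using constant_field_exists[OF chart_at_in[OF B] chart_at_mem[OF B]] by metis
  then show ?thesis
    using that components_chart_at[OF B] by metis
qed

text \<open>A field constant in \<open>c\<close> has, in \<open>c'\<close>, the transition
  derivative as its component function; differentiating this gives the second derivative of the
  transition map. It is the inhomogeneous term of the Christoffel transformation law and also enters
  the bracket.\<close>

lemma constant_field_rep_fd:
  assumes c: "c \<in> B" "c' \<in> B" "q \<in> fst c" "q \<in> fst c'"
    and U: "open U" "q \<in> U" "U \<subseteq> fst c" "\<And>r. r \<in> U \<Longrightarrow> components B c r (X r) = w"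
  shows "fd (local_rep B c' X) (snd c' q) (coord_change c c' q u)
    = fd (\<lambda>y. fd (\<lambda>x. snd c' (chart_inv c x)) y w) (snd c q) u"
proof -
  let ?S = "snd c' ` (U \<inter> fst c')" and ?T = "snd c ` (fst c \<inter> fst c')"
  let ?G = "\<lambda>y. fd (\<lambda>x. snd c' (chart_inv c x)) y w"
  have S: "open ?S" "snd c' q \<in> ?S"
    using U c chart_open[OF B c(2)] by (auto intro!: open_chart_image[OF B])
  have T: "open ?T"
    using c chart_open[OF B c(1)] chart_open[OF B c(2)] by (intro open_chart_image[OF B]) auto
  have eq: "local_rep B c' X y = ?G (snd c (chart_inv c' y))" if "y \<in> ?S" for y
  proof -
    from that obtain r where r: "r \<in> U" "r \<in> fst c'" "y = snd c' r"
      by auto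
    then have "local_rep B c' X y = coord_change c c' r (components B c r (X r))"
      using components_change[OF B c(1,2) _ r(2), of "X r"] c U by (auto simp: chart_inv_chart[OF B])
    then show ?thesis
      using r U c by (simp add: chart_inv_chart[OF B] coord_change_eq)
  qed
  have "fd (local_rep B c' X) (snd c' q) (coord_change c c' q u)
      = fd (\<lambda>y. ?G (snd c (chart_inv c' y))) (snd c' q) (coord_change c c' q u)"
    using fd_cong[OF S eq] by simp
  also have "\<dots> = fd ?G (snd c (chart_inv c' (snd c' q))) (fd (\<lambda>y. snd c (chart_inv c' y)) (snd c' q) (coord_change c c' q u))"
  proof (rule fd_compose)
    show "(\<lambda>x. snd c (chart_inv c' x)) differentiable at (snd c' q)"
      using c by (intro transition_differentiable[OF B])
    show "?G differentiable at (snd c (chart_inv c' (snd c' q)))"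
      by (rule smooth_on_differentiable[OF smooth_on_fd[OF T transition_smooth[OF B c(1,2)]]])
        (use c in \<open>simp add: chart_inv_chart[OF B]\<close>)
  qed
  also have "fd (\<lambda>y. snd c (chart_inv c' y)) (snd c' q) (coord_change c c' q u) = u"
    using coord_change_comp[OF B c(1) c(2) c(1) c(3) c(4) c(3), of u] coord_change_self[OF B c(1,3)]
    by (simp add: coord_change_eq)
  finally show ?thesis
    by (simp add: chart_inv_chart[OF B c(2,4)])
qed

section \<open>Locality of an affine connection and its Christoffel symbols\<close>

context
  fixes nabla
  assumes nabla: "affine_connection B nabla"
begin

lemma nabla_in: "X \<in> vector_fields B \<Longrightarrow> Y \<in> vector_fields B \<Longrightarrow> nabla X Y \<in> vector_fields B"
  and nabla_add_left: "X \<in> vector_fields B \<Longrightarrow> X' \<in> vector_fields B \<Longrightarrow> Y \<in> vector_fields B \<Longrightarrow>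
    nabla (\<lambda>q. X q + X' q) Y q = nabla X Y q + nabla X' Y q"
  and nabla_scale_left: "smooth_fun B \<phi> \<Longrightarrow> X \<in> vector_fields B \<Longrightarrow> Y \<in> vector_fields B \<Longrightarrow>
    nabla (\<lambda>q. \<phi> q *\<^sub>R X q) Y q = \<phi> q *\<^sub>R nabla X Y q"
  and nabla_add_right: "X \<in> vector_fields B \<Longrightarrow> Y \<in> vector_fields B \<Longrightarrow> Y' \<in> vector_fields B \<Longrightarrow>
    nabla X (\<lambda>q. Y q + Y' q) q = nabla X Y q + nabla X Y' q"
  and nabla_scale_right: "smooth_fun B \<phi> \<Longrightarrow> X \<in> vector_fields B \<Longrightarrow> Y \<in> vector_fields B \<Longrightarrow>
    nabla X (\<lambda>q. \<phi> q *\<^sub>R Y q) q = dir_deriv B \<phi> q (X q) *\<^sub>R Y q + \<phi> q *\<^sub>R nabla X Y q"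
  using nabla unfolding affine_connection_def by meson+

lemma nabla_sum_left:
  assumes "finite I" "\<And>i. i \<in> I \<Longrightarrow> X i \<in> vector_fields B" "Y \<in> vector_fields B"
  shows "nabla (\<lambda>q. \<Sum>i\<in>I. X i q) Y q = (\<Sum>i\<in>I. nabla (X i) Y q)"
  using assms(1,2)
proof (induction I rule: finite_induct)
  case empty
  have z: "(\<lambda>q. 0) \<in> vector_fields B"
    using vector_fields_sum[of "{}"] by simp
  show ?case
    using nabla_add_left[OF z z assms(3), of q] by simp
next
  case (insert i I)
  then show ?case
    using nabla_add_left[OF insert.prems[of i] vector_fields_sum[of I X] assms(3)] by simp
qed

text \<open>Symbols computed from one cut-off frame. They are visibly bilinear and smooth, but
  represent the connection only where \<open>\<psi>\<close> is 1; agreement there transfers both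
  properties to \<open>christoffel\<close>.\<close>

definition bump_christoffel :: "('b, 'g) chart \<Rightarrow> ('b \<Rightarrow> real) \<Rightarrow> 'g \<Rightarrow> 'g \<Rightarrow> 'g \<Rightarrow> 'g" where
  "bump_christoffel c \<psi> x u w = (\<Sum>b\<in>Basis. (w \<bullet> b) *\<^sub>R (\<Sum>a\<in>Basis. (u \<bullet> a) *\<^sub>R
     local_rep B c (nabla (frame_field B c \<psi> a) (frame_field B c \<psi> b)) x))"

lemma nabla_bump_formula:
  assumes bump: "bump_in B c U K \<psi>" and q: "q \<in> U"
    and X: "X \<in> vector_fields B" and Y: "Y \<in> vector_fields B"
  shows "components B c q (nabla X Y q) = fd (local_rep B c Y) (snd c q) (components B c q (X q))
    + bump_christoffel c \<psi> (snd c q) (components B c q (X q)) (components B c q (Y q))"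
proof -
  have c: "c \<in> B" "q \<in> fst c" and \<psi>: "smooth_fun B \<psi>" "\<psi> q = 1"
    using bump q by (auto simp: bump_in_def)
  note idB = smooth_map_id[OF B] and E = frame_field_vector_field[OF B bump]
  \<comment> \<open>In its first argument the connection is linear over functions and
    \<open>\<psi> q = 1\<close>, so at \<open>q\<close> the field \<open>X\<close> may be replaced
    by its cut-off and decomposed along global frame fields.\<close>
  have left: "nabla X (frame_field B c \<psi> b) q
    = (\<Sum>a\<in>Basis. (components B c q (X q) \<bullet> a) *\<^sub>R nabla (frame_field B c \<psi> a) (frame_field B c \<psi> b) q)" for b
  proof -
    let ?\<phi> = "\<lambda>a q. \<psi> q * (components B c q (X q) \<bullet> a)"
    have \<phi>: "smooth_fun B (?\<phi> a)" for a
      using cutoff_component_smooth[OF B B idB bump, of X a] X by (simp add: vector_fields_def)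
    have "nabla X (frame_field B c \<psi> b) q = nabla (\<lambda>q. (\<psi> q * \<psi> q) *\<^sub>R X q) (frame_field B c \<psi> b) q"
      using nabla_scale_left[OF smooth_fun_mult[OF B \<psi>(1) \<psi>(1)] X E] \<psi>(2) by simp
    also have "\<dots> = nabla (\<lambda>q. \<Sum>a\<in>Basis. ?\<phi> a q *\<^sub>R frame_field B c \<psi> a q) (frame_field B c \<psi> b) q"
      using cutoff_decomposition[OF B B idB bump] by simp
    also have "\<dots> = (\<Sum>a\<in>Basis. nabla (\<lambda>q. ?\<phi> a q *\<^sub>R frame_field B c \<psi> a q) (frame_field B c \<psi> b) q)"
      by (rule nabla_sum_left) (auto intro!: vector_fields_scale \<phi> E)
    also have "\<dots> = (\<Sum>a\<in>Basis. ?\<phi> a q *\<^sub>R nabla (frame_field B c \<psi> a) (frame_field B c \<psi> b) q)"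
      by (intro sum.cong refl nabla_scale_left \<phi> E)
    finally show ?thesis
      using \<psi>(2) by simp
  qed
  have "components B c (id q) (nabla X Y q) =
    fd (\<lambda>x. components B c (id (chart_inv c x)) (Y (chart_inv c x))) (snd c q) (components B c q (X q))
    + (\<Sum>b\<in>Basis. (components B c (id q) (Y q) \<bullet> b) *\<^sub>R
        components B c (id q) (nabla X (frame_field B c \<psi> b \<circ> id) q))"
    using Y q unfolding vector_fields_def
    by (intro local_operator[OF B B idB bump c, where \<Delta> = "\<lambda>Y. nabla X Y q"])
      (auto intro!: nabla_add_right nabla_scale_right X simp: vector_fields_def)
  then show ?thesis
    by (simp add: left bump_christoffel_def linear_sum[OF components_linear[OF B c]]
        linear_cmul[OF components_linear[OF B c]] chart_inv_chart[OF B c])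
qed

lemma christoffel_works:
  assumes c: "c \<in> B" "q \<in> fst c"
    and XY: "X \<in> vector_fields B" "Y \<in> vector_fields B"
  shows "components B c q (nabla X Y q) = fd (local_rep B c Y) (snd c q) (components B c q (X q))
    + christoffel B nabla c (snd c q) (components B c q (X q)) (components B c q (Y q))"
proof -
  obtain U K \<psi> where b: "q \<in> U" "bump_in B c U K \<psi>"
    using bump_exists[OF B c] by metis
  let ?u = "components B c q (X q)" and ?w = "components B c q (Y q)"
  \<comment> \<open>The correction depends on the fields only through their components at
    \<open>q\<close>; hence one vector serves all fields, which is the existence required by the
    choice in \<open>christoffel\<close>.\<close>
  have "\<forall>X\<in>vector_fields B. \<forall>Y\<in>vector_fields B.
     local_rep B c X (snd c q) = ?u \<and> local_rep B c Y (snd c q) = ?w \<longrightarrow>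
     local_rep B c (nabla X Y) (snd c q) = fd (local_rep B c Y) (snd c q) ?u
         + bump_christoffel c \<psi> (snd c q) ?u ?w"
    using nabla_bump_formula[OF b(2,1)] by (auto simp: chart_inv_chart[OF B c])
  then have "\<forall>X\<in>vector_fields B. \<forall>Y\<in>vector_fields B.
     local_rep B c X (snd c q) = ?u \<and> local_rep B c Y (snd c q) = ?w \<longrightarrow>
     local_rep B c (nabla X Y) (snd c q) = fd (local_rep B c Y) (snd c q) ?u
         + christoffel B nabla c (snd c q) ?u ?w"
    unfolding christoffel_def by (rule someI)
  then show ?thesis
    using XY by (simp add: chart_inv_chart[OF B c])
qed

text \<open>Both describe the same covariant derivative of frame fields with components
  \<open>u\<close> and \<open>w\<close> at \<open>q\<close>, and the derivative term is
  common.\<close>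

lemma christoffel_eq_bump:
  assumes bump: "bump_in B c U K \<psi>" and q: "q \<in> U"
  shows "christoffel B nabla c (snd c q) u w = bump_christoffel c \<psi> (snd c q) u w"
proof -
  have c: "c \<in> B" "q \<in> fst c" "\<psi> q = 1"
    using bump q by (auto simp: bump_in_def)
  have "components B c q (frame_field B c \<psi> u q) = u" for u
    using components_frame_field[OF B B smooth_map_id[OF B] bump c(2), of u] c by simp
  then show ?thesis
    using christoffel_works[OF c(1,2), of "frame_field B c \<psi> u" "frame_field B c \<psi> w"]
      nabla_bump_formula[OF assms, of "frame_field B c \<psi> u" "frame_field B c \<psi> w"]
      frame_field_vector_field[OF B bump] by simp
qed

lemma christoffel_smooth_bil:
  assumes c: "c \<in> B"
  shows "smooth_bil (snd c ` fst c) (christoffel B nabla c)"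
  unfolding smooth_bil_def
proof (intro conjI ballI allI)
  fix x assume "x \<in> snd c ` fst c"
  then obtain q where q: "q \<in> fst c" "x = snd c q"
    by auto
  obtain U K \<psi> where b: "q \<in> U" "bump_in B c U K \<psi>"
    using bump_exists[OF B c q(1)] by metis
  have "bilinear (bump_christoffel c \<psi> x)"
    unfolding bilinear_def bump_christoffel_def
    by (auto intro!: linear_compose_sum linear_compose_scale_right
        simp: linear_iff inner_add_left scaleR_add_left scaleR_add_right sum.distrib scaleR_sum_right
          mult.assoc mult.left_commute distrib_left distrib_right)
  moreover have "christoffel B nabla c x = bump_christoffel c \<psi> x"
    using christoffel_eq_bump[OF b(2,1)] q by (intro ext) simp
  ultimately show "bilinear (christoffel B nabla c x)"
    by simp
next
  fix u w
  show "smooth_on (snd c ` fst c) (\<lambda>x. christoffel B nabla c x u w)"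
  proof (rule smooth_on_local)
    fix x assume "x \<in> snd c ` fst c"
    then obtain q where q: "q \<in> fst c" "x = snd c q"
      by auto
    obtain U K \<psi> where b: "q \<in> U" "bump_in B c U K \<psi>"
      using bump_exists[OF B c q(1)] by metis
    have U: "open U" "U \<subseteq> fst c"
      using b by (auto simp: bump_in_def)
    have o: "open (snd c ` U)"
      using open_chart_image[OF B c U] .
    have "smooth_on (snd c ` fst c) (\<lambda>x. bump_christoffel c \<psi> x u w)"
      unfolding bump_christoffel_def
      by (intro smooth_on_sum smooth_on_scaleR smooth_on_const chart_image_open[OF B c]
          vector_field_rep_smooth nabla_in frame_field_vector_field[OF B b(2)] c)
    then have "smooth_on (snd c ` U) (\<lambda>x. bump_christoffel c \<psi> x u w)"
      by (rule smooth_on_subset) (use U in auto)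
    then have "smooth_on (snd c ` U) (\<lambda>x. christoffel B nabla c x u w)"
      by (rule smooth_on_cong[OF o, rotated]) (auto simp: christoffel_eq_bump[OF b(2)])
    then show "\<exists>T. open T \<and> x \<in> T \<and> smooth_on T (\<lambda>x. christoffel B nabla c x u w)"
      using o b q by blast
  qed
qed

text \<open>Both sides compute \<open>nabla X Y\<close> at \<open>q\<close> for fields constant in
  \<open>c\<close>: in \<open>c\<close> only the symbol survives, in \<open>c'\<close> the second
  derivative of the transition map is added.\<close>

lemma christoffel_transformation:
  assumes c: "c \<in> B" "c' \<in> B" "q \<in> fst c" "q \<in> fst c'"
  shows "coord_change c c' q (christoffel B nabla c (snd c q) u w)
    = fd (\<lambda>y. fd (\<lambda>x. snd c' (chart_inv c x)) y w) (snd c q) u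
      + christoffel B nabla c' (snd c' q) (coord_change c c' q u) (coord_change c c' q w)"
proof -
  obtain X U where X: "X \<in> vector_fields B" "open U" "q \<in> U" "U \<subseteq> fst c"
    "\<And>r. r \<in> U \<Longrightarrow> components B c r (X r) = u"
    using constant_field_exists[OF c(1,3)] by metis
  obtain Y V where Y: "Y \<in> vector_fields B" "open V" "q \<in> V" "V \<subseteq> fst c"
    "\<And>r. r \<in> V \<Longrightarrow> components B c r (Y r) = w"
    using constant_field_exists[OF c(1,3)] by metis
  have X': "components B c' q (X q) = coord_change c c' q u" and Y': "components B c' q (Y q)
      = coord_change c c' q w"
    using components_change[OF B c] X Y by metis+
  have "fd (local_rep B c Y) (snd c q) = (\<lambda>_. 0)"
    by (rule fd_constant_rep[OF c(1) Y(2-5)])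
  then have "components B c q (nabla X Y q) = christoffel B nabla c (snd c q) u w"
    using christoffel_works[OF c(1,3) X(1) Y(1)] X Y by simp
  then have "coord_change c c' q (christoffel B nabla c (snd c q) u w) = components B c' q (nabla X Y q)"
    using components_change[OF B c] by metis
  then show ?thesis
    using christoffel_works[OF c(2,4) X(1) Y(1)] X' Y' constant_field_rep_fd[OF c Y(2-5)] by simp
qed

end

section \<open>Metric, torsion and curvature of the target in a chart\<close>

lemma metric_rep_smooth_bil:
  assumes "riemannian_metric B h" "c \<in> B"
  shows "smooth_bil (snd c ` fst c) (metric_rep B h c)"
  unfolding smooth_bil_def
proof (intro conjI ballI allI)
  fix x assume x: "x \<in> snd c ` fst c"
  have lin: "linear (from_components B c (chart_inv c x))"
    using from_components_linear[OF B assms(2) chart_inv_in[OF x]] .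
  have h: "bilinear (h (chart_inv c x))"
    using assms by (simp add: riemannian_metric_def)
  show "bilinear (metric_rep B h c x)"
    unfolding bilinear_def metric_rep_def
    by (auto intro!: linearI simp: linear_add[OF lin] linear_cmul[OF lin] bilinear_ladd[OF h]
        bilinear_radd[OF h] bilinear_lmul[OF h] bilinear_rmul[OF h])
next
  fix u w show "smooth_on (snd c ` fst c) (\<lambda>x. metric_rep B h c x u w)"
    using assms unfolding riemannian_metric_def metric_rep_def by blast
qed

lemma metric_rep_components:
  assumes "c \<in> B" "q \<in> fst c"
  shows "metric_rep B h c (snd c q) (components B c q u) (components B c q w) = h q u w"
  using assms by (simp add: metric_rep_def chart_inv_chart[OF B] from_components_components[OF B])

context
  fixes h nabla
  assumes h: "riemannian_metric B h" and lc: "levi_civita_connection B h nabla"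
begin

lemma lc_affine: "affine_connection B nabla"
  using lc by (simp add: levi_civita_connection_def)

lemma lc_torsion:
  "X \<in> vector_fields B \<Longrightarrow> Y \<in> vector_fields B \<Longrightarrow> nabla X Y q - nabla Y X q = lie_bracket B X Y q"
  using lc unfolding levi_civita_connection_def by blast

lemma lc_metric:
  assumes "X \<in> vector_fields B" "Y \<in> vector_fields B" "Z \<in> vector_fields B"
  shows "dir_deriv B (\<lambda>r. h r (Y r) (Z r)) q (X q) = h q (nabla X Y q) (Z q) + h q (Y q) (nabla X Z q)"
proof -
  have "\<forall>X\<in>vector_fields B. \<forall>Y\<in>vector_fields B. \<forall>Z\<in>vector_fields B. \<forall>q.
      dir_deriv B (\<lambda>r. h r (Y r) (Z r)) q (X q) = h q (nabla X Y q) (Z q) + h q (Y q) (nabla X Z q)"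
    using lc unfolding levi_civita_connection_def by (elim conjE)
  then show ?thesis
    using assms by blast
qed

text \<open>Torsion-freeness applied to two fields constant in \<open>c\<close>, whose bracket
  vanishes.\<close>

lemma christoffel_symmetric:
  assumes c: "c \<in> B" "x \<in> snd c ` fst c"
  shows "christoffel B nabla c x u w = christoffel B nabla c x w u"
proof -
  obtain q where q: "q \<in> fst c" "x = snd c q"
    using c by auto
  let ?d = "chart_at B q"
  have d: "?d \<in> B" "q \<in> fst ?d"
    by (rule chart_at_in[OF B] chart_at_mem[OF B])+
  obtain X U where X: "X \<in> vector_fields B" "open U" "q \<in> U" "U \<subseteq> fst c"
    "\<And>r. r \<in> U \<Longrightarrow> components B c r (X r) = u"
    using constant_field_exists[OF c(1) q(1)] by metis
  obtain Y V where Y: "Y \<in> vector_fields B" "open V" "q \<in> V" "V \<subseteq> fst c"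
    "\<And>r. r \<in> V \<Longrightarrow> components B c r (Y r) = w"
    using constant_field_exists[OF c(1) q(1)] by metis
  have X': "X q = coord_change c ?d q u" and Y': "Y q = coord_change c ?d q w"
    using components_change[OF B c(1) d(1) q(1) d(2)] components_chart_at[OF B] X Y by metis+
  have T: "open (snd c ` (fst c \<inter> fst ?d))"
    using c d chart_open[OF B c(1)] chart_open[OF B d(1)] by (intro open_chart_image[OF B]) auto
  \<comment> \<open>The bracket is evaluated in the preferred chart, where these fields need not be
    constant; its two terms are second derivatives of the transition map, which commute.\<close>
  have "lie_bracket B X Y q = 0"
    unfolding lie_bracket_def Let_def X' Y'
    using constant_field_rep_fd[OF c(1) d(1) q(1) d(2) Y(2-5)]
      constant_field_rep_fd[OF c(1) d(1) q(1) d(2) X(2-5)]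
      fd_fd_commute[OF T transition_smooth[OF B c(1) d(1)], of x u w] q d by simp
  then have n: "nabla X Y q = nabla Y X q"
    using lc_torsion[OF X(1) Y(1), of q] by simp
  have "fd (local_rep B c Y) (snd c q) = (\<lambda>_. 0)"
    by (rule fd_constant_rep[OF c(1) Y(2-5)])
  moreover have "fd (local_rep B c X) (snd c q) = (\<lambda>_. 0)"
    by (rule fd_constant_rep[OF c(1) X(2-5)])
  ultimately show ?thesis
    using christoffel_works[OF lc_affine c(1) q(1) X(1) Y(1)]
      christoffel_works[OF lc_affine c(1) q(1) Y(1) X(1)] X Y q n by simp
qed

text \<open>Metric compatibility for \<open>Y\<close> and \<open>Z\<close> constant near the point:
  the function differentiated is the metric coefficient itself, and each covariant derivative
  reduces to a symbol.\<close>

lemma metric_rep_compatible: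
  assumes c: "c \<in> B" "x \<in> snd c ` fst c"
  shows "fd (\<lambda>y. metric_rep B h c y u w) x z = metric_rep B h c x (christoffel B nabla c x z u) w
    + metric_rep B h c x u (christoffel B nabla c x z w)"
proof -
  obtain q where q: "q \<in> fst c" "x = snd c q"
    using c by auto
  obtain X where X: "X \<in> vector_fields B" "components B c q (X q) = z"
    using constant_field_exists[OF c(1) q(1)] by metis
  obtain Y U where Y: "Y \<in> vector_fields B" "open U" "q \<in> U" "U \<subseteq> fst c"
    "\<And>r. r \<in> U \<Longrightarrow> components B c r (Y r) = u"
    using constant_field_exists[OF c(1) q(1)] by metis
  obtain Z V where Z: "Z \<in> vector_fields B" "open V" "q \<in> V" "V \<subseteq> fst c"
    "\<And>r. r \<in> V \<Longrightarrow> components B c r (Z r) = w"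
    using constant_field_exists[OF c(1) q(1)] by metis
  have "smooth_fun B (\<lambda>r. h r (Y r) (Z r))"
    unfolding smooth_fun_def o_def
  proof
    fix d assume d: "d \<in> B"
    have "smooth_on (snd d ` fst d) (\<lambda>x. metric_rep B h d x (local_rep B d Y x) (local_rep B d Z x))"
      using d Y Z
      by (intro smooth_on_bil[OF chart_image_open[OF B d] chart_image_open[OF B d] metric_rep_smooth_bil[OF h d]]
          smooth_on_id vector_field_rep_smooth) auto
    then show "smooth_on (snd d ` fst d) (\<lambda>x. h (chart_inv d x) (Y (chart_inv d x)) (Z (chart_inv d x)))"
      by (rule smooth_on_cong[OF chart_image_open[OF B d], rotated])
        (use d in \<open>auto simp: chart_inv_chart[OF B] metric_rep_components\<close>)
  qed
  from dir_deriv_components[OF B this c(1) q(1), of "X q"]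
  have "dir_deriv B (\<lambda>r. h r (Y r) (Z r)) q (X q)
    = fd (\<lambda>y. h (chart_inv c y) (Y (chart_inv c y)) (Z (chart_inv c y))) x z"
    using X q by simp
  also have "\<dots> = fd (\<lambda>y. metric_rep B h c y u w) x z"
  proof (rule arg_cong[where f = "\<lambda>f. f z"], rule fd_cong[of "snd c ` (U \<inter> V)"])
    fix y assume "y \<in> snd c ` (U \<inter> V)"
    then obtain r where r: "r \<in> U" "r \<in> V" "y = snd c r"
      by auto
    then show "h (chart_inv c y) (Y (chart_inv c y)) (Z (chart_inv c y)) = metric_rep B h c y u w"
      using metric_rep_components[OF c(1), of r h "Y r" "Z r"] Y Z by
          (auto simp: chart_inv_chart[OF B c(1)] subset_iff)
  qed (use Y Z q c in \<open>auto intro!: open_chart_image[OF B]\<close>)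
  finally have 1: "fd (\<lambda>y. metric_rep B h c y u w) x z = h q (nabla X Y q) (Z q) + h q (Y q) (nabla X Z q)"
    using lc_metric[OF X(1) Y(1) Z(1)] by simp
  have "fd (local_rep B c Y) (snd c q) = (\<lambda>_. 0)"
    by (rule fd_constant_rep[OF c(1) Y(2-5)])
  moreover have "fd (local_rep B c Z) (snd c q) = (\<lambda>_. 0)"
    by (rule fd_constant_rep[OF c(1) Z(2-5)])
  ultimately show ?thesis
    unfolding 1 metric_rep_components[OF c(1) q(1), symmetric]
    using christoffel_works[OF lc_affine c(1) q(1) X(1) Y(1)]
      christoffel_works[OF lc_affine c(1) q(1) X(1) Z(1)] X Y Z q by simp
qed

lemma curvature_components:
  assumes c: "c \<in> B" "q \<in> fst c"
    and X: "X \<in> vector_fields B" and Y: "Y \<in> vector_fields B" and Z: "Z \<in> vector_fields B"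
  shows "components B c q (curvature B nabla X Y Z q) = curvature_rep (christoffel B nabla c) (snd c q)
    (components B c q (X q)) (components B c q (Y q)) (components B c q (Z q))"
proof -
  note nab = christoffel_works[OF lc_affine c(1)] and nin = nabla_in[OF lc_affine]
  let ?S = "snd c ` fst c" and ?G = "christoffel B nabla c" and ?x = "snd c q"
  let ?r = "local_rep B c"
  have S: "open ?S" "?x \<in> ?S"
    using chart_image_open[OF B c(1)] c by auto
  have G: "smooth_bil ?S ?G"
    by (rule christoffel_smooth_bil[OF lc_affine c(1)])
  note sm = vector_field_rep_smooth[OF _ c(1)]
  have bil: "bilinear (?G ?x)"
    using G S(2) unfolding smooth_bil_def by blast
  have rx: "?r W ?x = components B c q (W q)" for W
    using chart_inv_chart[OF B c] by simp
  have fst: "?r (nabla X Y) x = fd (?r Y) x (?r X x) + ?G x (?r X x) (?r Y x)"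
    if "x \<in> ?S" "X \<in> vector_fields B" "Y \<in> vector_fields B" for x X Y
    using nab[OF chart_inv_in[OF that(1)] that(2,3)] chart_chart_inv[OF that(1)] by simp
  have der: "fd (?r (nabla X Y)) ?x v = fd (\<lambda>y. fd (?r Y) y (?r X ?x)) ?x v + fd (?r Y) ?x (fd (?r X) ?x v)
      + fd (\<lambda>x. ?G x (?r X ?x) (?r Y ?x)) ?x v + ?G ?x (fd (?r X) ?x v) (?r Y ?x)
          + ?G ?x (?r X ?x) (fd (?r Y) ?x v)"
    if XY: "X \<in> vector_fields B" "Y \<in> vector_fields B" for X Y v
  proof -
    have dX: "(?r X has_derivative fd (?r X) ?x) (at ?x)" and dY: "(?r Y has_derivative fd (?r Y) ?x) (at ?x)"
      using sm[OF XY(1)] sm[OF XY(2)] S by (auto intro!: fd_works smooth_on_differentiable)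

    have 1: "((\<lambda>x. fd (?r Y) x (?r X x)) has_derivative
        (\<lambda>v. fd (\<lambda>x. fd (?r Y) x (?r X ?x)) ?x v + fd (?r Y) ?x (fd (?r X) ?x v))) (at ?x)"
      by (rule has_derivative_fd_apply[OF S(1) sm[OF XY(2)], of "\<lambda>x. x", OF S(2) has_derivative_ident dX])
    have 2: "((\<lambda>x. ?G x (?r X x) (?r Y x)) has_derivative (\<lambda>v. fd (\<lambda>x. ?G x (?r X ?x) (?r Y ?x)) ?x v
        + ?G ?x (fd (?r X) ?x v) (?r Y ?x) + ?G ?x (?r X ?x) (fd (?r Y) ?x v))) (at ?x)"
      by (rule has_derivative_bil[OF S(1) G, of "\<lambda>x. x", OF S(2) has_derivative_ident dX dY])
    have "fd (?r (nabla X Y)) ?x = fd (\<lambda>x. fd (?r Y) x (?r X x) + ?G x (?r X x) (?r Y x)) ?x"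
      by (rule fd_cong[OF S]) (simp add: fst[OF _ XY])
    then show ?thesis
      unfolding fd_eq[OF has_derivative_add[OF 1 2]] by (simp add: add.assoc)
  qed
  have br: "nabla X Y q - nabla Y X q = lie_bracket B X Y q" for q
    by (rule lc_torsion[OF X Y])
  \<comment> \<open>Smoothness of the bracket is read off from torsion-freeness, avoiding its
    definition through jumping preferred charts.\<close>
  have "lie_bracket B X Y = (\<lambda>q. nabla X Y q + (-1) *\<^sub>R nabla Y X q)"
    using br[symmetric] by auto
  moreover have "smooth_fun B (\<lambda>q. - 1)"
    by (simp add: smooth_fun_def o_def smooth_on_const)
  ultimately have L: "lie_bracket B X Y \<in> vector_fields B"
    using vector_fields_add[OF nin[OF X Y] vector_fields_scale[OF _ nin[OF Y X], of "\<lambda>_. -1"]] by simp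
  have lin: "linear (components B c q)"
    by (rule components_linear[OF B c])
  define x' where "x' = components B c q (X q)"
  define y' where "y' = components B c q (Y q)"
  define z' where "z' = components B c q (Z q)"
  have Lc: "components B c q (lie_bracket B X Y q) = fd (?r Y) ?x x' - fd (?r X) ?x y'"
    unfolding br[symmetric] linear_diff[OF lin] nab[OF c(2) X Y] nab[OF c(2) Y X]
    using christoffel_symmetric[OF c(1) S(2)] by (simp add: x'_def y'_def)
  have linZ: "linear (fd (?r Z) ?x)"
    by (rule fd_linear_in[OF sm[OF Z] S(2)])
  have comm: "fd (\<lambda>y. fd (?r Z) y x') ?x y' = fd (\<lambda>y. fd (?r Z) y y') ?x x'"
    by (rule fd_fd_commute[OF S(1) sm[OF Z] S(2)])
  have YZ: "components B c q (nabla Y Z q) = fd (?r Z) ?x y' + ?G ?x y' z'"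
    and XZ: "components B c q (nabla X Z q) = fd (?r Z) ?x x' + ?G ?x x' z'"
    unfolding nab[OF c(2) Y Z] nab[OF c(2) X Z] by (simp_all add: x'_def y'_def z'_def)
  have "components B c q (curvature B nabla X Y Z q) =
    (fd (?r (nabla Y Z)) ?x x' + ?G ?x x' (fd (?r Z) ?x y' + ?G ?x y' z'))
    - (fd (?r (nabla X Z)) ?x y' + ?G ?x y' (fd (?r Z) ?x x' + ?G ?x x' z'))
    - (fd (?r Z) ?x (fd (?r Y) ?x x' - fd (?r X) ?x y') + ?G ?x (fd (?r Y) ?x x' - fd (?r X) ?x y') z')"
    unfolding curvature_def linear_diff[OF lin] nab[OF c(2) X nin[OF Y Z]] nab[OF c(2) Y nin[OF X Z]]
      nab[OF c(2) L Z] Lc YZ XZ by (simp add: x'_def y'_def z'_def)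
  \<comment> \<open>Second derivatives of \<open>Z\<close> cancel by symmetry, the mixed terms
    cancel in pairs, and the bracket term removes the first derivatives of \<open>X\<close> and
    \<open>Y\<close>.\<close>
  also have "\<dots> = curvature_rep ?G ?x x' y' z'"
    unfolding der[OF Y Z] der[OF X Z] rx x'_def[symmetric] y'_def[symmetric] z'_def[symmetric] curvature_rep_def comm
      linear_diff[OF linZ] bilinear_lsub[OF bil] bilinear_radd[OF bil] by (simp add: algebra_simps)
  finally show ?thesis
    by (simp add: x'_def y'_def z'_def)
qed

text \<open>The definite description is justified because \<open>curvature_components\<close>
  involves only the values of the fields at \<open>q\<close>, and every vector extends to a global
  field.\<close>

lemma curvature_tensor_components:
  assumes c: "c \<in> B" "q \<in> fst c"
  shows "components B c q (curvature_tensor B nabla q u v w) = curvature_rep (christoffel B nabla c) (snd c q)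
    (components B c q u) (components B c q v) (components B c q w)"
proof -
  let ?R = "curvature_rep (christoffel B nabla c) (snd c q) (components B c q u) (components B c q v)
      (components B c q w)"
  have *: "curvature B nabla X Y Z q = from_components B c q ?R"
    if "X \<in> vector_fields B" "Y \<in> vector_fields B" "Z \<in> vector_fields B" "X q = u" "Y q = v" "Z q = w" for X Y Z
    using curvature_components[OF c that(1-3)] that(4-6) from_components_components[OF B c] by metis
  obtain X Y Z where "X \<in> vector_fields B" "Y \<in> vector_fields B" "Z \<in> vector_fields B" "X q = u" "Y q = v"
      "Z q = w"
    using extending_field_exists by metis
  then have "curvature_tensor B nabla q u v w = from_components B c q ?R"
    unfolding curvature_tensor_def using * by (intro the_equality) blast+
  then show ?thesis
    using components_from_components[OF B c] by simp
qed

end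

end

section \<open>The pull-back connection\<close>

text \<open>\<open>local_operator\<close> reduces to frame fields composed with \<open>f\<close>. On
  these the last clause of \<open>pullback_connection\<close> brings in \<open>nabla\<close>, and
  constancy of the frame near \<open>f p\<close> leaves only the Christoffel term.\<close>

lemma pullback_components:
  fixes A :: "('a::{t2_space,second_countable_topology}, 'e::euclidean_space) chart set"
    and B :: "('b::{t2_space,second_countable_topology}, 'g::euclidean_space) chart set"
  assumes A: "smooth_manifold A" and B: "smooth_manifold B" and f: "smooth_map A B f"
    and nabla: "affine_connection B nabla" and D: "pullback_connection A B f nabla D"
    and c: "c \<in> A" "p \<in> fst c" and c': "c' \<in> B" "f p \<in> fst c'" and W: "W \<in> sections A B f"
  shows "components B c' (f p) (D p v W) =
    fd (\<lambda>x. components B c' (f (chart_inv c x)) (W (chart_inv c x))) (snd c p) (components A c p v)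
    + christoffel B nabla c' (snd c' (f p)) (components B c' (f p) (differential A B f p v))
        (components B c' (f p) (W p))"
proof -
  obtain U K \<psi> where b: "f p \<in> U" "bump_in B c' U K \<psi>"
    using bump_exists[OF B c'] by metis
  have U: "open U" "U \<subseteq> fst c'" "\<And>q. q \<in> U \<Longrightarrow> \<psi> q = 1"
    using b(2) by (auto simp: bump_in_def)
  let ?v = "components B c' (f p) (differential A B f p v)" and ?G = "christoffel B nabla c' (snd c' (f p))"
  obtain X where X: "X \<in> vector_fields B" "X (f p) = differential A B f p v"
    using extending_field_exists[OF B] by metis
  have E: "components B c' (f p) (D p v (frame_field B c' \<psi> a \<circ> f)) = ?G ?v a" for a
  proof -
    have Ea: "frame_field B c' \<psi> a \<in> vector_fields B"
      by (rule frame_field_vector_field[OF B b(2)])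
    have comp: "components B c' q (frame_field B c' \<psi> a q) = a" if "q \<in> U" for q
      using components_frame_field[OF B B smooth_map_id[OF B] b(2), of q a] U that by auto
    have "D p v (frame_field B c' \<psi> a \<circ> f) = nabla X (frame_field B c' \<psi> a) (f p)"
      using D X Ea unfolding pullback_connection_def by blast
    moreover have "fd (local_rep B c' (frame_field B c' \<psi> a)) (snd c' (f p)) = (\<lambda>_. 0)"
      by (rule fd_constant_rep[OF B c'(1) U(1) b(1) U(2) comp])
    ultimately show ?thesis
      using christoffel_works[OF B nabla c' X(1) Ea] X(2) comp[OF b(1)] by simp
  qed
  have "components B c' (f p) (D p v W) =
    fd (\<lambda>x. components B c' (f (chart_inv c x)) (W (chart_inv c x))) (snd c p) (components A c p v)
    + (\<Sum>a\<in>Basis. (components B c' (f p) (W p) \<bullet> a) *\<^sub>R components B c' (f p) (D p v (frame_field B c' \<psi> a \<circ> f)))"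
    by (rule local_operator[OF A B f b(2) c b(1) _ _ W])
      (use D in \<open>unfold pullback_connection_def, blast+\<close>)
  moreover have "linear (?G ?v)"
    using christoffel_smooth_bil[OF B nabla c'(1)] c' by (auto simp: smooth_bil_def bilinear_def)
  ultimately show ?thesis
    using linear_basis_sum[of "?G ?v" "components B c' (f p) (W p)"] by (simp add: E)
qed

section \<open>Variations in coordinates\<close>

lemma
  fixes g :: "'e::euclidean_space \<times> real \<Rightarrow> 'v::euclidean_space"
  assumes g: "smooth_on Q g" and z: "(x, t) \<in> Q"
  shows fd_slice_space: "fd (\<lambda>x. g (x, t)) x v = fd g (x, t) (v, 0)"
    and has_derivative_slice_time: "((\<lambda>t. g (x, t)) has_vector_derivative fd g (x, t) (0, 1)) (at t)"
proof -
  have d: "(g has_derivative fd g (x, t)) (at (x, t))"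
    by (rule fd_works[OF smooth_on_differentiable[OF g z]])
  have "((\<lambda>x. g (x, t)) has_derivative (\<lambda>v. fd g (x, t) (v, 0))) (at x)"
    by (rule has_derivative_compose[where f = "\<lambda>x. (x, t)" and g = g, OF _ d])
      (auto intro!: derivative_eq_intros)
  then show "fd (\<lambda>x. g (x, t)) x v = fd g (x, t) (v, 0)"
    by (simp add: fd_eq)
  have "((\<lambda>t. g (x, t)) has_derivative (\<lambda>s. fd g (x, t) (0, s))) (at t)"
    by (rule has_derivative_compose[where f = "\<lambda>t. (x, t)" and g = g, OF _ d])
      (auto intro!: derivative_eq_intros)
  moreover have "(\<lambda>s. fd g (x, t) (0, s)) = (\<lambda>s. s *\<^sub>R fd g (x, t) (0, 1))"
  proof
    fix s :: real
    show "fd g (x, t) (0, s) = s *\<^sub>R fd g (x, t) (0, 1)"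
      using linear_cmul[OF fd_linear_in[OF g z], of s "(0, 1)"]
      by (simp only: scaleR_Pair scaleR_zero_right real_scaleR_def mult_1_right)
  qed
  ultimately show "((\<lambda>t. g (x, t)) has_vector_derivative fd g (x, t) (0, 1)) (at t)"
    by (simp only: has_vector_derivative_def)
qed

definition vel :: "('e::euclidean_space \<times> real \<Rightarrow> 'g::euclidean_space) \<Rightarrow> 'e \<times> real \<Rightarrow> 'g" where
  "vel \<Phi> z = fd \<Phi> z (0, 1)"

definition sdir :: "('e::euclidean_space \<times> real \<Rightarrow> 'g::euclidean_space) \<Rightarrow> 'e \<Rightarrow> 'e \<times> real \<Rightarrow> 'g" where
  "sdir \<Phi> v z = fd \<Phi> z (v, 0)"

text \<open>Coordinate form of the covariant time derivative of the velocity.\<close>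

definition acc :: "('e::euclidean_space \<times> real \<Rightarrow> 'g::euclidean_space) \<Rightarrow> ('g \<Rightarrow> 'g \<Rightarrow> 'g \<Rightarrow> 'g) \<Rightarrow>
    'e \<times> real \<Rightarrow> 'g" where
  "acc \<Phi> G z = fd (vel \<Phi>) z (0, 1) + G (\<Phi> z) (vel \<Phi> z) (vel \<Phi> z)"

text \<open>Coordinate form of the covariant derivative of the velocity in the space direction
  \<open>v\<close>; for symmetric \<open>G\<close> it is also the covariant time derivative of
  \<open>sdir\<close>.\<close>

definition cov_vel :: "('e::euclidean_space \<times> real \<Rightarrow> 'g::euclidean_space) \<Rightarrow> ('g \<Rightarrow> 'g \<Rightarrow> 'g \<Rightarrow> 'g) \<Rightarrow>
    'e \<Rightarrow> 'e \<times> real \<Rightarrow> 'g" where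
  "cov_vel \<Phi> G v z = fd (vel \<Phi>) z (v, 0) + G (\<Phi> z) (sdir \<Phi> v z) (vel \<Phi> z)"

context
  fixes Q :: "('e::euclidean_space \<times> real) set" and \<Phi> :: "'e \<times> real \<Rightarrow> 'g::euclidean_space"
  assumes Q: "open Q" and \<Phi>: "smooth_on Q \<Phi>"
begin

lemma vel_smooth: "smooth_on Q (vel \<Phi>)" and sdir_smooth: "smooth_on Q (sdir \<Phi> v)"
  unfolding vel_def[abs_def] sdir_def[abs_def] by (intro smooth_on_fd Q \<Phi>)+

lemma fd_sdir: "z \<in> Q \<Longrightarrow> fd (sdir \<Phi> v) z (0, 1) = fd (vel \<Phi>) z (v, 0)"
  unfolding vel_def[abs_def] sdir_def[abs_def] by (rule fd_fd_commute[OF Q \<Phi>])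

context
  fixes S :: "'g set" and G :: "'g \<Rightarrow> 'g \<Rightarrow> 'g \<Rightarrow> 'g"
  assumes S: "open S" "\<Phi> ` Q \<subseteq> S" and G: "smooth_bil S G"
begin

lemma acc_smooth: "smooth_on Q (acc \<Phi> G)" and cov_vel_smooth: "smooth_on Q (cov_vel \<Phi> G v)"
  unfolding acc_def[abs_def] cov_vel_def[abs_def]
  by (intro smooth_on_add Q smooth_on_fd smooth_on_bil[OF S(1) Q G S(2)] vel_smooth sdir_smooth \<Phi>)+

context
  fixes \<mu> :: "'g \<Rightarrow> 'g \<Rightarrow> 'g \<Rightarrow> real" and z
  assumes \<mu>: "smooth_bil S \<mu>"
    and G_sym: "\<And>x u w. x \<in> S \<Longrightarrow> G x u w = G x w u"
    and \<mu>_sym: "\<And>x u w. x \<in> S \<Longrightarrow> \<mu> x u w = \<mu> x w u"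
    and compatible: "\<And>x u w z. x \<in> S \<Longrightarrow> fd (\<lambda>y. \<mu> y u w) x z = \<mu> x (G x z u) w + \<mu> x u (G x z w)"
    and z: "z \<in> Q"
begin

lemma z_in: "\<Phi> z \<in> S"
  using z S by blast

lemma G_bil: "bilinear (G (\<Phi> z))" and \<mu>_bil: "bilinear (\<mu> (\<Phi> z))"
  using G \<mu> z_in by (auto simp: smooth_bil_def)

lemma smooth_has_derivative: "smooth_on Q g \<Longrightarrow> (g has_derivative fd g z) (at z)"
  by (rule fd_works[OF smooth_on_differentiable[OF _ z]])

text \<open>Compatibility absorbs the derivative of the metric coefficients at the moving point into
  covariant time derivatives of the two arguments.\<close>

lemma fd_metric:
  assumes u: "smooth_on Q u" and w: "smooth_on Q w"
  shows "fd (\<lambda>z. \<mu> (\<Phi> z) (u z) (w z)) z (0, 1)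
    = \<mu> (\<Phi> z) (fd u z (0, 1) + G (\<Phi> z) (vel \<Phi> z) (u z)) (w z)
      + \<mu> (\<Phi> z) (u z) (fd w z (0, 1) + G (\<Phi> z) (vel \<Phi> z) (w z))"
  unfolding fd_eq[OF has_derivative_bil[OF S(1) \<mu> z_in smooth_has_derivative[OF \<Phi>]
      smooth_has_derivative[OF u] smooth_has_derivative[OF w]]]
  using compatible[OF z_in]
  by (simp add: vel_def bilinear_ladd[OF \<mu>_bil] bilinear_radd[OF \<mu>_bil])

text \<open>Commuting derivatives and symmetry of \<open>G\<close> identify the covariant time
  derivative of \<open>sdir\<close> with \<open>cov_vel\<close>; the factor 2 is the symmetry of the
  metric.\<close>

lemma fd_energy_density:
  "fd (\<lambda>z. \<mu> (\<Phi> z) (sdir \<Phi> v z) (sdir \<Phi> v z)) z (0, 1) = 2 * \<mu> (\<Phi> z) (cov_vel \<Phi> G v z) (sdir \<Phi> v z)"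
  using fd_metric[OF sdir_smooth sdir_smooth] \<mu>_sym[OF z_in] G_sym[OF z_in]
  by (simp add: fd_sdir[OF z] cov_vel_def)

text \<open>Commutation of covariant derivatives on the velocity. The sign follows the convention
  R(v, t) = \<nabla>v \<nabla>t - \<nabla>t \<nabla>v, with the time derivative outermost on the
  left-hand side.\<close>

lemma fd_cov_vel:
  "fd (cov_vel \<Phi> G v) z (0, 1) + G (\<Phi> z) (vel \<Phi> z) (cov_vel \<Phi> G v z)
    = fd (acc \<Phi> G) z (v, 0) + G (\<Phi> z) (sdir \<Phi> v z) (acc \<Phi> G z)
        - curvature_rep G (\<Phi> z) (sdir \<Phi> v z) (vel \<Phi> z) (vel \<Phi> z)"
proof -
  note d\<Phi> = smooth_has_derivative[OF \<Phi>] and dv = smooth_has_derivative[OF vel_smooth]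
    and ds = smooth_has_derivative[OF sdir_smooth]
  have 1: "fd (cov_vel \<Phi> G v) z (0, 1) = fd (\<lambda>z. fd (vel \<Phi>) z (v, 0)) z (0, 1)
      + (fd (\<lambda>x. G x (sdir \<Phi> v z) (vel \<Phi> z)) (\<Phi> z) (vel \<Phi> z) + G (\<Phi> z) (fd (vel \<Phi>) z (v, 0)) (vel \<Phi> z)
      + G (\<Phi> z) (sdir \<Phi> v z) (fd (vel \<Phi>) z (0, 1)))"
    unfolding cov_vel_def[abs_def]
      fd_eq[OF has_derivative_add[OF smooth_has_derivative[OF smooth_on_fd[OF Q vel_smooth]]
          has_derivative_bil[OF S(1) G z_in d\<Phi> ds dv]]] fd_sdir[OF z]
    by (simp add: vel_def)
  have 2: "fd (acc \<Phi> G) z (v, 0) = fd (\<lambda>z. fd (vel \<Phi>) z (0, 1)) z (v, 0)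
      + (fd (\<lambda>x. G x (vel \<Phi> z) (vel \<Phi> z)) (\<Phi> z) (sdir \<Phi> v z) + G (\<Phi> z) (fd (vel \<Phi>) z (v, 0)) (vel \<Phi> z)
      + G (\<Phi> z) (vel \<Phi> z) (fd (vel \<Phi>) z (v, 0)))"
    unfolding acc_def[abs_def]
      fd_eq[OF has_derivative_add[OF smooth_has_derivative[OF smooth_on_fd[OF Q vel_smooth]]
          has_derivative_bil[OF S(1) G z_in d\<Phi> dv dv]]]
    by (simp add: sdir_def)
  have 3: "fd (\<lambda>z. fd (vel \<Phi>) z (v, 0)) z (0, 1) = fd (\<lambda>z. fd (vel \<Phi>) z (0, 1)) z (v, 0)"
    by (rule fd_fd_commute[OF Q vel_smooth z])
  show ?thesis
    unfolding 1 2 3 cov_vel_def acc_def curvature_rep_def bilinear_radd[OF G_bil]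
    by (simp add: algebra_simps)
qed

text \<open>In the product rule, differentiating \<open>sdir\<close> produces the square of
  \<open>cov_vel\<close>, and differentiating \<open>cov_vel\<close> produces the acceleration and
  curvature terms.\<close>

lemma fd_fd_energy_density:
  "fd (\<lambda>z. \<mu> (\<Phi> z) (cov_vel \<Phi> G v z) (sdir \<Phi> v z)) z (0, 1)
    = \<mu> (\<Phi> z) (fd (acc \<Phi> G) z (v, 0) + G (\<Phi> z) (sdir \<Phi> v z) (acc \<Phi> G z)) (sdir \<Phi> v z)
      + \<mu> (\<Phi> z) (cov_vel \<Phi> G v z) (cov_vel \<Phi> G v z)
      - \<mu> (\<Phi> z) (curvature_rep G (\<Phi> z) (sdir \<Phi> v z) (vel \<Phi> z) (vel \<Phi> z)) (sdir \<Phi> v z)"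
  unfolding fd_metric[OF cov_vel_smooth sdir_smooth] fd_cov_vel fd_sdir[OF z]
    G_sym[OF z_in, of "vel \<Phi> z" "sdir \<Phi> v z"]
  by (simp add: cov_vel_def[symmetric] bilinear_lsub[OF \<mu>_bil])

end

end

end

section \<open>Smooth families of maps\<close>

text \<open>Not a product in general: how long \<open>F t\<close> stays in the target chart depends
  on the point.\<close>

definition family_domain :: "('a, 'e) chart \<Rightarrow> ('b, 'g) chart \<Rightarrow> real \<Rightarrow> (real \<Rightarrow> 'a \<Rightarrow> 'b) \<Rightarrow> ('e \<times> real) set" where
  "family_domain c c' \<epsilon> F = {(x, t). x \<in> snd c ` fst c \<and> \<bar>t\<bar> < \<epsilon> \<and> F t (chart_inv c x) \<in> fst c'}"

definition family_rep :: "('a, 'e) chart \<Rightarrow> ('b, 'g) chart \<Rightarrow> (real \<Rightarrow> 'a \<Rightarrow> 'b) \<Rightarrow> 'e \<times> real \<Rightarrow> 'g" where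
  "family_rep c c' F z = snd c' (F (snd z) (chart_inv c (fst z)))"

text \<open>The covariant acceleration of the family at time 0, stored like every tangent vector in
  the preferred chart at \<open>F 0 p\<close>. Its chart independence is
  \<open>components_acceleration\<close>.\<close>

definition acceleration :: "('b::topological_space, 'g::euclidean_space) chart set \<Rightarrow>
    (('b \<Rightarrow> 'g) \<Rightarrow> ('b \<Rightarrow> 'g) \<Rightarrow> 'b \<Rightarrow> 'g) \<Rightarrow> (real \<Rightarrow> 'a \<Rightarrow> 'b) \<Rightarrow> 'a \<Rightarrow> 'g" where
  "acceleration B nabla F p =
     (let c' = chart_at B (F 0 p); y = (\<lambda>t. snd c' (F t p)); y' = (\<lambda>t. vector_derivative y (at t))
      in vector_derivative y' (at 0) + christoffel B nabla c' (y 0) (y' 0) (y' 0))"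

context
  fixes A :: "('a::{t2_space,second_countable_topology}, 'e::euclidean_space) chart set"
    and B :: "('b::{t2_space,second_countable_topology}, 'g::euclidean_space) chart set"
    and \<epsilon> :: real and F :: "real \<Rightarrow> 'a \<Rightarrow> 'b"
  assumes A: "smooth_manifold A" and B: "smooth_manifold B"
begin

lemma product_carrier: "atlas_carrier (product_atlas A I) = UNIV \<times> I"
  using A unfolding smooth_manifold_def atlas_carrier_def product_atlas_def by auto

lemma product_chart_inv:
  assumes "c \<in> A" "x \<in> snd c ` fst c" "t \<in> I"
  shows "chart_inv (fst c \<times> I, \<lambda>(p, t). (snd c p, t)) (x, t) = (chart_inv c x, t)"
  unfolding chart_inv_def fst_conv snd_conv
proof (rule inv_into_f_eq)
  show "inj_on (\<lambda>(p, t). (snd c p, t)) (fst c \<times> I)"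
    by (rule inj_on_inverseI[of _ "\<lambda>(x, t). (chart_inv c x, t)"])
      (auto simp: chart_inv_chart[OF A assms(1)])
qed (use assms chart_inv_in[OF assms(2)] chart_chart_inv[OF assms(2)] in \<open>auto simp: chart_inv_def[symmetric]\<close>)

lemma product_chart_domain:
  assumes "c \<in> A"
  shows "(\<lambda>(p, t). (snd c p, t)) ` ((fst c \<times> {-\<epsilon><..<\<epsilon>}) \<inter> (\<lambda>(p, t). F t p) -` fst c') = family_domain c c' \<epsilon> F"
proof -
  have "(x, t) \<in> (\<lambda>(p, t). (snd c p, t)) ` ((fst c \<times> {-\<epsilon><..<\<epsilon>}) \<inter> (\<lambda>(p, t). F t p) -` fst c')"
    if "x \<in> snd c ` fst c" "\<bar>t\<bar> < \<epsilon>" "F t (chart_inv c x) \<in> fst c'" for x t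
    using that chart_inv_in[OF that(1)] chart_chart_inv[OF that(1)]
    by (intro image_eqI[of _ _ "(chart_inv c x, t)"]) auto
  then show ?thesis
    by (auto simp: family_domain_def chart_inv_chart[OF A assms])
qed

lemma product_family_rep:
  assumes "c \<in> A" "z \<in> family_domain c c' \<epsilon> F"
  shows "(snd c' \<circ> (\<lambda>(p, t). F t p) \<circ> chart_inv (fst c \<times> {-\<epsilon><..<\<epsilon>}, \<lambda>(p, t). (snd c p, t))) z
    = family_rep c c' F z"
proof -
  obtain x t where "z = (x, t)" "x \<in> snd c ` fst c" "\<bar>t\<bar> < \<epsilon>"
    using assms(2) by (auto simp: family_domain_def)
  moreover from this(3) have "t \<in> {-\<epsilon><..<\<epsilon>}"
    by auto
  ultimately show ?thesis
    using product_chart_inv[OF assms(1), of x t "{-\<epsilon><..<\<epsilon>}"] by (simp add: family_rep_def)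
qed

lemma smooth_family_iff:
  "smooth_family A B \<epsilon> F \<longleftrightarrow> continuous_on (UNIV \<times> {-\<epsilon><..<\<epsilon>}) (\<lambda>(p, t). F t p) \<and>
    (\<forall>c\<in>A. \<forall>c'\<in>B. smooth_on (family_domain c c' \<epsilon> F)
      (snd c' \<circ> (\<lambda>(p, t). F t p) \<circ> chart_inv (fst c \<times> {-\<epsilon><..<\<epsilon>}, \<lambda>(p, t). (snd c p, t))))"
proof -
  have "atlas_carrier B = UNIV"
    using B by (simp add: smooth_manifold_def)
  then show ?thesis
    unfolding smooth_family_def smooth_map_def product_carrier
    by (simp add: product_atlas_def product_chart_domain)
qed

lemma family_domain_open:
  assumes F: "continuous_on (UNIV \<times> {-\<epsilon><..<\<epsilon>}) (\<lambda>(p, t). F t p)" and c: "c \<in> A" "c' \<in> B"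
  shows "open (family_domain c c' \<epsilon> F)"
proof -
  have "continuous_on (snd c ` fst c \<times> {-\<epsilon><..<\<epsilon>}) (\<lambda>z. (\<lambda>(p, t). F t p) (chart_inv c (fst z), snd z))"
    by (rule continuous_on_compose2[OF F])
      (auto intro!: continuous_intros continuous_on_compose2[OF chart_inv_continuous[OF A c(1)]])
  then have "open ((snd c ` fst c \<times> {-\<epsilon><..<\<epsilon>}) \<inter> (\<lambda>z. (\<lambda>(p, t). F t p) (chart_inv c (fst z), snd z)) -` fst c')"
    by (rule continuous_open_preimage) (auto intro!: open_Times chart_image_open[OF A c(1)] chart_open[OF B c(2)])
  moreover have "(snd c ` fst c \<times> {-\<epsilon><..<\<epsilon>}) \<inter> (\<lambda>z. (\<lambda>(p, t). F t p) (chart_inv c (fst z), snd z)) -` fst c'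
    = family_domain c c' \<epsilon> F"
    by (auto simp: family_domain_def)
  ultimately show ?thesis
    by simp
qed

lemma smooth_familyI:
  assumes F: "continuous_on (UNIV \<times> {-\<epsilon><..<\<epsilon>}) (\<lambda>(p, t). F t p)"
    and "\<And>c c'. c \<in> A \<Longrightarrow> c' \<in> B \<Longrightarrow> smooth_on (family_domain c c' \<epsilon> F) (family_rep c c' F)"
  shows "smooth_family A B \<epsilon> F"
  unfolding smooth_family_iff
proof (intro conjI ballI F)
  fix c c' assume c: "c \<in> A" "c' \<in> B"
  show "smooth_on (family_domain c c' \<epsilon> F)
      (snd c' \<circ> (\<lambda>(p, t). F t p) \<circ> chart_inv (fst c \<times> {-\<epsilon><..<\<epsilon>}, \<lambda>(p, t). (snd c p, t)))"
    by (rule smooth_on_cong[OF family_domain_open[OF F c] product_family_rep[OF c(1), symmetric] assms(2)[OF c]])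
qed

section \<open>Velocity and acceleration of a smooth family in charts\<close>

context
  assumes F: "smooth_family A B \<epsilon> F"
begin

lemma family_continuous: "continuous_on (UNIV \<times> {-\<epsilon><..<\<epsilon>}) (\<lambda>(p, t). F t p)"
  using F smooth_family_iff by blast

lemma family_rep_smooth:
  assumes c: "c \<in> A" "c' \<in> B"
  shows "smooth_on (family_domain c c' \<epsilon> F) (family_rep c c' F)"
proof -
  have "smooth_on (family_domain c c' \<epsilon> F)
      (snd c' \<circ> (\<lambda>(p, t). F t p) \<circ> chart_inv (fst c \<times> {-\<epsilon><..<\<epsilon>}, \<lambda>(p, t). (snd c p, t)))"
    using F c smooth_family_iff by blast
  then show ?thesis
    by (rule smooth_on_cong[OF family_domain_open[OF family_continuous c], rotated])
      (rule product_family_rep[OF c(1)])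
qed

lemma family_smooth_map:
  assumes t: "\<bar>t\<bar> < \<epsilon>"
  shows "smooth_map A B (F t)"
proof -
  have carrier: "atlas_carrier A = UNIV" "atlas_carrier B = UNIV"
    using A B by (simp_all add: smooth_manifold_def)
  have "continuous_on UNIV (\<lambda>p. (\<lambda>(p, t). F t p) (p, t))"
    by (rule continuous_on_compose2[OF family_continuous]) (use t in \<open>auto intro!: continuous_intros\<close>)
  then have cont: "continuous_on UNIV (F t)"
    by simp
  moreover have "smooth_on (snd c ` (fst c \<inter> F t -` fst c')) (\<lambda>x. snd c' (F t (chart_inv c x)))"
    if c: "c \<in> A" "c' \<in> B" for c c'
  proof -
    have o: "open (snd c ` (fst c \<inter> F t -` fst c'))"
      by (rule local_domain_open[OF A c(1) cont chart_open[OF B c(2)]])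
    have "smooth_on (snd c ` (fst c \<inter> F t -` fst c')) (\<lambda>x. family_rep c c' F (x, t))"
      by (rule smooth_on_compose[OF o family_domain_open[OF family_continuous c] _ _ family_rep_smooth[OF c]])
        (use c t in \<open>auto simp: family_domain_def chart_inv_chart[OF A]
          intro!: smooth_on_Pair o smooth_on_id smooth_on_const\<close>)
    then show ?thesis
      by (simp add: family_rep_def)
  qed
  ultimately show ?thesis
    by (simp add: smooth_map_def carrier o_def)
qed

lemma family_differential:
  assumes t: "\<bar>t\<bar> < \<epsilon>" and c: "c \<in> A" "p \<in> fst c" "c' \<in> B" "F t p \<in> fst c'"
  shows "components B c' (F t p) (differential A B (F t) p v)
    = fd (family_rep c c' F) (snd c p, t) (components A c p v, 0)"
proof -
  have "(snd c p, t) \<in> family_domain c c' \<epsilon> F"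
    using assms by (simp add: family_domain_def chart_inv_chart[OF A])
  from fd_slice_space[OF family_rep_smooth[OF c(1,3)] this]
  show ?thesis
    unfolding components_differential[OF A B family_smooth_map[OF t] c(1,3,2,4)]
    by (simp add: family_rep_def)
qed

context
  fixes c c' p
  assumes \<epsilon>: "\<epsilon> > 0" and c: "c \<in> A" "c' \<in> B" "p \<in> fst c" "F 0 p \<in> fst c'"
begin

lemma family_zero_domain: "(snd c p, 0) \<in> family_domain c c' \<epsilon> F"
  using c \<epsilon> by (simp add: family_domain_def chart_inv_chart[OF A])

lemma family_rep_change:
  defines "d \<equiv> chart_at B (F 0 p)"
  obtains N where "open N" "(snd c p, 0) \<in> N" "N \<subseteq> family_domain c c' \<epsilon> F" "N \<subseteq> family_domain c d \<epsilon> F"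
    "family_rep c d F ` N \<subseteq> snd d ` (fst d \<inter> fst c')"
    "\<forall>z\<in>N. family_rep c c' F z = snd c' (chart_inv d (family_rep c d F z))"
proof
  let ?N = "family_domain c c' \<epsilon> F \<inter> family_domain c d \<epsilon> F"
  have d: "d \<in> B" "F 0 p \<in> fst d"
    unfolding d_def by (rule chart_at_in[OF B] chart_at_mem[OF B])+
  show "open ?N"
    using family_domain_open[OF family_continuous] c d by blast
  show "(snd c p, 0) \<in> ?N"
    using c d \<epsilon> by (simp add: family_domain_def chart_inv_chart[OF A])
  show "family_rep c d F ` ?N \<subseteq> snd d ` (fst d \<inter> fst c')"
    by (auto simp: family_rep_def family_domain_def)
  show "\<forall>z\<in>?N. family_rep c c' F z = snd c' (chart_inv d (family_rep c d F z))"
    using d by (auto simp: family_rep_def family_domain_def chart_inv_chart[OF B])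
qed auto

lemma variation_field_chart_at:
  "variation_field B F p = fd (family_rep c (chart_at B (F 0 p)) F) (snd c p, 0) (0, 1)"
proof -
  let ?d = "chart_at B (F 0 p)"
  have d: "?d \<in> B" "F 0 p \<in> fst ?d"
    by (rule chart_at_in[OF B] chart_at_mem[OF B])+
  have "(snd c p, 0) \<in> family_domain c ?d \<epsilon> F"
    using c d \<epsilon> by (simp add: family_domain_def chart_inv_chart[OF A])
  from has_derivative_slice_time[OF family_rep_smooth[OF c(1) d(1)] this]
  have "((\<lambda>t. snd ?d (F t p)) has_vector_derivative fd (family_rep c ?d F) (snd c p, 0) (0, 1)) (at 0)"
    using c by (simp add: family_rep_def chart_inv_chart[OF A])
  then show ?thesis
    unfolding variation_field_def by (rule vector_derivative_at)
qed

text \<open>The rule is needed on a whole neighbourhood and not just at time 0, since the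
  acceleration differentiates it once more.\<close>

lemma vel_change:
  defines "d \<equiv> chart_at B (F 0 p)"
  obtains N where "open N" "(snd c p, 0) \<in> N" "N \<subseteq> family_domain c c' \<epsilon> F" "N \<subseteq> family_domain c d \<epsilon> F"
    "family_rep c d F ` N \<subseteq> snd d ` (fst d \<inter> fst c')"
    "\<forall>z\<in>N. vel (family_rep c c' F) z
      = fd (\<lambda>y. snd c' (chart_inv d y)) (family_rep c d F z) (vel (family_rep c d F) z)"
proof -
  have d: "d \<in> B"
    unfolding d_def by (rule chart_at_in[OF B])
  obtain N where N: "open N" "(snd c p, 0) \<in> N" "N \<subseteq> family_domain c c' \<epsilon> F" "N \<subseteq> family_domain c d \<epsilon> F"
    "family_rep c d F ` N \<subseteq> snd d ` (fst d \<inter> fst c')"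
    "\<forall>z\<in>N. family_rep c c' F z = snd c' (chart_inv d (family_rep c d F z))"
    unfolding d_def by (rule family_rep_change)
  have "vel (family_rep c c' F) z
      = fd (\<lambda>y. snd c' (chart_inv d y)) (family_rep c d F z) (vel (family_rep c d F) z)" if z: "z \<in> N" for z
  proof -
    have 1: "fd (family_rep c c' F) z = fd (\<lambda>z. snd c' (chart_inv d (family_rep c d F z))) z"
      by (rule fd_cong[OF N(1) z]) (use N(6) in blast)
    have "family_rep c d F differentiable (at z)"
      by (rule smooth_on_differentiable[OF family_rep_smooth[OF c(1) d]]) (use N(4) z in blast)
    moreover have "(\<lambda>y. snd c' (chart_inv d y)) differentiable (at (family_rep c d F z))"
      by (rule smooth_on_differentiable[OF transition_smooth[OF B d c(2)]]) (use N(5) z in blast)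
    ultimately show ?thesis
      unfolding vel_def 1 by (intro fd_compose[where f = "\<lambda>y. snd c' (chart_inv d y)" and g
          = "family_rep c d F"])
  qed
  then show ?thesis
    using that N(1-5) by blast
qed

lemma components_variation_field:
  "components B c' (F 0 p) (variation_field B F p) = vel (family_rep c c' F) (snd c p, 0)"
proof -
  let ?d = "chart_at B (F 0 p)" and ?z = "(snd c p, 0::real)"
  obtain N where N: "?z \<in> N" "\<forall>z\<in>N. vel (family_rep c c' F) z
      = fd (\<lambda>y. snd c' (chart_inv ?d y)) (family_rep c ?d F z) (vel (family_rep c ?d F) z)"
    by (rule vel_change)
  have "family_rep c ?d F ?z = snd ?d (F 0 p)"
    using c by (simp add: family_rep_def chart_inv_chart[OF A])
  then show ?thesis
    unfolding bspec[OF N(2,1)] components_def coord_change_eq variation_field_chart_at by (simp add: vel_def)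
qed

lemma acceleration_chart_at:
  "acceleration B nabla F p = acc (family_rep c (chart_at B (F 0 p)) F)
    (christoffel B nabla (chart_at B (F 0 p))) (snd c p, 0)"
proof -
  let ?d = "chart_at B (F 0 p)"
  let ?\<Phi> = "family_rep c ?d F" and ?Q = "family_domain c ?d \<epsilon> F" and ?x = "snd c p"
  have d: "?d \<in> B" "F 0 p \<in> fst ?d"
    by (rule chart_at_in[OF B] chart_at_mem[OF B])+
  have z: "(?x, 0) \<in> ?Q"
    using c d \<epsilon> by (simp add: family_domain_def chart_inv_chart[OF A])
  have Q: "open ?Q" and \<Phi>: "smooth_on ?Q ?\<Phi>"
    by (rule family_domain_open[OF family_continuous c(1) d(1)] family_rep_smooth[OF c(1) d(1)])+
  let ?y = "\<lambda>t. snd ?d (F t p)" and ?I = "{t. (?x, t) \<in> ?Q}"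
  have y: "?y t = ?\<Phi> (?x, t)" for t
    using c by (simp add: family_rep_def chart_inv_chart[OF A])
  have "open ((\<lambda>t. (?x, t)) -` ?Q)"
    by (rule open_vimage[OF Q]) (intro continuous_intros)
  then have I: "open ?I" "0 \<in> ?I"
    using z by (simp_all add: vimage_def)
  have y': "vector_derivative ?y (at t) = vel ?\<Phi> (?x, t)" if "t \<in> ?I" for t
    using has_derivative_slice_time[OF \<Phi>, of ?x t] that
    by (intro vector_derivative_at) (simp add: y vel_def)
  have "((\<lambda>t. vel ?\<Phi> (?x, t)) has_vector_derivative fd (vel ?\<Phi>) (?x, 0) (0, 1)) (at 0)"
    by (rule has_derivative_slice_time[OF vel_smooth[OF Q \<Phi>] z])
  then have "((\<lambda>t. vector_derivative ?y (at t)) has_vector_derivative fd (vel ?\<Phi>) (?x, 0) (0, 1)) (at 0)"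
    by (rule has_vector_derivative_transform_within_open[OF _ I]) (simp add: y')
  then have "vector_derivative (\<lambda>t. vector_derivative ?y (at t)) (at 0) = fd (vel ?\<Phi>) (?x, 0) (0, 1)"
    by (rule vector_derivative_at)
  then show ?thesis
    unfolding acceleration_def Let_def acc_def using y'[OF I(2)] by (simp add: y)
qed

text \<open>Differentiating the transformed velocity creates a second derivative of the transition
  map; it is matched exactly by the inhomogeneous term of
  \<open>christoffel_transformation\<close>.\<close>

lemma components_acceleration:
  assumes nabla: "affine_connection B nabla"
  shows "components B c' (F 0 p) (acceleration B nabla F p)
    = acc (family_rep c c' F) (christoffel B nabla c') (snd c p, 0)"
proof -
  let ?d = "chart_at B (F 0 p)" and ?z = "(snd c p, 0::real)"
  let ?\<Phi> = "family_rep c ?d F" and ?H = "\<lambda>y. snd c' (chart_inv ?d y)" and ?\<Psi> = "family_rep c c' F"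
  have d: "?d \<in> B" "F 0 p \<in> fst ?d"
    by (rule chart_at_in[OF B] chart_at_mem[OF B])+
  obtain N where N: "open N" "?z \<in> N" "N \<subseteq> family_domain c c' \<epsilon> F" "N \<subseteq> family_domain c ?d \<epsilon> F"
    "?\<Phi> ` N \<subseteq> snd ?d ` (fst ?d \<inter> fst c')"
    "\<forall>z\<in>N. vel ?\<Psi> z = fd ?H (?\<Phi> z) (vel ?\<Phi> z)"
    by (rule vel_change)
  have S: "open (snd ?d ` (fst ?d \<inter> fst c'))"
    using chart_open[OF B d(1)] chart_open[OF B c(2)] by (intro open_chart_image[OF B d(1)]) auto
  have Q: "open (family_domain c ?d \<epsilon> F)" and \<Phi>: "smooth_on (family_domain c ?d \<epsilon> F) ?\<Phi>"
    by (rule family_domain_open[OF family_continuous c(1) d(1)] family_rep_smooth[OF c(1) d(1)])+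
  have z: "?\<Phi> ?z = snd ?d (F 0 p)" "?\<Psi> ?z = snd c' (F 0 p)" "?z \<in> family_domain c ?d \<epsilon> F"
    "?\<Phi> ?z \<in> snd ?d ` (fst ?d \<inter> fst c')"
    using c N by (auto simp: family_rep_def chart_inv_chart[OF A])
  have "fd (vel ?\<Psi>) ?z = fd (\<lambda>z. fd ?H (?\<Phi> z) (vel ?\<Phi> z)) ?z"
    by (rule fd_cong[OF N(1,2)]) (use N(6) in blast)
  also have "\<dots> = (\<lambda>h. fd (\<lambda>x. fd ?H x (vel ?\<Phi> ?z)) (?\<Phi> ?z) (fd ?\<Phi> ?z h) + fd ?H (?\<Phi> ?z) (fd (vel ?\<Phi>) ?z h))"
    by (intro fd_eq has_derivative_fd_apply[where t = ?z and y
        = ?\<Phi>, OF S transition_smooth[OF B d(1) c(2)] z(4)] fd_works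
        smooth_on_differentiable[OF \<Phi> z(3)] smooth_on_differentiable[OF vel_smooth[OF Q \<Phi>] z(3)])
  finally have 1: "fd (vel ?\<Psi>) ?z (0, 1) = fd (\<lambda>x. fd ?H x (vel ?\<Phi> ?z)) (?\<Phi> ?z) (vel ?\<Phi> ?z)
      + coord_change ?d c' (F 0 p) (fd (vel ?\<Phi>) ?z (0, 1))"
    by (simp add: coord_change_eq vel_def[of ?\<Phi> ?z] z)
  have 2: "vel ?\<Psi> ?z = coord_change ?d c' (F 0 p) (vel ?\<Phi> ?z)"
    using N(2,6) by (simp add: coord_change_eq z)
  show ?thesis
    unfolding components_def acceleration_chart_at acc_def 1 z(1,2)
      linear_add[OF coord_change_linear[OF B d(1) c(2) d(2) c(4)]]
      christoffel_transformation[OF B nabla d(1) c(2) d(2) c(4)] 2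
    by simp
qed

end

lemma sections_of_rep:
  assumes \<epsilon>: "\<epsilon> > 0"
    and R: "\<And>c c'. c \<in> A \<Longrightarrow> c' \<in> B \<Longrightarrow> smooth_on (family_domain c c' \<epsilon> F) (R c c')"
    and W: "\<And>c c' p. c \<in> A \<Longrightarrow> c' \<in> B \<Longrightarrow> p \<in> fst c \<Longrightarrow> F 0 p \<in> fst c' \<Longrightarrow>
      components B c' (F 0 p) (W p) = R c c' (snd c p, 0)"
  shows "W \<in> sections A B (F 0)"
  unfolding sections_def smooth_along_def
proof (intro CollectI ballI)
  fix c c' assume c: "c \<in> A" "c' \<in> B"
  let ?S = "snd c ` (fst c \<inter> F 0 -` fst c')"
  have f: "continuous_on UNIV (F 0)"
    using \<epsilon> by (intro smooth_map_continuous[OF A B] family_smooth_map) simp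
  have o: "open ?S"
    by (rule local_domain_open[OF A c(1) f chart_open[OF B c(2)]])
  have "smooth_on ?S (\<lambda>x. R c c' (x, 0))"
    by (rule smooth_on_compose[OF o family_domain_open[OF family_continuous c] _ _ R[OF c]])
      (use c \<epsilon> in \<open>auto simp: family_domain_def chart_inv_chart[OF A]
        intro!: smooth_on_Pair o smooth_on_id smooth_on_const\<close>)
  then have "smooth_on ?S (\<lambda>x. components B c' (F 0 (chart_inv c x)) (W (chart_inv c x)))"
    by (rule smooth_on_cong[OF o, rotated]) (use c W[OF c] in \<open>auto simp: chart_inv_chart[OF A]\<close>)
  then show "smooth_on (snd c ` (UNIV \<inter> fst c \<inter> F 0 -` fst c'))
      (\<lambda>x. components B c' (F 0 (chart_inv c x)) (W (chart_inv c x)))"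
    by simp
qed

lemma variation_field_section:
  assumes \<epsilon>: "\<epsilon> > 0"
  shows "variation_field B F \<in> sections A B (F 0)"
  by (rule sections_of_rep[OF \<epsilon> vel_smooth[OF family_domain_open[OF family_continuous] family_rep_smooth]
        components_variation_field[OF \<epsilon>]])

lemma acceleration_section:
  assumes \<epsilon>: "\<epsilon> > 0" and nabla: "affine_connection B nabla"
  shows "acceleration B nabla F \<in> sections A B (F 0)"
proof (rule sections_of_rep[OF \<epsilon> _ components_acceleration[OF \<epsilon> _ _ _ _ nabla]])
  fix c c' assume c: "c \<in> A" "c' \<in> B"
  show "smooth_on (family_domain c c' \<epsilon> F) (acc (family_rep c c' F) (christoffel B nabla c'))"
    by (rule acc_smooth[OF family_domain_open[OF family_continuous c] family_rep_smooth[OF c]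
          chart_image_open[OF B c(2)] _ christoffel_smooth_bil[OF B nabla c(2)]])
      (auto simp: family_domain_def family_rep_def)
qed

end

end

section \<open>Orthonormal frames\<close>

text \<open>Orthonormal vectors are independent, and \<open>m\<close> of them span a space of
  dimension \<open>m\<close>. The difference of the two sides is linear in \<open>v\<close> and
  vanishes on the frame.\<close>

lemma orthonormal_expansion:
  fixes g :: "'e::euclidean_space \<Rightarrow> 'e \<Rightarrow> real" and e :: "nat \<Rightarrow> 'e"
  assumes g: "bilinear g" and H: "dim H = m"
    and e: "\<And>i. i < m \<Longrightarrow> e i \<in> H" "\<And>i j. i < m \<Longrightarrow> j < m \<Longrightarrow> g (e i) (e j) = (if i = j then 1 else 0)"
    and v: "v \<in> H"
  shows "v = (\<Sum>i<m. g v (e i) *\<^sub>R e i)"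
proof -
  let ?S = "e ` {..<m}"
  have ne: "e i \<noteq> e j" if "i < m" "j < m" "i \<noteq> j" for i j
    using e(2)[of i i] e(2)[of i j] that by auto
  then have inj: "inj_on e {..<m}"
    by (auto simp: inj_on_def)
  have "independent ?S"
    unfolding dependent_def
  proof
    assume "\<exists>a\<in>?S. a \<in> span (?S - {a})"
    then obtain i where i: "i < m" "e i \<in> span (?S - {e i})"
      by auto
    have "linear (g (e i))"
      using g by (simp add: bilinear_def)
    moreover have "g (e i) x = 0" if "x \<in> ?S - {e i}" for x
      using that e(2)[OF i(1)] by auto
    ultimately have "g (e i) (e i) = 0"
      using linear_eq_0_on_span[OF _ _ i(2)] by blast
    then show False
      using e(2)[OF i(1) i(1)] by simp
  qed
  moreover have "card ?S = m"
    using card_image[OF inj] by simp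
  moreover have "?S \<subseteq> H"
    using e by auto
  ultimately have "H \<subseteq> span ?S"
    using H by (intro card_ge_dim_independent) auto
  then have v': "v \<in> span ?S"
    using v by blast
  have "linear (\<lambda>v. v - (\<Sum>i<m. g v (e i) *\<^sub>R e i))"
    by (intro linearI) (simp_all add: bilinear_ladd[OF g] bilinear_lmul[OF g] algebra_simps sum.distrib scaleR_sum_right)
  moreover have "x - (\<Sum>i<m. g x (e i) *\<^sub>R e i) = 0" if "x \<in> ?S" for x
  proof -
    from that obtain j where j: "j < m" "x = e j"
      by auto
    have "(\<Sum>i<m. g x (e i) *\<^sub>R e i) = (\<Sum>i<m. if i = j then e j else 0)"
      using j e(2) by (intro sum.cong) auto
    then show ?thesis
      using j by (simp add: sum.delta)
  qed
  ultimately have "v - (\<Sum>i<m. g v (e i) *\<^sub>R e i) = 0"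
    using linear_eq_0_on_span[OF _ _ v'] by blast
  then show ?thesis
    by simp
qed

text \<open>Invariance of the trace: two orthonormal frames differ by the orthogonal matrix
  \<open>a\<close>, and the coefficients of the double expansion contract to the identity.\<close>

lemma frame_sum_independent:
  fixes g b :: "'e::euclidean_space \<Rightarrow> 'e \<Rightarrow> real" and e e' :: "nat \<Rightarrow> 'e"
  assumes g: "bilinear g" "\<And>u w. g u w = g w u" and H: "dim H = m" and b: "bilinear b"
    and e: "\<And>i. i < m \<Longrightarrow> e i \<in> H" "\<And>i j. i < m \<Longrightarrow> j < m \<Longrightarrow> g (e i) (e j) = (if i = j then 1 else 0)"
    and e': "\<And>i. i < m \<Longrightarrow> e' i \<in> H" "\<And>i j. i < m \<Longrightarrow> j < m \<Longrightarrow> g (e' i) (e' j) = (if i = j then 1 else 0)"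
  shows "(\<Sum>i<m. b (e i) (e i)) = (\<Sum>i<m. b (e' i) (e' i))"
proof -
  define a where "a i j = g (e' i) (e j)" for i j
  have exp': "e' i = (\<Sum>j<m. a i j *\<^sub>R e j)" if "i < m" for i
    unfolding a_def by (rule orthonormal_expansion[OF g(1) H e(1,2) e'(1)[OF that]])
  have b1: "linear (\<lambda>u. b u w)" and b2: "linear (b u)" for u w
    using b by (auto simp: bilinear_def)
  have bb: "b (e' i) (e' i) = (\<Sum>j<m. \<Sum>l<m. (a i j * a i l) * b (e j) (e l))" if "i < m" for i
  proof -
    have 1: "b (e' i) w = (\<Sum>j<m. a i j * b (e j) w)" for w
      by (subst exp'[OF that]) (simp add: linear_sum[OF b1] linear_cmul[OF b1])
    have 2: "b u (e' i) = (\<Sum>l<m. a i l * b u (e l))" for u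
      by (subst exp'[OF that]) (simp add: linear_sum[OF b2] linear_cmul[OF b2])
    show ?thesis
      unfolding 1[of "e' i"] 2[of "e _"] by (simp add: sum_distrib_left mult.assoc)
  qed
  \<comment> \<open>Orthonormality of the columns of \<open>a\<close>, obtained by expanding
    \<open>e j\<close> in the other frame.\<close>
  have orth: "(\<Sum>i<m. a i j * a i l) = (if j = l then 1 else 0)" if "j < m" "l < m" for j l
  proof -
    have g1: "linear (\<lambda>u. g u w)" for w
      using g(1) by (simp add: bilinear_def)
    have "g (e j) (e l) = g (\<Sum>i<m. g (e j) (e' i) *\<^sub>R e' i) (e l)"
      using orthonormal_expansion[OF g(1) H e'(1,2) e(1)[OF that(1)]] by simp
    also have "\<dots> = (\<Sum>i<m. a i j * a i l)"
      by (simp add: linear_sum[OF g1] linear_cmul[OF g1] a_def g(2)[of "e j"])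
    finally show ?thesis
      using e(2)[OF that] by simp
  qed
  have "(\<Sum>i<m. b (e' i) (e' i)) = (\<Sum>i<m. \<Sum>j<m. \<Sum>l<m. (a i j * a i l) * b (e j) (e l))"
    by (simp add: bb)
  also have "\<dots> = (\<Sum>j<m. \<Sum>i<m. \<Sum>l<m. (a i j * a i l) * b (e j) (e l))"
    by (rule sum.swap)
  also have "\<dots> = (\<Sum>j<m. \<Sum>l<m. \<Sum>i<m. (a i j * a i l) * b (e j) (e l))"
    by (intro sum.cong refl sum.swap)
  also have "\<dots> = (\<Sum>j<m. \<Sum>l<m. (if j = l then 1 else 0) * b (e j) (e l))"
    by (intro sum.cong refl) (simp add: sum_distrib_right[symmetric] orth)
  also have "\<dots> = (\<Sum>j<m. b (e j) (e j))"
    by (intro sum.cong refl) (simp add: if_distrib[of "\<lambda>x. x * _"] sum.delta cong: if_cong)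
  finally show ?thesis
    by simp
qed

text \<open>Continuity of the frame is all that is carried along: it enters the density as
  coefficients that do not depend on time.\<close>

lemma gram_schmidt_continuous:
  fixes X :: "nat \<Rightarrow> 'e::euclidean_space \<Rightarrow> 'e" and g :: "'e \<Rightarrow> 'e \<Rightarrow> 'e \<Rightarrow> real"
  assumes g: "smooth_bil S g" and sym: "\<And>x u w. x \<in> S \<Longrightarrow> g x u w = g x w u"
    and pos: "\<And>x v. x \<in> S \<Longrightarrow> v \<noteq> 0 \<Longrightarrow> g x v v > 0"
    and X: "\<And>i. i < m \<Longrightarrow> continuous_on S (X i)"
    and ind: "\<And>x i. x \<in> S \<Longrightarrow> i < m \<Longrightarrow> X i x \<notin> span ((\<lambda>j. X j x) ` {..<i})"
  shows "\<exists>E. (\<forall>i<m. continuous_on S (E i)) \<and>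
    (\<forall>x\<in>S. (\<forall>i<m. E i x \<in> span ((\<lambda>j. X j x) ` {..<m})) \<and>
      (\<forall>i<m. \<forall>j<m. g x (E i x) (E j x) = (if i = j then 1 else 0)))"
  using X ind
proof (induction m)
  case 0
  then show ?case
    by simp
next
  case (Suc m)
  have "\<exists>E. (\<forall>i<m. continuous_on S (E i)) \<and>
    (\<forall>x\<in>S. (\<forall>i<m. E i x \<in> span ((\<lambda>j. X j x) ` {..<m})) \<and>
      (\<forall>i<m. \<forall>j<m. g x (E i x) (E j x) = (if i = j then 1 else 0)))"
    by (rule Suc.IH) (use Suc.prems in auto)
  then obtain E where E: "\<And>i. i < m \<Longrightarrow> continuous_on S (E i)"
    "\<And>x i. x \<in> S \<Longrightarrow> i < m \<Longrightarrow> E i x \<in> span ((\<lambda>j. X j x) ` {..<m})"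
    "\<And>x i j. x \<in> S \<Longrightarrow> i < m \<Longrightarrow> j < m \<Longrightarrow> g x (E i x) (E j x) = (if i = j then 1 else 0)"
    by blast
  \<comment> \<open>The part of the new vector orthogonal to the frame built so far; independence
    keeps it nonzero, so dividing by its length is continuous.\<close>
  define w where "w x = X m x - (\<Sum>i<m. g x (X m x) (E i x) *\<^sub>R E i x)" for x
  define n where "n x = sqrt (g x (w x) (w x))" for x
  define E' where "E' i = (if i < m then E i else (\<lambda>x. (1 / n x) *\<^sub>R w x))" for i
  have bil: "bilinear (g x)" if "x \<in> S" for x
    using g that by (auto simp: smooth_bil_def)
  have cont_w: "continuous_on S w"
    unfolding w_def[abs_def]
    by (intro continuous_intros continuous_on_bil[OF g] E(1)) (use Suc.prems in \<open>auto intro: continuous_on_id\<close>)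
  have w0: "w x \<noteq> 0" if x: "x \<in> S" for x
  proof
    assume "w x = 0"
    then have "X m x = (\<Sum>i<m. g x (X m x) (E i x) *\<^sub>R E i x)"
      by (simp add: w_def)
    also have "\<dots> \<in> span ((\<lambda>j. X j x) ` {..<m})"
      by (intro span_sum span_scale E(2) x) auto
    finally show False
      using Suc.prems(2)[OF x, of m] by simp
  qed
  have n: "n x > 0" "n x * n x = g x (w x) (w x)" if x: "x \<in> S" for x
    using pos[OF x w0[OF x]] by (simp_all add: n_def)
  have wE: "g x (w x) (E j x) = 0" if x: "x \<in> S" and j: "j < m" for x j
  proof -
    have lin: "linear (\<lambda>u. g x u (E j x))"
      using bil[OF x] by (simp add: bilinear_def)
    have "g x (w x) (E j x) = g x (X m x) (E j x) - (\<Sum>i<m. g x (X m x) (E i x) * g x (E i x) (E j x))"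
      by (simp add: w_def linear_sum[OF lin] linear_diff[OF lin] linear_cmul[OF lin])
    also have "(\<Sum>i<m. g x (X m x) (E i x) * g x (E i x) (E j x)) = (\<Sum>i<m. if i
        = j then g x (X m x) (E j x) else 0)"
      by (intro sum.cong) (use E(3)[OF x _ j] in auto)
    finally show ?thesis
      using j by (simp add: sum.delta)
  qed
  have cont: "continuous_on S (E' i)" if "i < Suc m" for i
  proof (cases "i < m")
    case False
    have "continuous_on S n"
      unfolding n_def[abs_def] by (intro continuous_intros continuous_on_bil[OF g] cont_w) auto
    then show ?thesis
      using False n(1) by (force simp: E'_def intro!: continuous_intros cont_w)
  qed (simp add: E'_def E(1))
  have mono: "span ((\<lambda>j. X j x) ` {..<m}) \<subseteq> span ((\<lambda>j. X j x) ` {..<Suc m})" for x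
    by (intro span_mono image_mono) auto
  have sp: "E' i x \<in> span ((\<lambda>j. X j x) ` {..<Suc m})" if x: "x \<in> S" and i: "i < Suc m" for x i
  proof (cases "i < m")
    case True
    then show ?thesis
      using E(2)[OF x True] mono by (auto simp: E'_def)
  next
    case False
    have "w x \<in> span ((\<lambda>j. X j x) ` {..<Suc m})"
      unfolding w_def using E(2)[OF x] mono
      by (intro span_diff span_sum span_scale) (auto intro: span_base)
    then show ?thesis
      using False by (simp add: E'_def span_scale)
  qed
  have orth: "g x (E' i x) (E' j x) = (if i = j then 1 else 0)"
    if x: "x \<in> S" and ij: "i < Suc m" "j < Suc m" for x i j
    using ij E(3)[OF x, of i j] wE[OF x, of i] wE[OF x, of j] n[OF x] sym[OF x, of "E i x" "w x"]
    by (cases "i < m"; cases "j < m")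
      (auto simp: E'_def bilinear_lmul[OF bil[OF x]] bilinear_rmul[OF bil[OF x]] field_simps)
  show ?case
    using cont sp orth by (intro exI[of _ E']) blast
qed

text \<open>A redundant member could be dropped, leaving too few vectors for dimension
  \<open>m\<close>. This turns the constant rank of the bundle into the hypothesis of
  Gram-Schmidt.\<close>

lemma spanning_family_independent:
  fixes X :: "nat \<Rightarrow> 'e::euclidean_space"
  assumes "dim (span (X ` {..<m})) = m" "i < m"
  shows "X i \<notin> span (X ` {..<i})"
proof
  assume "X i \<in> span (X ` {..<i})"
  moreover have "X ` {..<i} \<subseteq> X ` ({..<m} - {i})"
    using assms by auto
  ultimately have "X i \<in> span (X ` ({..<m} - {i}))"
    using span_mono by blast
  then have "X ` {..<m} \<subseteq> span (X ` ({..<m} - {i}))"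
    by (metis (no_types, lifting) DiffI image_eqI image_subsetI insertE insert_iff singletonD span_base)
  then have "dim (X ` {..<m}) \<le> card (X ` ({..<m} - {i}))"
    by (intro dim_le_card) auto
  also have "\<dots> \<le> card ({..<m} - {i})"
    by (rule card_image_le) simp
  also have "\<dots> < m"
    using assms(2) by simp
  finally show False
    using assms(1) by simp
qed

context
  fixes A :: "('a::{t2_space,second_countable_topology}, 'e::euclidean_space) chart set"
    and g :: "'a \<Rightarrow> 'e \<Rightarrow> 'e \<Rightarrow> real" and H m
  assumes A: "smooth_manifold A" and g: "riemannian_metric A g" and H: "smooth_subbundle A H m"
begin

lemma metric_bilinear: "bilinear (g p)" and metric_symmetric: "g p u w = g p w u"
  and metric_positive: "v \<noteq> 0 \<Longrightarrow> g p v v > 0"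
  using g by (auto simp: riemannian_metric_def)

lemma frame_sum_eq:
  assumes "bilinear b" "orthonormal_frame_at g H m p e" "orthonormal_frame_at g H m p e'"
  shows "(\<Sum>i<m. b (e i) (e i) :: real) = (\<Sum>i<m. b (e' i) (e' i))"
proof -
  have "dim (H p) = m"
    using H by (simp add: smooth_subbundle_def)
  then show ?thesis
    using assms by (intro frame_sum_independent[where g = "g p" and H =
        "H p", OF metric_bilinear metric_symmetric])
      (auto simp: orthonormal_frame_at_def)
qed

text \<open>Gram-Schmidt is applied to the components, in one chart, of the local spanning sections
  of the bundle; components make continuity meaningful across changes of the preferred
  chart.\<close>

lemma local_continuous_frame:
  assumes c: "c \<in> A" "p \<in> fst c"
  obtains U E where "open U" "p \<in> U" "U \<subseteq> fst c" "\<And>i. i < m \<Longrightarrow> continuous_on U (E i)"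
    "\<And>q. q \<in> U \<Longrightarrow> orthonormal_frame_at g H m q (\<lambda>i. from_components A c q (E i q))"
proof -
  from H obtain V X where V: "open V" "p \<in> V" "\<And>i. i < m \<Longrightarrow> smooth_along A A V id (X i)"
    "\<And>q. q \<in> V \<Longrightarrow> H q = span ((\<lambda>i. X i q) ` {..<m})" and dimH: "\<And>q. dim (H q) = m"
    unfolding smooth_subbundle_def by metis
  define U where "U = V \<inter> fst c"
  have U: "open U" "p \<in> U" "U \<subseteq> fst c"
    using V c chart_open[OF A c(1)] by (auto simp: U_def)
  let ?S = "snd c ` U"
  let ?X = "\<lambda>i. local_rep A c (X i)"
  have S: "open ?S" "?S \<subseteq> snd c ` fst c"
    using U open_chart_image[OF A c(1)] by auto
  have gS: "smooth_bil ?S (metric_rep A g c)"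
    by (rule smooth_bil_subset[OF metric_rep_smooth_bil[OF A g c(1)] S(2)])
  have lin: "linear (components A c q)" "linear (from_components A c q)" if "q \<in> U" for q
    using components_linear[OF A c(1)] from_components_linear[OF A c(1)] U that by blast+
  have H_eq: "span ((\<lambda>i. ?X i (snd c q)) ` {..<m}) = components A c q ` H q" if "q \<in> U" for q
  proof -
    have "(\<lambda>i. ?X i (snd c q)) ` {..<m} = components A c q ` (\<lambda>i. X i q) ` {..<m}"
      using that U by (auto simp: image_image chart_inv_chart[OF A c(1)] subset_iff)
    then show ?thesis
      using linear_span_image[OF lin(1)[OF that]] V(4) that by (simp add: U_def)
  qed
  have inj: "inj (components A c q)" if "q \<in> U" for q
    using components_inj[OF A c(1)] U that by (auto simp: inj_def)
  have "\<exists>E. (\<forall>i<m. continuous_on ?S (E i)) \<and>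
    (\<forall>x\<in>?S. (\<forall>i<m. E i x \<in> span ((\<lambda>j. ?X j x) ` {..<m})) \<and>
      (\<forall>i<m. \<forall>j<m. metric_rep A g c x (E i x) (E j x) = (if i = j then 1 else 0)))"
  proof (rule gram_schmidt_continuous[OF gS])
    fix x u w assume "x \<in> ?S"
    then show "metric_rep A g c x u w = metric_rep A g c x w u"
      by (simp add: metric_rep_def metric_symmetric)
  next
    fix x and v :: 'e assume x: "x \<in> ?S" and v: "v \<noteq> 0"
    then obtain q where q: "q \<in> U" "x = snd c q"
      by auto
    then have q': "q \<in> fst c"
      using U by blast
    have "from_components A c q v \<noteq> 0"
      using v components_from_components[OF A c(1) q', of v] linear_0[OF lin(1)[OF q(1)]] by auto
    then show "metric_rep A g c x v v > 0"
      using q q' by (simp add: metric_rep_def metric_positive chart_inv_chart[OF A c(1)])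
  next
    fix i assume i: "i < m"
    have "smooth_on (snd c ` (V \<inter> fst c \<inter> id -` fst c)) (\<lambda>x. components A c (id (chart_inv c x)) (X i (chart_inv c x)))"
      using V(3)[OF i] c unfolding smooth_along_def by blast
    moreover have "V \<inter> fst c \<inter> id -` fst c = U"
      by (auto simp: U_def)
    ultimately have "smooth_on ?S (?X i)"
      by simp
    then show "continuous_on ?S (?X i)"
      by (rule smooth_on_continuous)
  next
    fix x i assume x: "x \<in> ?S" and i: "i < m"
    then obtain q where q: "q \<in> U" "x = snd c q"
      by auto
    have "dim (components A c q ` H q) = m"
      using dim_image_eq[OF lin(1)[OF q(1)]] inj[OF q(1)] dimH by (metis inj_on_subset subset_UNIV)
    then show "?X i x \<notin> span ((\<lambda>j. ?X j x) ` {..<i})"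
      using spanning_family_independent[of "\<lambda>i. ?X i x" m i] i H_eq[OF q(1)] q(2) by simp
  qed
  then obtain E where E: "\<And>i. i < m \<Longrightarrow> continuous_on ?S (E i)"
    "\<And>x i. x \<in> ?S \<Longrightarrow> i < m \<Longrightarrow> E i x \<in> span ((\<lambda>j. ?X j x) ` {..<m})"
    "\<And>x i j. x \<in> ?S \<Longrightarrow> i < m \<Longrightarrow> j < m \<Longrightarrow> metric_rep A g c x (E i x) (E j x) = (if i = j then 1 else 0)"
    by blast
  show ?thesis
  proof (rule that[OF U, of "\<lambda>i q. E i (snd c q)"])
    fix i assume "i < m"
    then show "continuous_on U (\<lambda>q. E i (snd c q))"
      using U(3) by (intro continuous_on_compose2[OF E(1) continuous_on_subset[OF chart_continuous[OF A c(1)]]]) auto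
  next
    fix q assume q: "q \<in> U"
    then have q': "q \<in> fst c"
      using U by blast
    have mem: "from_components A c q (E i (snd c q)) \<in> H q" if "i < m" for i
    proof -
      have "E i (snd c q) \<in> components A c q ` H q"
        using E(2)[of "snd c q" i] that q H_eq[OF q] by auto
      then show ?thesis
        using from_components_components[OF A c(1) q'] by auto
    qed
    have "g q (from_components A c q (E i (snd c q))) (from_components A c q (E j (snd c q)))
      = (if i = j then 1 else 0)" if "i < m" "j < m" for i j
      using E(3)[OF imageI[OF q] that] q' by (simp add: metric_rep_def chart_inv_chart[OF A c(1)])
    then show "orthonormal_frame_at g H m q (\<lambda>i. from_components A c q (E i (snd c q)))"
      using mem by (simp add: orthonormal_frame_at_def)
  qed
qed

text \<open>The frame chosen in \<open>hor_norm_sq\<close> is arbitrary; trace invariance lets any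
  convenient frame at the point take its place.\<close>

lemma hor_norm_sq_frame:
  assumes f: "linear (differential A B f p)" and h: "bilinear (h (f p))"
    and e: "orthonormal_frame_at g H m p e"
  shows "hor_norm_sq A g H m B h f p
    = (\<Sum>i<m. h (f p) (differential A B f p (e i)) (differential A B f p (e i)))"
proof -
  let ?e = "SOME e. orthonormal_frame_at g H m p e"
  have "bilinear (\<lambda>u w. h (f p) (differential A B f p u) (differential A B f p w))"
    unfolding bilinear_def
    by (auto intro!: linearI simp: linear_add[OF f] linear_cmul[OF f] bilinear_ladd[OF h] bilinear_radd[OF h]
        bilinear_lmul[OF h] bilinear_rmul[OF h])
  moreover have "orthonormal_frame_at g H m p ?e"
    using someI[of "orthonormal_frame_at g H m p", OF e] by simp
  ultimately show ?thesis
    using frame_sum_eq e unfolding hor_norm_sq_def Let_def by blast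
qed

end

section \<open>Differentiation under the integral over a compact manifold\<close>

text \<open>Continuity is joint in time and point: on a compact space it gives a uniform bound over
  closed time intervals, hence a dominating constant.\<close>

definition C1_in_time :: "real \<Rightarrow> (real \<Rightarrow> 'a::topological_space \<Rightarrow> real) \<Rightarrow> (real \<Rightarrow> 'a \<Rightarrow> real) \<Rightarrow> bool" where
  "C1_in_time \<epsilon> w w' \<longleftrightarrow>
     continuous_on ({-\<epsilon><..<\<epsilon>} \<times> UNIV) (\<lambda>z. w (fst z) (snd z)) \<and>
     continuous_on ({-\<epsilon><..<\<epsilon>} \<times> UNIV) (\<lambda>z. w' (fst z) (snd z)) \<and>
     (\<forall>t p. \<bar>t\<bar> < \<epsilon> \<longrightarrow> ((\<lambda>s. w s p) has_real_derivative w' t p) (at t))"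

lemma C1_in_time_exp_half:
  assumes "C1_in_time \<epsilon> w w'" "C1_in_time \<epsilon> w' w''"
  shows "C1_in_time \<epsilon> (\<lambda>t p. exp (w t p / 2)) (\<lambda>t p. exp (w t p / 2) * (w' t p / 2))"
    and "C1_in_time \<epsilon> (\<lambda>t p. exp (w t p / 2) * (w' t p / 2))
      (\<lambda>t p. exp (w t p / 2) * ((w' t p / 2)\<^sup>2 + w'' t p / 2))"
  using assms unfolding C1_in_time_def
  by (auto intro!: continuous_intros derivative_eq_intros simp: algebra_simps power2_eq_square)

context
  fixes M :: "'a::{t2_space,second_countable_topology} measure"
  assumes fin: "finite_measure M" and borel: "sets M = sets borel" and compact: "compact (UNIV :: 'a set)"
begin

lemma continuous_integrable:
  fixes f :: "'a \<Rightarrow> real"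
  assumes f: "continuous_on UNIV f"
  shows "integrable M f"
proof -
  have "compact (f ` UNIV)"
    using f compact by (rule compact_continuous_image)
  then obtain C where "\<And>p. norm (f p) \<le> C"
    by (meson bounded_iff compact_imp_bounded rangeI)
  moreover have "f \<in> borel_measurable M"
    using borel_measurable_continuous_onI[OF f] measurable_cong_sets[OF borel refl] by blast
  ultimately show ?thesis
    by (intro finite_measure.integrable_const_bound[OF fin]) auto
qed

lemma C1_in_time_slice:
  fixes w :: "real \<Rightarrow> 'a \<Rightarrow> real"
  assumes w: "C1_in_time \<epsilon> w w'" and t: "\<bar>t\<bar> < \<epsilon>"
  shows "continuous_on UNIV (w t)" "continuous_on UNIV (w' t)"
proof -
  have "continuous_on UNIV (\<lambda>p::'a. (t, p))"
    by (intro continuous_intros)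
  moreover have "range (\<lambda>p::'a. (t, p)) \<subseteq> {-\<epsilon><..<\<epsilon>} \<times> UNIV"
    using t by auto
  ultimately have *: "continuous_on UNIV (\<lambda>p. f (t, p))"
    if "continuous_on ({-\<epsilon><..<\<epsilon>} \<times> UNIV) f" for f :: "real \<times> 'a \<Rightarrow> real"
    using continuous_on_compose2[OF that] by blast
  show "continuous_on UNIV (w t)" "continuous_on UNIV (w' t)"
    using w *[of "\<lambda>z. w (fst z) (snd z)"] *[of "\<lambda>z. w' (fst z) (snd z)"] by (simp_all add: C1_in_time_def)
qed

lemma integral_has_time_derivative:
  fixes w :: "real \<Rightarrow> 'a \<Rightarrow> real"
  assumes w: "C1_in_time \<epsilon> w w'" and t: "\<bar>t\<bar> < \<epsilon>"
  shows "((\<lambda>t. LINT p|M. w t p) has_real_derivative (LINT p|M. w' t p)) (at t)"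
proof -
  \<comment> \<open>A slightly shorter interval, whose closure still lies in the domain, so that
    \<open>w'\<close> is bounded on a compact product.\<close>
  obtain r where r: "\<bar>t\<bar> < r" "r < \<epsilon>"
    using t dense by blast
  let ?I = "{-r<..<r}"
  have I: "open ?I" "t \<in> ?I"
    using r by auto
  have "compact ((\<lambda>z. w' (fst z) (snd z)) ` ({-r..r} \<times> UNIV))"
    using w r compact unfolding C1_in_time_def
    by (intro compact_continuous_image compact_Times) (auto intro: continuous_on_subset)
  then obtain C where "\<forall>y\<in>(\<lambda>z. w' (fst z) (snd z)) ` ({-r..r} \<times> UNIV). norm y \<le> C"
    by (meson bounded_iff compact_imp_bounded)
  then have C: "\<bar>w' s p\<bar> \<le> C" if "s \<in> {-r..r}" for s p
    using that by force
  have int: "integrable M (w s)" if "s \<in> ?I" for s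
    using that r by (intro continuous_integrable C1_in_time_slice(1)[OF w]) auto
  have der: "((\<lambda>s. w s p) has_real_derivative w' s p) (at s)" if "s \<in> {-r..r}" for s p
    using w that r unfolding C1_in_time_def by auto
  \<comment> \<open>The mean value inequality bounds all difference quotients by the same constant,
    which is integrable because the measure is finite.\<close>
  have lip: "\<bar>(w s p - w t p) / (s - t)\<bar> \<le> C" if s: "s \<in> ?I" "s \<noteq> t" for s p
  proof -
    have "norm (w s p - w t p) \<le> C * norm (s - t)"
      by (rule field_differentiable_bound[of "{-r..r}" "\<lambda>s. w s p" "\<lambda>s. w' s p"])
        (use C der s I in \<open>auto intro: has_field_derivative_at_within\<close>)
    then show ?thesis
      using s by (simp add: abs_divide divide_le_eq)
  qed
  have "((\<lambda>s. ((LINT p|M. w s p) - (LINT p|M. w t p)) / (s - t)) \<longlongrightarrow> (LINT p|M. w' t p)) (at t within ?I)"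
    unfolding tendsto_at_iff_sequentially
  proof (intro allI impI)
    fix X assume X: "\<forall>i. X i \<in> ?I - {t}" "X \<longlonglongrightarrow> t"
    have "(\<lambda>i. LINT p|M. (w (X i) p - w t p) / (X i - t)) \<longlonglongrightarrow> (LINT p|M. w' t p)"
    proof (rule integral_dominated_convergence[where w = "\<lambda>_. C"])
      show "integrable M (\<lambda>_. C)"
        using fin by (simp add: finite_measure.integrable_const)
      show "w' t \<in> borel_measurable M"
        using continuous_integrable[OF C1_in_time_slice(2)[OF w t]] by simp
      show "(\<lambda>p. (w (X i) p - w t p) / (X i - t)) \<in> borel_measurable M" for i
        using int[of "X i"] int[of t] X(1) I by (intro borel_measurable_divide borel_measurable_diff) auto
      show "AE p in M. norm ((w (X i) p - w t p) / (X i - t)) \<le> C" for i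
        using lip X(1) by auto
      show "AE p in M. (\<lambda>i. (w (X i) p - w t p) / (X i - t)) \<longlonglongrightarrow> w' t p"
      proof (rule AE_I2)
        fix p
        have "((\<lambda>s. (w s p - w t p) / (s - t)) \<longlongrightarrow> w' t p) (at t)"
          using der[of t p] I by (simp add: has_field_derivative_iff)
        then show "(\<lambda>i. (w (X i) p - w t p) / (X i - t)) \<longlonglongrightarrow> w' t p"
          using X unfolding tendsto_at_iff_sequentially by (auto simp: o_def)
      qed
    qed
    moreover have "(LINT p|M. (w (X i) p - w t p) / (X i - t)) = ((LINT p|M. w (X i) p)
        - (LINT p|M. w t p)) / (X i - t)" for i
    proof -
      have "X i \<in> ?I"
        using X(1) by blast
      then show ?thesis
        by (simp only: integral_divide_zero Bochner_Integration.integral_diff[OF int int] I(2))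
    qed
    ultimately show "((\<lambda>s. ((LINT p|M. w s p) - (LINT p|M. w t p)) / (s - t)) \<circ> X) \<longlonglongrightarrow> (LINT p|M. w' t p)"
      by (simp only: o_def)
  qed
  then show ?thesis
    unfolding has_field_derivative_iff using at_within_open[OF I(2,1)] by simp
qed

end

text \<open>The density \<open>sqrt (det (g\<^sub>i\<^sub>j))\<close> is bounded on a compact coordinate ball.\<close>

lemma riemannian_volume_finite:
  fixes A :: "('a::{t2_space,second_countable_topology}, real^'k) chart set"
  assumes A: "smooth_manifold A" and g: "riemannian_metric A g" and dv: "riemannian_volume A g dv"
    and compact: "compact (UNIV :: 'a set)"
  shows "finite_measure dv"
proof -
  have sets: "sets dv = sets borel"
    using dv by (simp add: riemannian_volume_def)
  have "\<exists>U. open U \<and> p \<in> U \<and> emeasure dv U < \<infinity>" for p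
  proof -
    let ?c = "chart_at A p"
    have c: "?c \<in> A" "p \<in> fst ?c"
      by (rule chart_at_in[OF A] chart_at_mem[OF A])+
    let ?d = "\<lambda>x. sqrt (det (gram_matrix A g ?c (chart_inv ?c x)))"
    obtain r where r: "r > 0" "cball (snd ?c p) r \<subseteq> snd ?c ` fst ?c"
      using c chart_image_open[OF A c(1)] open_contains_cball by blast
    define U where "U = fst ?c \<inter> snd ?c -` ball (snd ?c p) r"
    have U: "open U" "p \<in> U" "U \<subseteq> fst ?c"
      using r c by (auto simp: U_def open_chart_preimage[OF A])
    have entry: "continuous_on (snd ?c ` fst ?c) (\<lambda>x. gram_matrix A g ?c (chart_inv ?c x) $ i $ j)" for i j
    proof -
      have "smooth_on (snd ?c ` fst ?c) (\<lambda>x. metric_rep A g ?c x (axis i 1) (axis j 1))"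
        using metric_rep_smooth_bil[OF A g c(1)] by (simp only: smooth_bil_def)
      then show ?thesis
        using smooth_on_continuous by (simp add: gram_matrix_def metric_rep_def)
    qed
    have "continuous_on (snd ?c ` fst ?c) ?d"
      unfolding det_def[abs_def] by (intro continuous_intros entry)
    then have "compact (?d ` cball (snd ?c p) r)"
      by (intro compact_continuous_image[OF continuous_on_subset[OF _ r(2)]] compact_cball)
    then obtain C where "\<forall>y\<in>?d ` cball (snd ?c p) r. norm y \<le> C"
      by (meson bounded_iff compact_imp_bounded)
    then have C: "?d x \<le> C" if "x \<in> ball (snd ?c p) r" for x
      using that by (auto dest!: bspec[of _ _ x] simp: less_imp_le)
    have "emeasure dv U = (\<integral>\<^sup>+ x \<in> snd ?c ` U. ennreal (?d x) \<partial>lborel)"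
      using dv c U unfolding riemannian_volume_def by (meson borel_open)
    also have "\<dots> \<le> (\<integral>\<^sup>+ x. ennreal C * indicator (ball (snd ?c p) r) x \<partial>lborel)"
    proof (rule nn_integral_mono)
      fix x :: "real^'k"
      show "ennreal (?d x) * indicator (snd ?c ` U) x \<le> ennreal C * indicator (ball (snd ?c p) r) x"
      proof (cases "x \<in> snd ?c ` U")
        case True
        then have "x \<in> ball (snd ?c p) r"
          by (auto simp: U_def)
        then show ?thesis
          using C True by (simp add: ennreal_leI)
      qed simp
    qed
    also have "\<dots> = ennreal C * emeasure lborel (ball (snd ?c p) r)"
      by (rule nn_integral_cmult_indicator) simp
    also have "\<dots> < \<infinity>"
      using emeasure_lborel_ball_finite[of "snd ?c p" r] by (simp add: ennreal_mult_less_top less_top)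
    finally show ?thesis
      using U by blast
  qed
  then obtain U where U: "\<And>p. open (U p)" "\<And>p. p \<in> U p" "\<And>p. emeasure dv (U p) < \<infinity>"
    by metis
  have "\<exists>D. D \<subseteq> UNIV \<and> finite D \<and> UNIV \<subseteq> (\<Union>p\<in>D. U p)"
    using compactE_image[OF compact, of UNIV U] U by (metis UNIV_I UN_I subsetI)
  then obtain D where D: "finite D" "UNIV \<subseteq> (\<Union>p\<in>D. U p)"
    by blast
  have "emeasure dv (\<Union>p\<in>D. U p) \<le> (\<Sum>p\<in>D. emeasure dv (U p))"
    using U sets D by (intro emeasure_subadditive_finite) auto
  also have "\<dots> < \<infinity>"
    using D(1) U(3) by (simp add: less_top)
  finally have "emeasure dv UNIV \<noteq> \<infinity>"
    using D(2) by (simp add: top.extremum_unique)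
  moreover have "space dv = UNIV"
    using sets_eq_imp_space_eq[OF sets] by simp
  ultimately show ?thesis
    by (intro finite_measureI) simp
qed

section \<open>Time regularity of the energy density\<close>

text \<open>Derivatives are unique, so the local functions \<open>k1\<close> and \<open>k2\<close>
  must coincide with those given by \<open>deriv\<close>; regularity found near each point therefore
  patches together.\<close>

lemma C1_in_time_local:
  fixes w :: "real \<Rightarrow> 'a::t2_space \<Rightarrow> real"
  assumes "\<And>t p. \<bar>t\<bar> < \<epsilon> \<Longrightarrow> \<exists>N k0 k1 k2. open N \<and> (t, p) \<in> N \<and> N \<subseteq> {-\<epsilon><..<\<epsilon>} \<times> UNIV \<and>
      continuous_on N k0 \<and> continuous_on N k1 \<and> continuous_on N k2 \<and>
      (\<forall>s q. (s, q) \<in> N \<longrightarrow> w s q = k0 (s, q) \<and> ((\<lambda>s. k0 (s, q)) has_real_derivative k1 (s, q)) (at s) \<and>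
        ((\<lambda>s. k1 (s, q)) has_real_derivative k2 (s, q)) (at s))"
  shows "C1_in_time \<epsilon> w (\<lambda>t p. deriv (\<lambda>s. w s p) t)"
    and "C1_in_time \<epsilon> (\<lambda>t p. deriv (\<lambda>s. w s p) t) (\<lambda>t p. deriv (\<lambda>r. deriv (\<lambda>s. w s p) r) t)"
proof -
  let ?w1 = "\<lambda>t p. deriv (\<lambda>s. w s p) t"
  let ?w2 = "\<lambda>t p. deriv (\<lambda>r. deriv (\<lambda>s. w s p) r) t"
  have *: "isCont (\<lambda>z. w (fst z) (snd z)) (t, p) \<and> isCont (\<lambda>z. ?w1 (fst z) (snd z)) (t, p) \<and>
    isCont (\<lambda>z. ?w2 (fst z) (snd z)) (t, p) \<and>
    ((\<lambda>s. w s p) has_real_derivative ?w1 t p) (at t) \<and> ((\<lambda>s. ?w1 s p) has_real_derivative ?w2 t p) (at t)"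
    if t: "\<bar>t\<bar> < \<epsilon>" for t p
  proof -
    obtain N k0 k1 k2 where N: "open N" "(t, p) \<in> N"
      "continuous_on N k0" "continuous_on N k1" "continuous_on N k2"
      and k: "\<And>s q. (s, q) \<in> N \<Longrightarrow> w s q = k0 (s, q)"
      "\<And>s q. (s, q) \<in> N \<Longrightarrow> ((\<lambda>s. k0 (s, q)) has_real_derivative k1 (s, q)) (at s)"
      "\<And>s q. (s, q) \<in> N \<Longrightarrow> ((\<lambda>s. k1 (s, q)) has_real_derivative k2 (s, q)) (at s)"
      using assms[OF t, of p] by blast
    have sl: "open {s. (s, q) \<in> N}" for q
    proof -
      have "open ((\<lambda>s. (s, q)) -` N)"
        by (rule open_vimage[OF N(1)]) (intro continuous_intros)
      then show ?thesis
        by (simp add: vimage_def)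
    qed
    have d1: "((\<lambda>s. w s q) has_real_derivative k1 (s, q)) (at s)" if "(s, q) \<in> N" for s q
      by (rule has_field_derivative_transform_within_open[OF k(2)[OF that] sl[of q]])
        (use that k(1) in auto)
    then have w1: "?w1 s q = k1 (s, q)" if "(s, q) \<in> N" for s q
      using that DERIV_imp_deriv by blast
    have d2: "((\<lambda>s. ?w1 s q) has_real_derivative k2 (s, q)) (at s)" if "(s, q) \<in> N" for s q
      by (rule has_field_derivative_transform_within_open[OF k(3)[OF that] sl[of q]])
        (use that w1 in auto)
    then have w2: "?w2 s q = k2 (s, q)" if "(s, q) \<in> N" for s q
      using that DERIV_imp_deriv by blast
    have cont: "isCont f (t, p)" if "continuous_on N k" "\<And>z. z \<in> N \<Longrightarrow> k z = f z" for k f :: "real \<times> 'a \<Rightarrow> real"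
      using continuous_on_eq[OF that] N(1,2) by (simp add: continuous_on_eq_continuous_at)
    show ?thesis
      using cont[OF N(3), of "\<lambda>z. w (fst z) (snd z)"] cont[OF N(4), of "\<lambda>z. ?w1 (fst z) (snd z)"]
        cont[OF N(5), of "\<lambda>z. ?w2 (fst z) (snd z)"] d1[OF N(2)] d2[OF N(2)] k(1) w1 w2 N(2) by auto
  qed
  have mem: "\<bar>fst z\<bar> < \<epsilon>" if "z \<in> {-\<epsilon><..<\<epsilon>} \<times> (UNIV :: 'a set)" for z
    using that by auto
  show "C1_in_time \<epsilon> w ?w1" "C1_in_time \<epsilon> ?w1 ?w2"
    unfolding C1_in_time_def using * mem
    by (auto intro!: continuous_at_imp_continuous_on)
qed

context
  fixes A :: "('a::{t2_space,second_countable_topology}, 'e::euclidean_space) chart set"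
    and g :: "'a \<Rightarrow> 'e \<Rightarrow> 'e \<Rightarrow> real" and H :: "'a \<Rightarrow> 'e set" and m :: nat
    and B :: "('b::{t2_space,second_countable_topology}, 'n::euclidean_space) chart set"
    and h :: "'b \<Rightarrow> 'n \<Rightarrow> 'n \<Rightarrow> real"
  assumes A: "smooth_manifold A" and g: "riemannian_metric A g" and H: "smooth_subbundle A H m"
    and B: "smooth_manifold B" and h: "riemannian_metric B h"
begin

lemma h_bilinear: "bilinear (h q)"
  using h by (simp add: riemannian_metric_def)

context
  fixes \<epsilon> :: real and F :: "real \<Rightarrow> 'a \<Rightarrow> 'b"
  assumes F: "smooth_family A B \<epsilon> F"
begin

abbreviation (input) hor_density :: "real \<Rightarrow> 'a \<Rightarrow> real" where
  "hor_density t p \<equiv> hor_norm_sq A g H m B h (F t) p"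

lemma density_rep:
  assumes t: "\<bar>t\<bar> < \<epsilon>" and c: "c \<in> A" "p \<in> fst c" "c' \<in> B" "F t p \<in> fst c'"
    and e: "orthonormal_frame_at g H m p e"
  shows "hor_density t p = (\<Sum>i<m. metric_rep B h c' (family_rep c c' F (snd c p, t))
    (sdir (family_rep c c' F) (components A c p (e i)) (snd c p, t))
    (sdir (family_rep c c' F) (components A c p (e i)) (snd c p, t)))"
proof -
  have z: "family_rep c c' F (snd c p, t) = snd c' (F t p)"
    using c by (simp add: family_rep_def chart_inv_chart[OF A])
  show ?thesis
    unfolding hor_norm_sq_frame[where A = A and B = B and f = "F t" and h = h and p = p and e = e,
        OF A g H differential_linear[OF A B family_smooth_map[OF A B F t]] h_bilinear e]
      sdir_def z family_differential[OF A B F t c, symmetric] metric_rep_components[OF B c(3,4)]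
    by simp
qed

text \<open>The frame is only continuous, so it must not be differentiated. The density is expanded
  over pairs of basis vectors: the frame contributes time-independent coefficients, and the
  remaining factors are smooth.\<close>

lemma density_local:
  assumes t0: "\<bar>t0\<bar> < \<epsilon>"
  shows "\<exists>N k0 k1 k2. open N \<and> (t0, p0) \<in> N \<and> N \<subseteq> {-\<epsilon><..<\<epsilon>} \<times> UNIV \<and>
      continuous_on N k0 \<and> continuous_on N k1 \<and> continuous_on N k2 \<and>
      (\<forall>s q. (s, q) \<in> N \<longrightarrow> hor_density s q = k0 (s, q) \<and> ((\<lambda>s. k0 (s, q)) has_real_derivative k1 (s, q)) (at s) \<and>
        ((\<lambda>s. k1 (s, q)) has_real_derivative k2 (s, q)) (at s))"
proof -
  let ?c = "chart_at A p0" and ?d = "chart_at B (F t0 p0)"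
  have c: "?c \<in> A" "p0 \<in> fst ?c" and d: "?d \<in> B" "F t0 p0 \<in> fst ?d"
    using chart_at_in chart_at_mem A B by blast+
  let ?Q = "family_domain ?c ?d \<epsilon> F" and ?\<Phi> = "family_rep ?c ?d F"
  have Q: "open ?Q" and \<Phi>: "smooth_on ?Q ?\<Phi>"
    using family_domain_open[OF A B family_continuous[OF A B F] c(1) d(1)] family_rep_smooth[OF A B F c(1) d(1)] .
  have \<Phi>S: "?\<Phi> ` ?Q \<subseteq> snd ?d ` fst ?d"
    by (auto simp: family_domain_def family_rep_def)
  have \<mu>: "smooth_bil (snd ?d ` fst ?d) (metric_rep B h ?d)"
    by (rule metric_rep_smooth_bil[OF B h d(1)])
  obtain U E where U: "open U" "p0 \<in> U" "U \<subseteq> fst ?c" "\<And>i. i < m \<Longrightarrow> continuous_on U (E i)"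
    "\<And>q. q \<in> U \<Longrightarrow> orthonormal_frame_at g H m q (\<lambda>i. from_components A ?c q (E i q))"
    using local_continuous_frame[OF A g H c] by metis
  \<comment> \<open>Family representations are ordered as (space, time), whereas here time comes
    first; the preimage performs the swap.\<close>
  let ?N = "(UNIV \<times> U) \<inter> (\<lambda>z. (snd ?c (snd z), fst z)) -` ?Q"
  define K where "K a b z = metric_rep B h ?d (?\<Phi> z) (sdir ?\<Phi> a z) (sdir ?\<Phi> b z)" for a b z
  have K: "smooth_on ?Q (K a b)" for a b
    unfolding K_def[abs_def]
    by (intro smooth_on_bil[OF chart_image_open[OF B d(1)] Q \<mu> \<Phi>S] \<Phi> sdir_smooth[OF Q \<Phi>])
  \<comment> \<open>Parametrised by \<open>k\<close> so that the density and its first two time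
    derivatives are instances of the same sum, with \<open>K\<close>, \<open>?K1\<close> and
    \<open>?K2\<close>.\<close>
  define J where "J k z = (\<Sum>i<m. \<Sum>a\<in>Basis. \<Sum>b\<in>Basis.
      ((E i (snd z) \<bullet> a) * (E i (snd z) \<bullet> b)) * k a b (snd ?c (snd z), fst z))"
    for k :: "'e \<Rightarrow> 'e \<Rightarrow> 'e \<times> real \<Rightarrow> real" and z
  let ?K1 = "\<lambda>a b z. fd (K a b) z (0, 1)" and ?K2 = "\<lambda>a b z. fd (\<lambda>z. fd (K a b) z (0, 1)) z (0, 1)"
  have chart: "continuous_on (UNIV \<times> U) (\<lambda>z. (snd ?c (snd z), fst z))"
    using U(3) by (intro continuous_intros continuous_on_compose2[OF chart_continuous[OF A c(1)]]) auto
  have N: "open ?N"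
    by (rule continuous_open_preimage[OF chart _ Q]) (simp add: open_Times U)
  have J: "continuous_on ?N (J k)" if k: "\<And>a b. smooth_on ?Q (k a b)" for k
    unfolding J_def[abs_def]
  proof (intro continuous_intros)
    fix i a b assume "i \<in> {..<m}"
    then show "continuous_on ?N (\<lambda>z. E i (snd z))"
      by (intro continuous_on_compose2[OF U(4)] continuous_intros) auto
    then show "continuous_on ?N (\<lambda>z. E i (snd z))" .
    show "continuous_on ?N (\<lambda>z. k a b (snd ?c (snd z), fst z))"
      by (rule continuous_on_compose2[OF smooth_on_continuous[OF k] continuous_on_subset[OF chart]]) auto
  qed
  have der: "((\<lambda>s. J k (s, q)) has_real_derivative J (\<lambda>a b z. fd (k a b) z (0, 1)) (s, q)) (at s)"
    if k: "\<And>a b. smooth_on ?Q (k a b)" and sq: "(s, q) \<in> ?N" for k s q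
  proof -
    have "((\<lambda>s. k a b (snd ?c q, s)) has_real_derivative fd (k a b) (snd ?c q, s) (0, 1)) (at s)" for a b
      using has_derivative_slice_time[OF k] sq by (simp add: has_real_derivative_iff_has_vector_derivative)
    then show ?thesis
      unfolding J_def fst_conv snd_conv
      by (intro DERIV_sum DERIV_cmult) 
  qed
  have eq: "hor_density s q = J K (s, q)" if sq: "(s, q) \<in> ?N" for s q
  proof -
    have q: "q \<in> U" "q \<in> fst ?c" "(snd ?c q, s) \<in> ?Q"
      using sq U(3) by auto
    then have s: "\<bar>s\<bar> < \<epsilon>" "F s q \<in> fst ?d"
      by (simp_all add: family_domain_def chart_inv_chart[OF A c(1)])
    let ?z = "(snd ?c q, s)"
    have bil: "bilinear (metric_rep B h ?d (?\<Phi> ?z))"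
      using \<mu> \<Phi>S q by (auto simp: smooth_bil_def)
    have "linear (\<lambda>v::'e. (v, 0::real))"
      by (simp add: linear_iff)
    from linear_compose[OF this fd_linear_in[OF \<Phi> q(3)]]
    have lin: "linear (\<lambda>v. sdir ?\<Phi> v ?z)"
      by (simp add: sdir_def o_def)
    have "bilinear (\<lambda>u w. K u w ?z)"
      unfolding bilinear_def K_def
      by (auto intro!: linearI simp: linear_add[OF lin] linear_cmul[OF lin] bilinear_ladd[OF bil]
          bilinear_radd[OF bil] bilinear_lmul[OF bil] bilinear_rmul[OF bil])
    then have "K (E i q) (E i q) ?z
        = (\<Sum>a\<in>Basis. \<Sum>b\<in>Basis. ((E i q \<bullet> a) * (E i q \<bullet> b)) * K a b ?z)" for i
      using bilinear_basis_sum[of "\<lambda>u w. K u w ?z" "E i q" "E i q"] by simp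
    moreover have "hor_density s q = (\<Sum>i<m. K (E i q) (E i q) ?z)"
      unfolding density_rep[OF s(1) c(1) q(2) d(1) s(2) U(5)[OF q(1)]] K_def
      by (simp add: components_from_components[OF A c(1) q(2)])
    ultimately show ?thesis
      by (simp add: J_def)
  qed
  have p0: "(t0, p0) \<in> ?N"
    using t0 c d U by (simp add: family_domain_def chart_inv_chart[OF A])
  have sub: "?N \<subseteq> {-\<epsilon><..<\<epsilon>} \<times> UNIV"
    by (auto simp: family_domain_def)
  have K1: "smooth_on ?Q (?K1 a b)" and K2: "smooth_on ?Q (?K2 a b)" for a b
    by (intro smooth_on_fd Q K)+
  show ?thesis
    by (intro exI[of _ ?N] exI[of _ "J K"] exI[of _ "J ?K1"] exI[of _ "J ?K2"] conjI allI impI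
        N p0 sub J[OF K] J[OF K1] J[OF K2] eq der[OF K] der[OF K1])
qed

lemmas density_C1 = C1_in_time_local[of \<epsilon> hor_density, OF density_local]

section \<open>Pointwise first and second variation of the energy density\<close>

context
  fixes nabla D
  assumes \<epsilon>: "\<epsilon> > 0" and lc: "levi_civita_connection B h nabla" and D: "pullback_connection A B (F 0) nabla D"
begin

text \<open>Velocity and acceleration are represented on space-time; their slice at time 0
  represents a section, and a space derivative of the slice is a space-time derivative in a
  direction \<open>(v, 0)\<close>.\<close>

lemma D_of_rep:
  assumes W: "W \<in> sections A B (F 0)"
    and R: "smooth_on (family_domain (chart_at A p) (chart_at B (F 0 p)) \<epsilon> F) R"
    and rep: "\<And>q. q \<in> fst (chart_at A p) \<Longrightarrow> F 0 q \<in> fst (chart_at B (F 0 p)) \<Longrightarrow>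
      components B (chart_at B (F 0 p)) (F 0 q) (W q) = R (snd (chart_at A p) q, 0)"
  shows "D p v W = fd R (snd (chart_at A p) p, 0) (v, 0)
    + christoffel B nabla (chart_at B (F 0 p)) (snd (chart_at B (F 0 p)) (F 0 p))
        (differential A B (F 0) p v) (W p)"
proof -
  let ?c = "chart_at A p" and ?d = "chart_at B (F 0 p)"
  have c: "?c \<in> A" "p \<in> fst ?c" and d: "?d \<in> B" "F 0 p \<in> fst ?d"
    using chart_at_in chart_at_mem A B by blast+
  have f: "smooth_map A B (F 0)"
    using \<epsilon> by (intro family_smooth_map[OF A B F]) simp
  let ?S = "snd ?c ` (fst ?c \<inter> F 0 -` fst ?d)"
  have S: "open ?S" "snd ?c p \<in> ?S"
    using local_domain_open[OF A c(1) smooth_map_continuous[OF A B f] chart_open[OF B d(1)]] c d by auto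
  have z: "(snd ?c p, 0) \<in> family_domain ?c ?d \<epsilon> F"
    using c d \<epsilon> by (simp add: family_domain_def chart_inv_chart[OF A])
  have "fd (\<lambda>x. components B ?d (F 0 (chart_inv ?c x)) (W (chart_inv ?c x))) (snd ?c p)
      = fd (\<lambda>x. R (x, 0)) (snd ?c p)"
    by (rule fd_cong[OF S]) (auto simp: chart_inv_chart[OF A c(1)] rep)
  then have "fd (\<lambda>x. components B ?d (F 0 (chart_inv ?c x)) (W (chart_inv ?c x))) (snd ?c p) v
      = fd R (snd ?c p, 0) (v, 0)"
    using fd_slice_space[OF R z] by simp
  then show ?thesis
    using pullback_components[OF A B f lc_affine[OF B h lc] D c d W, of v]
    by (simp add: components_chart_at[OF A] components_chart_at[OF B])
qed

text \<open>In the preferred charts at \<open>p\<close> and \<open>F 0 p\<close> components are the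
  vectors themselves, so the coordinate identities at time 0 read directly as intrinsic
  ones.\<close>

lemma density_variations:
  assumes e: "orthonormal_frame_at g H m p e"
  shows "deriv (\<lambda>t. hor_density t p) 0 = 2 * (\<Sum>i<m. h (F 0 p) (D p (e i) (variation_field B F))
      (differential A B (F 0) p (e i)))"
    and "deriv (\<lambda>r. deriv (\<lambda>t. hor_density t p) r) 0 =
      2 * ((\<Sum>i<m. h (F 0 p) (D p (e i) (acceleration B nabla F)) (differential A B (F 0) p (e i)))
        + (\<Sum>i<m. h (F 0 p) (D p (e i) (variation_field B F)) (D p (e i) (variation_field B F)))
        - (\<Sum>i<m. h (F 0 p) (curvature_tensor B nabla (F 0 p)
            (differential A B (F 0) p (e i)) (variation_field B F p) (variation_field B F p))
            (differential A B (F 0) p (e i))))"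
proof -
  let ?V = "variation_field B F"
  let ?c = "chart_at A p" and ?d = "chart_at B (F 0 p)"
  have c: "?c \<in> A" "p \<in> fst ?c" and d: "?d \<in> B" "F 0 p \<in> fst ?d"
    using chart_at_in chart_at_mem A B by blast+
  let ?Q = "family_domain ?c ?d \<epsilon> F" and ?\<Phi> = "family_rep ?c ?d F" and ?x = "snd ?c p"
    and ?S = "snd ?d ` fst ?d" and ?G = "christoffel B nabla ?d" and ?\<mu> = "metric_rep B h ?d"
  note aff = lc_affine[OF B h lc]
  have Q: "open ?Q" and \<Phi>: "smooth_on ?Q ?\<Phi>"
    using family_domain_open[OF A B family_continuous[OF A B F] c(1) d(1)] family_rep_smooth[OF A B F c(1) d(1)] .
  have \<Phi>S: "?\<Phi> ` ?Q \<subseteq> ?S"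
    by (auto simp: family_domain_def family_rep_def)
  have S: "open ?S"
    by (rule chart_image_open[OF B d(1)])
  have \<mu>: "smooth_bil ?S ?\<mu>"
    by (rule metric_rep_smooth_bil[OF B h d(1)])
  have G: "smooth_bil ?S ?G"
    by (rule christoffel_smooth_bil[OF B aff d(1)])
  have G_sym: "?G x u w = ?G x w u" if "x \<in> ?S" for x u w
    by (rule christoffel_symmetric[OF B h lc d(1) that])
  have \<mu>_sym: "?\<mu> x u w = ?\<mu> x w u" for x u w
    using h by (simp add: metric_rep_def riemannian_metric_def)
  have compat: "fd (\<lambda>y. ?\<mu> y u w) x z = ?\<mu> x (?G x z u) w + ?\<mu> x u (?G x z w)" if "x \<in> ?S" for x u w z
    by (rule metric_rep_compatible[OF B h lc d(1) that])
  let ?N = "\<lambda>v z. ?\<mu> (?\<Phi> z) (cov_vel ?\<Phi> ?G v z) (sdir ?\<Phi> v z)"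
  let ?P = "\<lambda>v z. ?\<mu> (?\<Phi> z) (sdir ?\<Phi> v z) (sdir ?\<Phi> v z)"
  have N: "smooth_on ?Q (?N v)" and P: "smooth_on ?Q (?P v)" for v
    by (intro smooth_on_bil[OF S Q \<mu> \<Phi>S] \<Phi> sdir_smooth[OF Q \<Phi>] cov_vel_smooth[OF Q \<Phi> S \<Phi>S G])+
  let ?N' = "\<lambda>v. ?\<mu> (?\<Phi> (?x, 0)) (cov_vel ?\<Phi> ?G v (?x, 0)) (cov_vel ?\<Phi> ?G v (?x, 0))"
  let ?I = "{t. (?x, t) \<in> ?Q}"
  have "open ((\<lambda>t. (?x, t)) -` ?Q)"
    by (rule open_vimage[OF Q]) (intro continuous_intros)
  then have I: "open ?I" "0 \<in> ?I"
    using c d \<epsilon> by (simp_all add: vimage_def family_domain_def chart_inv_chart[OF A])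
  have slice: "((\<lambda>t. \<Sum>i<m. k (e i) (?x, t)) has_real_derivative (\<Sum>i<m. fd (k (e i)) (?x, t) (0, 1))) (at t)"
    if "\<And>v. smooth_on ?Q (k v)" "t \<in> ?I" for k :: "'e \<Rightarrow> 'e \<times> real \<Rightarrow> real" and t
    using has_derivative_slice_time[OF that(1)] that(2)
    by (intro DERIV_sum) (simp add: has_real_derivative_iff_has_vector_derivative)
  have eq: "hor_density t p = (\<Sum>i<m. ?P (e i) (?x, t))" if "t \<in> ?I" for t
    using density_rep[OF _ c d(1) _ e, of t] that
    by (simp add: family_domain_def chart_inv_chart[OF A c] components_chart_at[OF A])
  have fdP: "fd (?P v) z (0, 1) = 2 * ?N v z" if "z \<in> ?Q" for v z
    by (rule fd_energy_density[OF Q \<Phi> S \<Phi>S G \<mu>]) (erule G_sym | rule \<mu>_sym | erule compat | rule that)+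
  have d1: "((\<lambda>t. hor_density t p) has_real_derivative 2 * (\<Sum>i<m. ?N (e i) (?x, t))) (at t)" if t: "t \<in> ?I"
      for t
    using has_field_derivative_transform_within_open[OF slice[OF P t] I(1) t eq[symmetric]] t
    by (simp add: fdP sum_distrib_left)
  \<comment> \<open>The formula is recorded on a whole open time interval, as it has to be
    differentiated again at 0.\<close>
  then have d1': "deriv (\<lambda>t. hor_density t p) t = 2 * (\<Sum>i<m. ?N (e i) (?x, t))" if "t \<in> ?I" for t
    using that DERIV_imp_deriv by blast
  have d2: "((\<lambda>r. deriv (\<lambda>t. hor_density t p) r) has_real_derivative 2 * (\<Sum>i<m. fd (?N (e i)) (?x, 0) (0, 1))) (at 0)"
    by (rule has_field_derivative_transform_within_open[OF DERIV_cmult[OF slice[OF N I(2)]] I])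
      (simp add: d1')
  have z: "(?x, 0) \<in> ?Q"
    using I(2) by simp
  have \<Phi>0: "?\<Phi> (?x, 0) = snd ?d (F 0 p)"
    using c by (simp add: family_rep_def chart_inv_chart[OF A])
  have met: "?\<mu> (snd ?d (F 0 p)) u w = h (F 0 p) u w" for u w
    using metric_rep_components[OF B d, of h u w] by (simp add: components_chart_at[OF B])
  have sd: "sdir ?\<Phi> v (?x, 0) = differential A B (F 0) p v" for v
    using family_differential[OF A B F _ c d, of v] \<epsilon>
    by (simp add: sdir_def components_chart_at[OF A] components_chart_at[OF B])
  have vel: "vel ?\<Phi> (?x, 0) = ?V p"
    using components_variation_field[OF A B F \<epsilon> c(1) d(1) c(2) d(2)] by (simp add: components_chart_at[OF B])
  have acc: "acc ?\<Phi> ?G (?x, 0) = acceleration B nabla F p"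
    using components_acceleration[OF A B F \<epsilon> c(1) d(1) c(2) d(2) aff] by (simp add: components_chart_at[OF B])
  have DV: "D p v ?V = cov_vel ?\<Phi> ?G v (?x, 0)" for v
  proof -
    have "D p v ?V = fd (vel ?\<Phi>) (?x, 0) (v, 0) + ?G (snd ?d (F 0 p)) (differential A B (F 0) p v) (?V p)"
      by (rule D_of_rep[OF variation_field_section[OF A B F \<epsilon>] vel_smooth[OF Q \<Phi>]])
        (rule components_variation_field[OF A B F \<epsilon> c(1) d(1)])
    then show ?thesis
      by (simp add: cov_vel_def sd vel \<Phi>0)
  qed
  have Da: "D p v (acceleration B nabla F)
      = fd (acc ?\<Phi> ?G) (?x, 0) (v, 0) + ?G (?\<Phi> (?x, 0)) (sdir ?\<Phi> v (?x, 0)) (acc ?\<Phi> ?G (?x, 0))" for v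
  proof -
    have "D p v (acceleration B nabla F) = fd (acc ?\<Phi> ?G) (?x, 0) (v, 0)
        + ?G (snd ?d (F 0 p)) (differential A B (F 0) p v) (acceleration B nabla F p)"
      by (rule D_of_rep[OF acceleration_section[OF A B F \<epsilon> aff] acc_smooth[OF Q \<Phi> S \<Phi>S G]])
        (rule components_acceleration[OF A B F \<epsilon> c(1) d(1) _ _ aff])
    then show ?thesis
      by (simp add: sd acc \<Phi>0)
  qed
  have curv: "curvature_rep ?G (snd ?d (F 0 p)) u v w = curvature_tensor B nabla (F 0 p) u v w" for u v w
    using curvature_tensor_components[OF B h lc d, of u v w] by (simp add: components_chart_at[OF B])
  show "deriv (\<lambda>t. hor_density t p) 0 = 2 * (\<Sum>i<m. h (F 0 p) (D p (e i) ?V) (differential A B (F 0) p (e i)))"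
    using d1'[OF I(2)] by (simp add: DV \<Phi>0 met sd)
  have fdN: "fd (?N v) (?x, 0) (0, 1) = ?\<mu> (?\<Phi> (?x, 0)) (fd (acc ?\<Phi> ?G) (?x, 0) (v, 0)
        + ?G (?\<Phi> (?x, 0)) (sdir ?\<Phi> v (?x, 0)) (acc ?\<Phi> ?G (?x, 0))) (sdir ?\<Phi> v (?x, 0))
      + ?N' v - ?\<mu> (?\<Phi> (?x, 0)) (curvature_rep ?G (?\<Phi> (?x, 0)) (sdir ?\<Phi> v (?x, 0)) (vel ?\<Phi> (?x, 0))
          (vel ?\<Phi> (?x, 0))) (sdir ?\<Phi> v (?x, 0))" for v
    by (rule fd_fd_energy_density[OF Q \<Phi> S \<Phi>S G \<mu>]) (erule G_sym | rule \<mu>_sym | erule compat | rule z)+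
  have "fd (?N v) (?x, 0) (0, 1) =
      h (F 0 p) (D p v (acceleration B nabla F)) (differential A B (F 0) p v) + h (F 0 p) (D p v ?V) (D p v ?V)
      - h (F 0 p) (curvature_tensor B nabla (F 0 p) (differential A B (F 0) p v) (?V p) (?V p))
          (differential A B (F 0) p v)"
    for v
    unfolding fdN Da[symmetric] DV[symmetric] by (simp only: \<Phi>0 met sd vel curv)
  then show "deriv (\<lambda>r. deriv (\<lambda>t. hor_density t p) r) 0 =
      2 * ((\<Sum>i<m. h (F 0 p) (D p (e i) (acceleration B nabla F)) (differential A B (F 0) p (e i)))
        + (\<Sum>i<m. h (F 0 p) (D p (e i) ?V) (D p (e i) ?V))
        - (\<Sum>i<m. h (F 0 p) (curvature_tensor B nabla (F 0 p) (differential A B (F 0) p (e i)) (?V p) (?V p))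
            (differential A B (F 0) p (e i))))"
    using DERIV_imp_deriv[OF d2] by (simp add: sum.distrib sum_subtractf)
qed

end

end

end

section \<open>Variations with prescribed localized variation field\<close>

context
  fixes A :: "('a::{t2_space,second_countable_topology}, 'e::euclidean_space) chart set"
    and B :: "('b::{t2_space,second_countable_topology}, 'n::euclidean_space) chart set"
    and f :: "'a \<Rightarrow> 'b" and c' U K \<psi> W and x0 :: 'n and r :: real
  assumes A: "smooth_manifold A" and B: "smooth_manifold B" and f: "smooth_map A B f"
    and compact: "compact (UNIV :: 'a set)"
    and bump: "bump_in B c' U K \<psi>" and r: "r > 0" "cball x0 (3 * r) \<subseteq> snd c' ` fst c'"
    and K: "snd c' ` K \<subseteq> cball x0 (2 * r)" and W: "W \<in> sections A B f"
begin

definition cut_rep :: "'a \<Rightarrow> 'n" where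
  "cut_rep p = \<psi> (f p) *\<^sub>R components B c' (f p) (W p)"

text \<open>Straight-line motion inside the chart \<open>c'\<close>, with the constant map outside
  its domain. Both agree off \<open>K\<close>, where the displacement is zero.\<close>

definition cut_family :: "real \<Rightarrow> 'a \<Rightarrow> 'b" where
  "cut_family t p = (if f p \<in> fst c' then chart_inv c' (snd c' (f p) + t *\<^sub>R cut_rep p) else f p)"

lemma c'_in: "c' \<in> B" and K_closed: "closed K" and K_sub: "K \<subseteq> fst c'" and off_K: "q \<notin> K \<Longrightarrow> \<psi> q = 0"
  using bump by (auto simp: bump_in_def)

lemma cut_rep_smooth:
  assumes c: "c \<in> A"
  shows "smooth_on (snd c ` fst c) (\<lambda>x. cut_rep (chart_inv c x))"
proof (rule smooth_on_cong[OF chart_image_open[OF A c]])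
  show "(\<Sum>b\<in>Basis. (\<psi> (f (chart_inv c x)) * (components B c' (f (chart_inv c x)) (W (chart_inv c x)) \<bullet> b)) *\<^sub>R b)
    = cut_rep (chart_inv c x)" for x
    using euclidean_representation[of "cut_rep (chart_inv c x)"] by (simp add: cut_rep_def)
  have "smooth_on (snd c ` fst c) (\<lambda>x. \<psi> (f (chart_inv c x)) *
      (components B c' (f (chart_inv c x)) (W (chart_inv c x)) \<bullet> b))" for b
    using cutoff_component_smooth[OF A B f bump W, of b] c by (simp add: smooth_fun_def o_def)
  then show "smooth_on (snd c ` fst c) (\<lambda>x. \<Sum>b\<in>Basis.
      (\<psi> (f (chart_inv c x)) * (components B c' (f (chart_inv c x)) (W (chart_inv c x)) \<bullet> b)) *\<^sub>R b)"
    by (intro smooth_on_sum smooth_on_scaleR smooth_on_const chart_image_open[OF A c])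
qed

lemma cut_rep_continuous: "continuous_on UNIV cut_rep"
proof -
  have "continuous_on UNIV (\<lambda>p. \<Sum>b\<in>Basis. (\<psi> (f p) * (components B c' (f p) (W p) \<bullet> b)) *\<^sub>R b)"
    by (intro continuous_on_sum continuous_on_scaleR continuous_on_const
        smooth_fun_continuous[OF A cutoff_component_smooth[OF A B f bump W]])
  moreover have "(\<Sum>b\<in>Basis. (\<psi> (f p) * (components B c' (f p) (W p) \<bullet> b)) *\<^sub>R b) = cut_rep p" for p
    using euclidean_representation[of "cut_rep p"] by (simp add: cut_rep_def)
  ultimately show ?thesis
    by simp
qed

text \<open>Compactness of the source bounds the displacement, so a single time interval works for
  all points.\<close>

lemma cut_radius:
  obtains \<epsilon> where "\<epsilon> > 0" "\<And>t p. \<bar>t\<bar> < \<epsilon> \<Longrightarrow> f p \<in> fst c' \<Longrightarrow> snd c' (f p) + t *\<^sub>R cut_rep p \<in> snd c' ` fst c'"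
proof -
  have "compact (range cut_rep)"
    using cut_rep_continuous compact by (rule compact_continuous_image)
  then obtain C where "\<forall>y\<in>range cut_rep. norm y \<le> C"
    by (meson bounded_iff compact_imp_bounded)
  then have C: "norm (cut_rep p) \<le> C" for p
    by simp
  then have C0: "0 \<le> C"
    using norm_ge_zero order_trans by blast
  show ?thesis
  \<comment> \<open>Within this time a point moves by at most \<open>r\<close>: points of
    \<open>K\<close> start within radius \<open>2 * r\<close> and stay within \<open>3 * r\<close>,
    while other points do not move. The summand 1 covers \<open>C = 0\<close>.\<close>
  proof (rule that[of "r / (C + 1)"])
    show "r / (C + 1) > 0"
      using r C0 by simp
    fix t p assume t: "\<bar>t\<bar> < r / (C + 1)" and p: "f p \<in> fst c'"
    show "snd c' (f p) + t *\<^sub>R cut_rep p \<in> snd c' ` fst c'"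
    proof (cases "f p \<in> K")
      case True
      have "norm (t *\<^sub>R cut_rep p) \<le> r / (C + 1) * (C + 1)"
        unfolding norm_scaleR using t C[of p] C0 by (intro mult_mono) auto
      then have "norm (t *\<^sub>R cut_rep p) \<le> r"
        using C0 by simp
      moreover have "dist x0 (snd c' (f p)) \<le> 2 * r"
        using K True by auto
      ultimately have "dist x0 (snd c' (f p) + t *\<^sub>R cut_rep p) \<le> 3 * r"
        using norm_triangle_ineq4[of "x0 - snd c' (f p)" "t *\<^sub>R cut_rep p"] by
            (simp add: dist_norm algebra_simps)
      then show ?thesis
        using r(2) by auto
    next
      case False
      then show ?thesis
        using p off_K by (simp add: cut_rep_def)
    qed
  qed
qed

lemma cut_family_off_K: "f p \<notin> K \<Longrightarrow> cut_family t p = f p"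
  using off_K by (simp add: cut_family_def cut_rep_def chart_inv_chart[OF B c'_in])

lemma cut_family_zero: "cut_family 0 = f"
  by (intro ext) (simp add: cut_family_def chart_inv_chart[OF B c'_in])

context
  fixes \<epsilon> :: real
  assumes \<epsilon>: "\<epsilon> > 0"
    and stay: "\<And>t p. \<bar>t\<bar> < \<epsilon> \<Longrightarrow> f p \<in> fst c' \<Longrightarrow> snd c' (f p) + t *\<^sub>R cut_rep p \<in> snd c' ` fst c'"
begin

text \<open>The preimages of the chart domain and of the complement of \<open>K\<close> are open and
  cover the source; on the first the affine formula holds, on the second the family is constant in
  time.\<close>

lemma cut_family_continuous: "continuous_on (UNIV \<times> {-\<epsilon><..<\<epsilon>}) (\<lambda>(p, t). cut_family t p)"
proof -
  have fc: "continuous_on UNIV f"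
    by (rule smooth_map_continuous[OF A B f])
  let ?P = "f -` fst c'" and ?R = "f -` (- K)" and ?I = "{-\<epsilon><..<\<epsilon>}"
  have o: "open (?P \<times> ?I)" "open (?R \<times> ?I)"
    using chart_open[OF B c'_in] K_closed fc by (auto intro!: open_Times open_vimage)
  have inP: "snd c' (f (fst z)) + snd z *\<^sub>R cut_rep (fst z) \<in> snd c' ` fst c'" if "z \<in> ?P \<times> ?I" for z
    using that by (intro stay) auto
  have "continuous_on (?P \<times> ?I) (\<lambda>z. chart_inv c' (snd c' (f (fst z)) + snd z *\<^sub>R cut_rep (fst z)))"
    by (intro continuous_on_compose2[OF chart_inv_continuous[OF B c'_in]] continuous_intros
        continuous_on_compose2[OF chart_continuous[OF B c'_in]] continuous_on_compose2[OF fc]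
        continuous_on_compose2[OF cut_rep_continuous]) (use inP in auto)
  then have 1: "continuous_on (?P \<times> ?I) (\<lambda>(p, t). cut_family t p)"
    by (rule continuous_on_eq) (auto simp: cut_family_def)
  have "continuous_on (?R \<times> ?I) (\<lambda>z. f (fst z))"
    by (intro continuous_on_compose2[OF fc] continuous_intros) auto
  then have 2: "continuous_on (?R \<times> ?I) (\<lambda>(p, t). cut_family t p)"
    by (rule continuous_on_eq) (auto simp: cut_family_off_K)
  have "?P \<times> ?I \<union> ?R \<times> ?I = UNIV \<times> ?I"
    using K_sub by auto
  then show ?thesis
    using continuous_on_open_Un[OF o 1 2] by simp
qed

lemma cut_family_smooth: "smooth_family A B \<epsilon> cut_family"
proof (rule smooth_familyI[OF A B cut_family_continuous])
  fix c d assume c: "c \<in> A" "d \<in> B"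
  let ?Q = "family_domain c d \<epsilon> cut_family"
  have Q: "open ?Q"
    by (rule family_domain_open[OF A B cut_family_continuous c])
  have fc: "continuous_on UNIV f"
    by (rule smooth_map_continuous[OF A B f])
  show "smooth_on ?Q (family_rep c d cut_family)"
  proof (rule smooth_on_local)
    fix z assume z: "z \<in> ?Q"
    then have z': "fst z \<in> snd c ` fst c" "\<bar>snd z\<bar> < \<epsilon>"
      by (auto simp: family_domain_def)
    show "\<exists>T. open T \<and> z \<in> T \<and> smooth_on T (family_rep c d cut_family)"
    \<comment> \<open>Smoothness uses the same two regions: the affine formula followed by a
      transition map, or the unmoved map \<open>f\<close> near points whose image is off
      \<open>K\<close>.\<close>
    proof (cases "f (chart_inv c (fst z)) \<in> fst c'")
      case True
      let ?D = "snd c ` (fst c \<inter> f -` fst c')"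
      have D: "open ?D"
        by (rule local_domain_open[OF A c(1) fc chart_open[OF B c'_in]])
      let ?T = "?Q \<inter> (?D \<times> UNIV)"
      have T: "open ?T"
        using Q D by (simp add: open_Int open_Times)
      have zT: "z \<in> ?T"
        using z z' True chart_inv_in[OF z'(1)] chart_chart_inv[OF z'(1)]
        by (cases z) (auto intro!: image_eqI[of _ "snd c" "chart_inv c (fst z)"])
      let ?y = "\<lambda>z. snd c' (f (chart_inv c (fst z))) + snd z *\<^sub>R cut_rep (chart_inv c (fst z))"
      have fstT: "fst ` ?T \<subseteq> ?D" "fst ` ?T \<subseteq> snd c ` fst c"
        by auto
      have sm_fst: "smooth_on ?T fst" and sm_snd: "smooth_on ?T snd"
        by (intro smooth_on_bounded_linear bounded_linear_fst bounded_linear_snd)+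
      have y: "smooth_on ?T ?y"
      proof (intro smooth_on_add smooth_on_scaleR T sm_snd)
        show "smooth_on ?T (\<lambda>z. snd c' (f (chart_inv c (fst z))))"
          by (rule smooth_on_compose[OF T D fstT(1) sm_fst smooth_map_local_smooth[OF A B f c(1) c'_in]])
        show "smooth_on ?T (\<lambda>z. cut_rep (chart_inv c (fst z)))"
          by (rule smooth_on_compose[OF T chart_image_open[OF A c(1)] fstT(2) sm_fst cut_rep_smooth[OF c(1)]])
      qed
      have in_domain: "?y z \<in> snd c' ` fst c'" "chart_inv c' (?y z) \<in> fst d"
        "family_rep c d cut_family z = snd d (chart_inv c' (?y z))" if "z \<in> ?T" for z
      proof -
        from that have "z \<in> ?Q" and "fst z \<in> ?D"
          by auto
        then have q: "\<bar>snd z\<bar> < \<epsilon>" "cut_family (snd z) (chart_inv c (fst z)) \<in> fst d" "f (chart_inv c (fst z)) \<in> fst c'"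
          by (auto simp: family_domain_def chart_inv_chart[OF A c(1)])
        then show "?y z \<in> snd c' ` fst c'"
          by (intro stay)
        show "chart_inv c' (?y z) \<in> fst d" "family_rep c d cut_family z = snd d (chart_inv c' (?y z))"
          using q by (simp_all add: cut_family_def family_rep_def)
      qed
      have S: "open (snd c' ` (fst c' \<inter> fst d))"
        using chart_open[OF B c'_in] chart_open[OF B c(2)] by (intro open_chart_image[OF B c'_in]) auto
      have yS: "?y ` ?T \<subseteq> snd c' ` (fst c' \<inter> fst d)"
      proof (rule image_subsetI)
        fix z assume z: "z \<in> ?T"
        show "?y z \<in> snd c' ` (fst c' \<inter> fst d)"
          using in_domain(2)[OF z] chart_inv_in[OF in_domain(1)[OF z]] chart_chart_inv[OF in_domain(1)[OF z]]
          by (intro image_eqI[of _ _ "chart_inv c' (?y z)"]) auto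
      qed
      have "smooth_on ?T (\<lambda>z. snd d (chart_inv c' (?y z)))"
        by (rule smooth_on_compose[OF T S yS y transition_smooth[OF B c'_in c(2)]])
      then have "smooth_on ?T (family_rep c d cut_family)"
        by (rule smooth_on_cong[OF T, rotated]) (rule in_domain(3)[symmetric])
      then show ?thesis
        using T zT by blast
    next
      case False
      then have nK: "f (chart_inv c (fst z)) \<notin> K"
        using K_sub by blast
      let ?D = "snd c ` (fst c \<inter> f -` (- K))" and ?D' = "snd c ` (fst c \<inter> f -` fst d)"
      have D: "open ?D" "open ?D'"
        using local_domain_open[OF A c(1) fc] K_closed chart_open[OF B c(2)] by (simp_all add: open_Compl)
      let ?T = "?Q \<inter> (?D \<times> UNIV)"
      have T: "open ?T"
        using Q D by (simp add: open_Int open_Times)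
      have zT: "z \<in> ?T"
        using z z' nK chart_inv_in[OF z'(1)] chart_chart_inv[OF z'(1)]
        by (cases z) (auto intro!: image_eqI[of _ "snd c" "chart_inv c (fst z)"])
      have same: "cut_family (snd z) (chart_inv c (fst z)) = f (chart_inv c (fst z))" if "z \<in> ?T" for z
        using that by (intro cut_family_off_K) (auto simp: chart_inv_chart[OF A c(1)])
      have sub: "fst ` ?T \<subseteq> ?D'"
      proof (rule image_subsetI)
        fix z assume z: "z \<in> ?T"
        then have x: "fst z \<in> snd c ` fst c" and fd: "f (chart_inv c (fst z)) \<in> fst d"
          using same[OF z] by (auto simp: family_domain_def)
        show "fst z \<in> ?D'"
          using fd chart_inv_in[OF x] chart_chart_inv[OF x]
              by (intro image_eqI[of _ _ "chart_inv c (fst z)"]) auto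
      qed
      have "smooth_on ?T (\<lambda>z. snd d (f (chart_inv c (fst z))))"
        by (rule smooth_on_compose[OF T D(2) sub _ smooth_map_local_smooth[OF A B f c]])
          (intro smooth_on_bounded_linear bounded_linear_fst)
      then have "smooth_on ?T (family_rep c d cut_family)"
        by (rule smooth_on_cong[OF T, rotated]) (simp only: family_rep_def same)
      then show ?thesis
        using T zT by blast
    qed
  qed
qed

lemma cut_family_variation_field: "variation_field B cut_family = (\<lambda>p. \<psi> (f p) *\<^sub>R W p)"
proof
  fix p
  show "variation_field B cut_family p = \<psi> (f p) *\<^sub>R W p"
  proof (cases "f p \<in> fst c'")
    case True
    let ?c = "chart_at A p"
    have c: "?c \<in> A" "p \<in> fst ?c"
      using chart_at_in chart_at_mem A by blast+
    have p: "cut_family 0 p \<in> fst c'"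
      using True by (simp add: cut_family_zero)
    let ?\<Phi> = "family_rep ?c c' cut_family" and ?x = "snd ?c p"
    have "((\<lambda>t. ?\<Phi> (?x, t)) has_vector_derivative fd ?\<Phi> (?x, 0) (0, 1)) (at 0)"
      by (rule has_derivative_slice_time[OF family_rep_smooth[OF A B cut_family_smooth c(1) c'_in]
            family_zero_domain[OF A B cut_family_smooth \<epsilon> c(1) c'_in c(2) p]])
    moreover have "((\<lambda>t. ?\<Phi> (?x, t)) has_vector_derivative cut_rep p) (at 0)"
    proof (rule has_vector_derivative_transform_within_open)
      show "((\<lambda>t. snd c' (f p) + t *\<^sub>R cut_rep p) has_vector_derivative cut_rep p) (at 0)"
        by (auto intro!: derivative_eq_intros)
      show "open {-\<epsilon><..<\<epsilon>}" "0 \<in> {-\<epsilon><..<\<epsilon>}"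
        using \<epsilon> by auto
      show "snd c' (f p) + t *\<^sub>R cut_rep p = ?\<Phi> (?x, t)" if "t \<in> {-\<epsilon><..<\<epsilon>}" for t
        using chart_chart_inv[OF stay[of t p]] that True c
        by (auto simp: family_rep_def cut_family_def chart_inv_chart[OF A])
    qed
    ultimately have "vel ?\<Phi> (?x, 0) = cut_rep p"
      unfolding vel_def by (rule vector_derivative_unique_at)
    then have "components B c' (f p) (variation_field B cut_family p) = components B c' (f p) (\<psi> (f p) *\<^sub>R W p)"
      using components_variation_field[OF A B cut_family_smooth \<epsilon> c(1) c'_in c(2) p]
      by (simp add: cut_family_zero cut_rep_def linear_cmul[OF components_linear[OF B c'_in True]])
    then show ?thesis
      by (rule components_inj[OF B c'_in True])
  next
    case False
    then have "\<psi> (f p) = 0"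
      using off_K K_sub by blast
    then show ?thesis
      using False by (simp add: variation_field_def cut_family_def)
  qed
qed

end

lemma cut_family_exists:
  obtains \<epsilon> G where "\<epsilon> > 0" "smooth_family A B \<epsilon> G" "G 0 = f" "variation_field B G = (\<lambda>p. \<psi> (f p) *\<^sub>R W p)"
proof -
  obtain \<epsilon> where \<epsilon>: "\<epsilon> > 0"
    "\<And>t p. \<bar>t\<bar> < \<epsilon> \<Longrightarrow> f p \<in> fst c' \<Longrightarrow> snd c' (f p) + t *\<^sub>R cut_rep p \<in> snd c' ` fst c'"
    by (rule cut_radius) (rule that)
  show ?thesis
    by (rule that[OF \<epsilon>(1) cut_family_smooth[OF \<epsilon>] cut_family_zero cut_family_variation_field[OF \<epsilon>]])
qed

end

section \<open>Energy variations\<close>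

context
  fixes A :: "('a::{t2_space,second_countable_topology}, 'e::euclidean_space) chart set"
    and g :: "'a \<Rightarrow> 'e \<Rightarrow> 'e \<Rightarrow> real" and H :: "'a \<Rightarrow> 'e set" and m :: nat
    and B :: "('b::{t2_space,second_countable_topology}, 'n::euclidean_space) chart set"
    and h :: "'b \<Rightarrow> 'n \<Rightarrow> 'n \<Rightarrow> real" and nabla and f :: "'a \<Rightarrow> 'b"
    and D :: "'a \<Rightarrow> 'e \<Rightarrow> ('a \<Rightarrow> 'n) \<Rightarrow> 'n" and dv :: "'a measure" and e :: "'a \<Rightarrow> nat \<Rightarrow> 'e"
  assumes A: "smooth_manifold A" and g: "riemannian_metric A g" and H: "smooth_subbundle A H m"
    and B: "smooth_manifold B" and h: "riemannian_metric B h" and compact: "compact (UNIV :: 'a set)"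
    and fin: "finite_measure dv" and borel: "sets dv = sets borel"
    and lc: "levi_civita_connection B h nabla" and D: "pullback_connection A B f nabla D"
    and e: "\<And>p. orthonormal_frame_at g H m p (e p)"
begin

abbreviation (input) energy :: "('a \<Rightarrow> 'b) \<Rightarrow> real" where
  "energy \<equiv> exp_energy A g H m dv B h"

text \<open>The integrand of the first variation, defined for every section \<open>W\<close> and
  additive in it, whether or not \<open>W\<close> is known to come from a family.\<close>

definition variation_density :: "('a \<Rightarrow> 'n) \<Rightarrow> 'a \<Rightarrow> real" where
  "variation_density W p = exp (hor_norm_sq A g H m B h f p / 2) *
     (\<Sum>i<m. h (f p) (D p (e p i) W) (differential A B f p (e p i)))"

lemma energy_derivatives:
  assumes F: "smooth_family A B \<epsilon> F" and t: "\<bar>t\<bar> < \<epsilon>"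
  defines "w \<equiv> \<lambda>t p. hor_norm_sq A g H m B h (F t) p"
  defines "w1 \<equiv> \<lambda>t p. deriv (\<lambda>s. w s p) t"
  defines "w2 \<equiv> \<lambda>t p. deriv (\<lambda>s. w1 s p) t"
  shows "((\<lambda>t. energy (F t)) has_real_derivative (LINT p|dv. exp (w t p / 2) * (w1 t p / 2))) (at t)"
    and "((\<lambda>t. LINT p|dv. exp (w t p / 2) * (w1 t p / 2)) has_real_derivative
      (LINT p|dv. exp (w t p / 2) * ((w1 t p / 2)\<^sup>2 + w2 t p / 2))) (at t)"
    and "integrable dv (\<lambda>p. exp (w t p / 2) * (w1 t p / 2))"
    and "integrable dv (\<lambda>p. exp (w t p / 2) * ((w1 t p / 2)\<^sup>2 + w2 t p / 2))"
proof -
  have C: "C1_in_time \<epsilon> w w1" "C1_in_time \<epsilon> w1 w2"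
    using density_C1[OF A g H B h F] unfolding w_def w1_def w2_def by blast+
  note E = C1_in_time_exp_half[OF C]
  show "((\<lambda>t. energy (F t)) has_real_derivative (LINT p|dv. exp (w t p / 2) * (w1 t p / 2))) (at t)"
    using integral_has_time_derivative[OF fin borel compact E(1) t] by (simp add: exp_energy_def w_def)
  show "((\<lambda>t. LINT p|dv. exp (w t p / 2) * (w1 t p / 2)) has_real_derivative
      (LINT p|dv. exp (w t p / 2) * ((w1 t p / 2)\<^sup>2 + w2 t p / 2))) (at t)"
    by (rule integral_has_time_derivative[OF fin borel compact E(2) t])
  show "integrable dv (\<lambda>p. exp (w t p / 2) * (w1 t p / 2))"
    "integrable dv (\<lambda>p. exp (w t p / 2) * ((w1 t p / 2)\<^sup>2 + w2 t p / 2))"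
    using continuous_integrable[OF fin borel compact] C1_in_time_slice[OF fin borel compact E(2) t] by blast+
qed

lemma energy_first_variation:
  assumes F: "smooth_family A B \<epsilon> F" "F 0 = f" "\<epsilon> > 0"
  shows "((\<lambda>t. energy (F t)) has_real_derivative (LINT p|dv. variation_density (variation_field B F) p)) (at 0)"
    and "integrable dv (variation_density (variation_field B F))"
proof -
  have D0: "pullback_connection A B (F 0) nabla D"
    using D F by simp
  have "variation_density (variation_field B F) = (\<lambda>p. exp (hor_norm_sq A g H m B h (F 0) p / 2) *
      (deriv (\<lambda>t. hor_norm_sq A g H m B h (F t) p) 0 / 2))"
    using density_variations(1)[OF A g H B h F(1,3) lc D0 e] F(2) by (intro ext)
        (simp add: variation_density_def)
  then show "((\<lambda>t. energy (F t)) has_real_derivative (LINT p|dv. variation_density (variation_field B F) p)) (at 0)"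
    "integrable dv (variation_density (variation_field B F))"
    using energy_derivatives(1,3)[OF F(1), of 0] F(3) by simp_all
qed

lemma compactly_supported_compact: "compactly_supported (W :: 'a \<Rightarrow> 'n)"
  unfolding compactly_supported_def using compact_Int_closed[OF compact closed_closure] by simp

text \<open>
  Localized fields \<open>\<psi> W\<close> are variation fields, so their first variation vanishes; an arbitrary section
  is peeled off into finitely many localized ones.
\<close>

lemma variation_density_integral_zero:
  assumes f: "exp_subelliptic_harmonic A g H m dv B h f" and W: "W \<in> sections A B f"
  shows "integrable dv (variation_density W) \<and> (LINT p|dv. variation_density W p) = 0"
proof -
  have fs: "smooth_map A B f"
    using f by (simp add: exp_subelliptic_harmonic_def)
  \<comment> \<open>A cut-off is good if it makes every section a variation field. Quantifying over
    all sections matters: the same cut-off is later applied to the remainders.\<close>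
  define good where "good \<psi> \<longleftrightarrow> smooth_fun B \<psi> \<and> (\<forall>W\<in>sections A B f. \<exists>\<epsilon> G. \<epsilon> > 0 \<and>
      smooth_family A B \<epsilon> G \<and> G 0 = f \<and> variation_field B G = (\<lambda>p. \<psi> (f p) *\<^sub>R W p))" for \<psi>
  have "\<exists>U \<psi>. open U \<and> q \<in> U \<and> (\<forall>r\<in>U. \<psi> r = 1) \<and> good \<psi>" for q
  proof -
    obtain r U K \<psi> where b: "r > 0" "cball (snd (chart_at B q) q) (3 * r) \<subseteq> snd (chart_at B q) ` fst (chart_at B q)"
      "q \<in> U" "snd (chart_at B q) ` K \<subseteq> cball (snd (chart_at B q) q) (2 * r)" "bump_in B (chart_at B q) U K \<psi>"
      by (rule bump_exists[OF B chart_at_in[OF B] chart_at_mem[OF B]])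
    have "good \<psi>"
      unfolding good_def
    proof (intro conjI ballI)
      show "smooth_fun B \<psi>"
        using b(5) by (simp add: bump_in_def)
      fix W assume "W \<in> sections A B f"
      from cut_family_exists[OF A B fs compact b(5,1,2,4) this]
      show "\<exists>\<epsilon> G. \<epsilon> > 0 \<and> smooth_family A B \<epsilon> G \<and> G 0 = f \<and> variation_field B G = (\<lambda>p. \<psi> (f p) *\<^sub>R W p)"
        by metis
    qed
    then show ?thesis
      using b(3,5) by (auto simp: bump_in_def)
  qed
  then obtain U \<psi> where U: "\<And>q. open (U q)" "\<And>q. q \<in> U q" "\<And>q r. r \<in> U q \<Longrightarrow> \<psi> q r = (1::real)" "\<And>q. good (\<psi> q)"
    by metis
  have "compact (range f)"
    using smooth_map_continuous[OF A B fs] compact by (rule compact_continuous_image)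
  then obtain Q where Q: "finite Q" "range f \<subseteq> (\<Union>q\<in>Q. U q)"
    using compactE_image[of "range f" UNIV U] U by (metis UNIV_I UN_I subsetI)
  have D_add: "D p v (\<lambda>q. V q + W q) = D p v V + D p v W" if "V \<in> sections A B f" "W \<in> sections A B f"
      for p v V W
    using D that unfolding pullback_connection_def by blast
  have hb: "linear (\<lambda>u. h q u w)" for q w
    using h by (simp add: riemannian_metric_def bilinear_def)
  have add: "variation_density (\<lambda>q. V q + W q) p = variation_density V p + variation_density W p"
    if "V \<in> sections A B f" "W \<in> sections A B f" for V W p
    by (simp add: variation_density_def D_add[OF that] linear_add[OF hb] sum.distrib distrib_left)
  have zero: "variation_density (\<lambda>q. 0) p = 0" for p
    using add[OF sections_zero[OF A B fs] sections_zero[OF A B fs]] by simp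
  \<comment> \<open>Generalised to sections that vanish wherever no cut-off indexed by
    \<open>Q\<close> equals 1. The remainder after removing one localized part vanishes where that
    cut-off is 1, so it meets the condition for the smaller index set.\<close>
  have "integrable dv (variation_density W) \<and> (LINT p|dv. variation_density W p) = 0"
    if "W \<in> sections A B f" "\<And>p. W p = 0 \<or> (\<exists>q\<in>Q. \<psi> q (f p) = 1)" for W
    using Q(1) that
  proof (induction Q arbitrary: W rule: finite_induct)
    case empty
    then have "W = (\<lambda>q. 0)"
      by auto
    then show ?case
      by (simp add: zero)
  next
    case (insert q Q)
    let ?V = "\<lambda>p. \<psi> q (f p) *\<^sub>R W p" and ?V' = "\<lambda>p. (1 - \<psi> q (f p)) *\<^sub>R W p"
    have sf: "smooth_fun A (\<lambda>p. \<psi> q (f p))"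
      using U(4)[of q] by (intro smooth_fun_compose[OF A B fs]) (simp add: good_def)
    have V: "?V \<in> sections A B f" "?V' \<in> sections A B f"
      by (intro sections_scale[OF A B fs] sf smooth_fun_one_minus[OF A] insert.prems)+
    obtain \<epsilon> G where G: "\<epsilon> > 0" "smooth_family A B \<epsilon> G" "G 0 = f" "variation_field B G = ?V"
      using U(4)[of q] insert.prems(1) unfolding good_def by blast
    have "((\<lambda>t. energy (G t)) has_real_derivative 0) (at 0)"
      using f G compactly_supported_compact unfolding exp_subelliptic_harmonic_def by blast
    \<comment> \<open>The same derivative is zero by harmonicity and equals the integral of the
      density, so the integral vanishes.\<close>
    then have 1: "integrable dv (variation_density ?V)" "(LINT p|dv. variation_density ?V p) = 0"
      using energy_first_variation[OF G(2,3,1)] DERIV_unique unfolding G(4) by blast+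
    have "?V' p = 0 \<or> (\<exists>q\<in>Q. \<psi> q (f p) = 1)" for p
      using insert.prems(2)[of p] by auto
    from insert.IH[OF V(2) this]
    have 2: "integrable dv (variation_density ?V')" "(LINT p|dv. variation_density ?V' p) = 0"
      by auto
    have "variation_density W = (\<lambda>p. variation_density ?V p + variation_density ?V' p)"
      unfolding add[OF V, symmetric] by (simp add: scaleR_diff_left)
    then show ?case
      using 1 2 by simp
  qed
  moreover have "\<exists>q\<in>Q. \<psi> q (f p) = 1" for p
    using Q(2) U(3) by blast
  ultimately show ?thesis
    using W by blast
qed

text \<open>Criticality enters only through the acceleration term, whose integral is the first
  variation along the section \<open>a\<close>.\<close>

lemma energy_second_variation:
  assumes f: "exp_subelliptic_harmonic A g H m dv B h f"
    and F: "smooth_family A B \<epsilon> F" "F 0 = f" "\<epsilon> > 0"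
  defines "V \<equiv> variation_field B F"
  shows "(deriv (\<lambda>s. energy (F s)) has_real_derivative
      (LINT p|dv. exp (hor_norm_sq A g H m B h f p / 2) *
        ((\<Sum>i<m. h (f p) (D p (e p i) V) (differential A B f p (e p i)))\<^sup>2
         + (\<Sum>i<m. h (f p) (D p (e p i) V) (D p (e p i) V))
         - (\<Sum>i<m. h (f p)
               (curvature_tensor B nabla (f p) (differential A B f p (e p i)) (V p) (V p))
               (differential A B f p (e p i)))))) (at 0)"
    (is "(_ has_real_derivative (LINT p|dv. ?T p)) _")
proof -
  define w where "w = (\<lambda>t p. hor_norm_sq A g H m B h (F t) p)"
  define w1 where "w1 = (\<lambda>t p. deriv (\<lambda>s. w s p) t)"
  define w2 where "w2 = (\<lambda>t p. deriv (\<lambda>s. w1 s p) t)"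
  define a where "a = acceleration B nabla F"
  have E: "((\<lambda>t. energy (F t)) has_real_derivative (LINT p|dv. exp (w t p / 2) * (w1 t p / 2))) (at t)"
    "((\<lambda>t. LINT p|dv. exp (w t p / 2) * (w1 t p / 2)) has_real_derivative
      (LINT p|dv. exp (w t p / 2) * ((w1 t p / 2)\<^sup>2 + w2 t p / 2))) (at t)"
    "integrable dv (\<lambda>p. exp (w t p / 2) * ((w1 t p / 2)\<^sup>2 + w2 t p / 2))" if "\<bar>t\<bar> < \<epsilon>" for t
    unfolding w2_def w1_def w_def using energy_derivatives[OF F(1) that] by blast+
  have D0: "pullback_connection A B (F 0) nabla D"
    using D F by simp
  have a: "a \<in> sections A B f"
    using acceleration_section[OF A B F(1,3) lc_affine[OF B h lc]] F(2) by (simp add: a_def)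
  note a0 = variation_density_integral_zero[OF f a]
  \<comment> \<open>The factors 2 in \<open>density_variations\<close> cancel the halves in the
    exponent; what remains beyond the asserted integrand is exactly the density of
    \<open>a\<close>.\<close>
  have T: "?T p = exp (w 0 p / 2) * ((w1 0 p / 2)\<^sup>2 + w2 0 p / 2) - variation_density a p" for p
    unfolding w2_def w1_def w_def variation_density_def a_def V_def
      density_variations[OF A g H B h F(1,3) lc D0 e] F(2)
    by (simp add: algebra_simps add_divide_distrib diff_divide_distrib)
  have "(LINT p|dv. ?T p) = (LINT p|dv. exp (w 0 p / 2) * ((w1 0 p / 2)\<^sup>2 + w2 0 p / 2))
      - (LINT p|dv. variation_density a p)"
    unfolding T using E(3)[of 0] F(3) a0 by (intro Bochner_Integration.integral_diff) auto
  then have "((\<lambda>t. LINT p|dv. exp (w t p / 2) * (w1 t p / 2)) has_real_derivative (LINT p|dv. ?T p)) (at 0)"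
    using E(2)[of 0] F(3) a0 by simp
  \<comment> \<open>The integral formula equals the first derivative of the energy on the whole
    interval, so its derivative at 0 is the second derivative.\<close>
  then show ?thesis
  proof (rule has_field_derivative_transform_within_open)
    show "open {-\<epsilon><..<\<epsilon>}" "0 \<in> {-\<epsilon><..<\<epsilon>}"
      using F(3) by auto
    show "(LINT p|dv. exp (w t p / 2) * (w1 t p / 2)) = deriv (\<lambda>s. energy (F s)) t" if "t \<in> {-\<epsilon><..<\<epsilon>}" for t
      using that by (intro DERIV_imp_deriv[symmetric] E(1)) auto
  qed
qed

end

text \<open>The differentiability claim guarantees that \<open>deriv\<close> in the second conjunct
  is a genuine derivative on the whole interval, so the conclusion is a statement about the actual
  second derivative.\<close>

theorem theorem2p4:
  fixes A :: "('a::{t2_space,second_countable_topology}, real^'k) chart set"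
    and g :: "'a \<Rightarrow> real^'k \<Rightarrow> real^'k \<Rightarrow> real"
    and H :: "'a \<Rightarrow> (real^'k) set"
    and m d :: nat
    and dv :: "'a measure"
    and B :: "('b::{t2_space,second_countable_topology}, real^'n) chart set"
    and h :: "'b \<Rightarrow> real^'n \<Rightarrow> real^'n \<Rightarrow> real"
    and nabla :: "('b \<Rightarrow> real^'n) \<Rightarrow> ('b \<Rightarrow> real^'n) \<Rightarrow> 'b \<Rightarrow> real^'n"
    and f :: "'a \<Rightarrow> 'b"
    and D :: "'a \<Rightarrow> real^'k \<Rightarrow> ('a \<Rightarrow> real^'n) \<Rightarrow> real^'n"
    and F :: "real \<Rightarrow> 'a \<Rightarrow> 'b"
    and \<epsilon> :: real
    and V :: "'a \<Rightarrow> real^'n"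
    and e :: "'a \<Rightarrow> nat \<Rightarrow> real^'k"
  assumes M: "riemannian_manifold A g" "compact (UNIV :: 'a set)" "connected (UNIV :: 'a set)"
    and dim_M: "CARD('k) = m + d"
    and H: "smooth_subbundle A H m"
    and dv: "riemannian_volume A g dv"
    and N: "riemannian_manifold B h"
    and nabla: "levi_civita_connection B h nabla"
    and f: "exp_subelliptic_harmonic A g H m dv B h f"
    and D: "pullback_connection A B f nabla D"
    and F: "\<epsilon> > 0" "smooth_family A B \<epsilon> F" "F 0 = f"
    and V: "V = variation_field B F" "compactly_supported V"
    and e: "\<And>p. orthonormal_frame_at g H m p (e p)"
  shows "(\<forall>t. \<bar>t\<bar> < \<epsilon> \<longrightarrow> (\<lambda>s. exp_energy A g H m dv B h (F s)) differentiable (at t)) \<and>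
    (deriv (\<lambda>s. exp_energy A g H m dv B h (F s)) has_real_derivative
      (LINT p|dv. exp (hor_norm_sq A g H m B h f p / 2) *
        ((\<Sum>i<m. h (f p) (D p (e p i) V) (differential A B f p (e p i)))\<^sup>2
         + (\<Sum>i<m. h (f p) (D p (e p i) V) (D p (e p i) V))
         - (\<Sum>i<m. h (f p)
               (curvature_tensor B nabla (f p) (differential A B f p (e p i)) (V p) (V p))
               (differential A B f p (e p i))))))
      (at 0)"
proof -
  have A: "smooth_manifold A" and g: "riemannian_metric A g" and B: "smooth_manifold B"
      and h: "riemannian_metric B h"
    using M(1) N by (simp_all add: riemannian_manifold_def)
  have fin: "finite_measure dv"
    by (rule riemannian_volume_finite[OF A g dv M(2)])
  have borel: "sets dv = sets borel"
    using dv by (simp add: riemannian_volume_def)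
  note base = A g H B h M(2) fin borel nabla D e
  have "(\<lambda>s. exp_energy A g H m dv B h (F s)) differentiable (at t)" if "\<bar>t\<bar> < \<epsilon>" for t
    using energy_derivatives(1)[OF base F(2) that] real_differentiable_def by blast
  then show ?thesis
    using energy_second_variation[OF base f F(2,3,1)] unfolding V(1) by blast
qed

end
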